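(* Let $G$ be a Cayley graph of an infinite, finitely generated group with respect to a finite generating set. Let $\mu$ be a non-atomic probability measure supported on $[0,\infty)$ with finite mean. Then for every $x\in G$, \[ \widehat{\mathbf P}\big[|\widehat T(x)|<\infty\big]=1\qquad\text{and}\qquad \overline{\mathbf P}\big[|\overline T(x)|<\infty\big]=1 , \] where $\widehat T(x)$ and $\overline T(x)$ are the geodesic trees rooted at $(x,0)$ in the directed graph $\widehat G$ and in the undirected graph $\overline G$, respectively, with i.i.d. edge weights of law $\mu$.
   Context: Cayley graph: vertices are the group elements, and $x,y$ are neighbors iff $y=xs$ for some $s$ in a fixed finite symmetric generating set not containing the identity. $\mathbb Z_+=\{0,1,2,\dots\}$. Directed graph $\widehat G$: vertex set $G\times\mathbb Z_+$; there is a directed edge from $(y,n+1)$ to $(x,n)$ for every $n\ge 0$ and every pair of neighbors $x,y$ in $G$; no other edges. Paths in $\widehat G$ are directed. Undirected graph $\overline G$: vertex set $G\times\mathbb Z_+$; $(x,m)$ and $(y,n)$ are joined by an edge iff either $x,y$ are neighbors in $G$ and $m=n\ge 1$, or $x=y$ and $|m-n|=1$. (There are no edges inside level $0$.) $G$ is identified with level $0$, i.e. with $\{(x,0):x\in G\}$. The edges of $\widehat G$ (resp. $\overline G$) carry i.i.d. weights $\omega(e)$ with law $\mu$; the product measure is $\widehat{\mathbf P}$ (resp. $\overline{\mathbf P}$). For a (directed, in the case of $\widehat G$) path $\gamma$ put $\lambda(\gamma)=\sum_{e\in\gamma}\omega(e)$; the passage time $d_\omega(u,v)$ is the infimum of $\lambda(\gamma)$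 over paths $\gamma$ from $u$ to $v$ ($\infty$ if there is none), and $d_\omega(u,G)=\inf_{x\in G}d_\omega(u,(x,0))$. These are denoted $\widehat d_\omega$ in $\widehat G$ and $\overline d_\omega$ in $\overline G$. Since $\mu$ has no atoms, almost surely each vertex $u$ has a unique path (geodesic) to $G$ with weight $d_\omega(u,G)$. For $x\in G$, the tree $T(x)$ ($\widehat T(x)$ in $\widehat G$, $\overline T(x)$ in $\overline G$) is the union of all geodesics from vertices $u$ to $G$ that end at $(x,0)$; $|T(x)|$ is its number of vertices (the trivial path shows $(x,0)\in T(x)$). *)

theory Defs
  imports
    "HOL-Probability.Probability"
    "HOL-Algebra.Generated_Groups"
    "Graph_Theory.Arc_Walk"
begin

section \<open>First-passage percolation on a weighted digraph\<close>

definition path_weight :: "('b \<Rightarrow> real) \<Rightarrow> 'b awalk \<Rightarrow> real" where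
  "path_weight c p = (\<Sum>e\<leftarrow>p. c e)"

context pre_digraph
begin

text \<open>
  The infimum is taken in the extended reals, so that the passage time is \<open>\<infinity>\<close> when there is
  no path. Paths are the library's \<open>apath\<close>s: finite directed walks without repeated vertices,
  given by their list of arcs.
\<close>

definition passage_time :: "('b \<Rightarrow> real) \<Rightarrow> 'a \<Rightarrow> 'a \<Rightarrow> ereal" where
  "passage_time c u v = (INF p\<in>{p. apath u p v}. ereal (path_weight c p))"

definition passage_time_set :: "('b \<Rightarrow> real) \<Rightarrow> 'a \<Rightarrow> 'a set \<Rightarrow> ereal" where
  "passage_time_set c u A = (INF v\<in>A. passage_time c u v)"

definition geodesic_to_set :: "('b \<Rightarrow> real) \<Rightarrow> 'a set \<Rightarrow> 'a \<Rightarrow> 'b awalk \<Rightarrow> 'a \<Rightarrow> bool" where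
  "geodesic_to_set c A u p v \<longleftrightarrow>
     v \<in> A \<and> apath u p v \<and> ereal (path_weight c p) = passage_time_set c u A"

definition geodesic_tree :: "('b \<Rightarrow> real) \<Rightarrow> 'a set \<Rightarrow> 'a \<Rightarrow> 'a set" where
  "geodesic_tree c A v = (\<Union>{set (awalk_verts u p) | u p. geodesic_to_set c A u p v})"

end

section \<open>The graphs over a Cayley graph\<close>

definition cayley_nbr :: "('g, 'm) monoid_scheme \<Rightarrow> 'g set \<Rightarrow> 'g \<Rightarrow> 'g \<Rightarrow> bool" where
  "cayley_nbr G S x y \<longleftrightarrow>
     x \<in> carrier G \<and> y \<in> carrier G \<and> (\<exists>s\<in>S. y = x \<otimes>\<^bsub>G\<^esub> s)"

definition level0 :: "('g, 'm) monoid_scheme \<Rightarrow> ('g \<times> nat) set" where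
  "level0 G = carrier G \<times> {0}"

definition hat_graph ::
  "('g, 'm) monoid_scheme \<Rightarrow> 'g set \<Rightarrow>
     ('g \<times> nat, ('g \<times> nat) \<times> ('g \<times> nat)) pre_digraph" where
  "hat_graph G S =
     \<lparr> verts = carrier G \<times> UNIV,
       arcs = {((y, Suc n), (x, n)) | x y n. cayley_nbr G S x y},
       tail = fst, head = snd \<rparr>"

definition bar_adj ::
  "('g, 'm) monoid_scheme \<Rightarrow> 'g set \<Rightarrow> 'g \<times> nat \<Rightarrow> 'g \<times> nat \<Rightarrow> bool" where
  "bar_adj G S = (\<lambda>(x, m) (y, n).
     cayley_nbr G S x y \<and> m = n \<and> n \<ge> 1 \<or>
     x \<in> carrier G \<and> x = y \<and> \<bar>int m - int n\<bar> = 1)"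

text \<open>
  The undirected graph is represented by the digraph containing both orientations of every
  edge. The random weights are nevertheless indexed by the undirected edges, i.e. by two-element
  vertex sets, so that both orientations carry the same weight.
\<close>

definition bar_graph ::
  "('g, 'm) monoid_scheme \<Rightarrow> 'g set \<Rightarrow>
     ('g \<times> nat, ('g \<times> nat) \<times> ('g \<times> nat)) pre_digraph" where
  "bar_graph G S =
     \<lparr> verts = carrier G \<times> UNIV,
       arcs = {(u, v). bar_adj G S u v},
       tail = fst, head = snd \<rparr>"

definition bar_edges :: "('g, 'm) monoid_scheme \<Rightarrow> 'g set \<Rightarrow> ('g \<times> nat) set set" where
  "bar_edges G S = {{u, v} | u v. bar_adj G S u v}"

section \<open>Random weights and geodesic trees\<close>

definition hat_P ::
  "('g, 'm) monoid_scheme \<Rightarrow> 'g set \<Rightarrow> real measure \<Rightarrow>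
     (('g \<times> nat) \<times> ('g \<times> nat) \<Rightarrow> real) measure" where
  "hat_P G S \<mu> = (\<Pi>\<^sub>M e\<in>arcs (hat_graph G S). \<mu>)"

definition bar_P ::
  "('g, 'm) monoid_scheme \<Rightarrow> 'g set \<Rightarrow> real measure \<Rightarrow> (('g \<times> nat) set \<Rightarrow> real) measure" where
  "bar_P G S \<mu> = (\<Pi>\<^sub>M e\<in>bar_edges G S. \<mu>)"

definition hat_tree ::
  "('g, 'm) monoid_scheme \<Rightarrow> 'g set \<Rightarrow> (('g \<times> nat) \<times> ('g \<times> nat) \<Rightarrow> real) \<Rightarrow>
     'g \<Rightarrow> ('g \<times> nat) set" where
  "hat_tree G S \<omega> x = pre_digraph.geodesic_tree (hat_graph G S) \<omega> (level0 G) (x, 0)"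

definition bar_tree ::
  "('g, 'm) monoid_scheme \<Rightarrow> 'g set \<Rightarrow> (('g \<times> nat) set \<Rightarrow> real) \<Rightarrow>
     'g \<Rightarrow> ('g \<times> nat) set" where
  "bar_tree G S \<omega> x =
     pre_digraph.geodesic_tree (bar_graph G S) (\<lambda>(u, v). \<omega> {u, v}) (level0 G) (x, 0)"

text \<open>An atom is a set of positive measure without measurable subsets of intermediate measure.\<close>

definition nonatomic :: "'a measure \<Rightarrow> bool" where
  "nonatomic M \<longleftrightarrow>
     (\<forall>A\<in>sets M. emeasure M A > 0 \<longrightarrow>
        (\<exists>B\<in>sets M. B \<subseteq> A \<and> 0 < emeasure M B \<and> emeasure M B < emeasure M A))"

end

theory Submission
  imports Defs
begin

text \<open>
  By mass transport the number of vertices of \<open>T(x)\<close> on a given level has mean at most \<open>1\<close>. Hence it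
  remains to exclude that, with positive probability, \<open>T(x)\<close> reaches every level. Suppose it does.
  Then for suitable levels \<open>n\<close> and \<open>N\<close> with \<open>n \<le> N \<le> 2 n\<close> the following holds with high probability:
  \<open>T(x)\<close> has few vertices on the levels near \<open>n\<close>, each vertex of \<open>T(x)\<close> on level \<open>n\<close> is close to vertices
  outside \<open>T(x)\<close> (bounded connected pieces are larger than the tree), from which the passage time
  is larger by a bounded amount only, and geodesics from level \<open>N\<close> go from level \<open>n\<close> to level \<open>n - q\<close> in
  boundedly many steps (most levels have this property, since the geodesics have length \<open>O(N)\<close>).
  If \<open>q\<close> is large, lowering the large weights on the first arcs of the geodesics of these outside vertices saves
  more than the excess, so that no geodesic from level \<open>N\<close> ends at \<open>x\<close> any more. The lowered arcs are boundedly many and lie in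
  a region that depends only on the tree up to level \<open>n - q\<close>, so resampling that region shows that a
  tree alive at level \<open>n - q\<close> is dead at level \<open>N\<close> with probability bounded below. This contradicts the
  convergence of the probability that \<open>T(x)\<close> reaches level \<open>n\<close>.
\<close>

section \<open>Walks and geodesics in layered graphs\<close>

text \<open>The law may have bounded support, so no single weight can be counted on to cut off a
  tree; many moderate changes are combined instead. The numbers \<open>lo\<close> and
  \<open>hi\<close> serve this purpose. Weights below \<open>hi\<close> are so rare that, by
  counting paths, every long path carries many weights of at least \<open>hi\<close>. Lowering one
  of them to at most \<open>lo\<close> saves at least \<open>hi - lo\<close> and has a probability
  bounded below. That the excess is bounded at most levels is not a local fact: mean passage times
  grow at most linearly, so their increments telescope over a block of levels between
  \<open>a\<close> and \<open>2 * a\<close> and are bounded on average. In the undirected graph a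
  geodesic may climb again before it reaches level 0. Survival is therefore tested in graphs
  truncated at a level: survival to level \<open>n\<close> is then determined by the weights up to
  level \<open>n\<close>, is monotone in \<open>n\<close>, and is implied by the existence of a tree
  vertex of the full graph on or above level \<open>n\<close>.\<close>

type_synonym 'g vertex = "'g \<times> nat"
type_synonym 'g arc = "'g vertex \<times> 'g vertex"

text \<open>Common frame for both graphs: \<open>\<kappa>\<close> sends an arc to the edge whose
  random weight it carries, which is the arc itself in the directed graph and the two-element vertex
  set in the undirected one. \<open>root_arcs\<close> prevents paths from passing through level 0:
  in the directed graph no arc leaves that level, and in the undirected graph (x, 0) has the single
  neighbour (x, 1).\<close>

locale layered_graph =
  fixes G :: "('g, 'm) monoid_scheme" (structure)
    and E :: "'g arc set"
    and \<kappa> :: "'g arc \<Rightarrow> 'e"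
  assumes arcs_carrier: "((y, i), (z, j)) \<in> E \<Longrightarrow> y \<in> carrier G \<and> z \<in> carrier G"
    and arcs_level: "((y, i), (z, j)) \<in> E \<Longrightarrow> i \<le> Suc j \<and> j \<le> Suc i"
    and descend: "y \<in> carrier G \<Longrightarrow> \<exists>z. ((y, Suc i), (z, i)) \<in> E"
    and label_eq: "a \<in> E \<Longrightarrow> b \<in> E \<Longrightarrow> \<kappa> a = \<kappa> b \<Longrightarrow> b = a \<or> b = (snd a, fst a)"
    and root_arcs: "((x, 0), v) \<in> E \<Longrightarrow> (u, (x, 0)) \<in> E \<Longrightarrow> u = v"
begin

declare split_paired_All [simp del] split_paired_Ex [simp del]

abbreviation V :: "'g vertex set" where "V \<equiv> carrier G \<times> UNIV"

text \<open>Here \<open>B\<close> is the set of admissible levels; \<open>{..n}\<close> gives the graph truncated at level \<open>n\<close>.\<close>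

primrec walk :: "nat set \<Rightarrow> 'g vertex \<Rightarrow> 'g arc list \<Rightarrow> 'g vertex \<Rightarrow> bool" where
  "walk B u [] v \<longleftrightarrow> u = v \<and> u \<in> carrier G \<times> B"
| "walk B u (e # p) v \<longleftrightarrow> e \<in> E \<and> fst e = u \<and> snd u \<in> B \<and> walk B (snd e) p v"

definition path :: "'g vertex \<Rightarrow> 'g arc list \<Rightarrow> 'g vertex \<Rightarrow> bool" where
  "path u p v \<longleftrightarrow> walk UNIV u p v \<and> distinct (u # map snd p)"

definition weight :: "('e \<Rightarrow> real) \<Rightarrow> 'g arc list \<Rightarrow> real" where
  "weight \<omega> p = (\<Sum>e\<leftarrow>p. \<omega> (\<kappa> e))"

text \<open>The competitors are all walks, not only paths, so that suffixes and concatenations can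
  be compared directly. Positivity of the weights makes a minimiser a path afterwards, see
  \<open>geod_distinct\<close>.\<close>

definition geod :: "nat set \<Rightarrow> ('e \<Rightarrow> real) \<Rightarrow> 'g vertex \<Rightarrow>
    'g arc list \<Rightarrow> 'g vertex \<Rightarrow> bool" where
  "geod B \<omega> u p v \<longleftrightarrow> walk B u p v \<and> snd v = 0 \<and>
     (\<forall>q w. walk B u q w \<and> snd w = 0 \<longrightarrow> weight \<omega> p \<le> weight \<omega> q)"

definition root :: "nat set \<Rightarrow> ('e \<Rightarrow> real) \<Rightarrow> 'g vertex \<Rightarrow> 'g vertex \<Rightarrow> bool" where
  "root B \<omega> u v \<longleftrightarrow> (\<exists>p. geod B \<omega> u p v)"

text \<open>The truncation at \<open>n\<close> makes this a condition on the weights up to level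
  \<open>n\<close> alone.\<close>

definition alive :: "nat \<Rightarrow> ('e \<Rightarrow> real) \<Rightarrow> 'g vertex \<Rightarrow> bool" where
  "alive n \<omega> v \<longleftrightarrow> (\<exists>y. root {..n} \<omega> (y, n) v)"

text \<open>The second clause stands in for compactness: only finitely many paths can compete for
  the minimum. The third excludes ties between different endpoints on level 0, so the root of a
  vertex is unique while several geodesics to that root are tolerated.\<close>

definition good :: "('e \<Rightarrow> real) \<Rightarrow> bool" where
  "good \<omega> \<longleftrightarrow> (\<forall>e\<in>E. 0 < \<omega> (\<kappa> e)) \<and>
     (\<forall>u t. \<exists>L. \<forall>p v. path u p v \<and> L \<le> length p \<longrightarrow> t < weight \<omega> p) \<and>
     (\<forall>u p v q w. path u p v \<and> path u q w \<and> snd v = 0 \<and> snd w = 0 \<and> v \<noteq> w \<longrightarrow>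
        weight \<omega> p \<noteq> weight \<omega> q)"

text \<open>Because the last piece stays on levels up to \<open>m\<close>, the vertex
  \<open>w\<close> of a geodesic belongs to the tree of the graph truncated at \<open>m\<close>. The
  middle piece then bounds the distance of \<open>u\<close> from that smaller tree.\<close>

definition near_walk :: "nat set \<Rightarrow> nat \<Rightarrow> nat \<Rightarrow> nat \<Rightarrow> 'g vertex \<Rightarrow> 'g arc list \<Rightarrow> 'g vertex \<Rightarrow> bool" where
  "near_walk B \<rho> n m U p v \<longleftrightarrow> (\<exists>p0 p1 p2 u w. p = p0 @ p1 @ p2 \<and>
     walk B U p0 u \<and> snd u = n \<and> walk B u p1 w \<and> length p1 \<le> \<rho> \<and> snd w = m \<and> walk {..m} w p2 v)"

definition near :: "nat set \<Rightarrow> ('e \<Rightarrow> real) \<Rightarrow> nat \<Rightarrow> nat \<Rightarrow> nat \<Rightarrow> 'g vertex \<Rightarrow> bool" where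
  "near B \<omega> \<rho> n m U \<longleftrightarrow> (\<exists>p v. geod B \<omega> U p v \<and> near_walk B \<rho> n m U p v)"

section \<open>Elementary operations on walks and paths\<close>

lemma arcs_simps:
  assumes "e \<in> E"
  shows "fst (fst e) \<in> carrier G" "fst (snd e) \<in> carrier G"
    "snd (fst e) \<le> Suc (snd (snd e))" "snd (snd e) \<le> Suc (snd (fst e))"
  using assms arcs_carrier arcs_level by (metis prod.collapse)+

lemma weight_simps [simp]:
  "weight \<omega> [] = 0" "weight \<omega> (e # p) = \<omega> (\<kappa> e) + weight \<omega> p"
  "weight \<omega> (p @ q) = weight \<omega> p + weight \<omega> q"
  by (simp_all add: weight_def)

lemma walk_append: "walk B u (p @ q) v \<longleftrightarrow> (\<exists>w. walk B u p w \<and> walk B w q v)"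
proof (induction p arbitrary: u)
  case Nil
  then show ?case by (cases q) (auto simp: mem_Times_iff dest: arcs_simps)
qed auto

lemma walk_appendI: "walk B u p w \<Longrightarrow> walk B w q v \<Longrightarrow> walk B u (p @ q) v"
  by (auto simp: walk_append)

lemma walk_mono: "walk B u p v \<Longrightarrow> B \<subseteq> B' \<Longrightarrow> walk B' u p v"
  by (induction p arbitrary: u) auto

lemma walk_end: "walk B u p v \<Longrightarrow> v \<in> carrier G \<times> B"
  by (induction p arbitrary: u) auto

lemma walk_start: "walk B u p v \<Longrightarrow> u \<in> carrier G \<times> B"
  by (cases p) (auto simp: mem_Times_iff dest: arcs_simps)

lemma walk_arcs: "walk B u p v \<Longrightarrow> e \<in> set p \<Longrightarrow> e \<in> E \<and> snd (fst e) \<in> B \<and> snd (snd e) \<in> B"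
  by (induction p arbitrary: u) (auto dest: walk_start)

lemma walk_subset: "walk B u p v \<Longrightarrow> set p \<subseteq> E"
  using walk_arcs by blast

lemma walk_last: "walk B u p v \<Longrightarrow> v = last (u # map snd p)"
  by (induction p arbitrary: u) (auto split: if_splits)

lemma walk_unique: "walk B u p v \<Longrightarrow> walk B' u p v' \<Longrightarrow> v = v'"
  by (metis walk_last)

lemma walk_take: 
  assumes "walk B u p v" "i \<le> length p"
  shows "walk B u (take i p) ((u # map snd p) ! i)" "walk B ((u # map snd p) ! i) (drop i p) v"
proof -
  obtain w where w: "walk B u (take i p) w" "walk B w (drop i p) v"
    using assms walk_append[of B u "take i p" "drop i p" v] by auto
  have "last (u # map snd (take i p)) = last (take (Suc i) (u # map snd p))"
    by (simp add: take_map)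
  also have "\<dots> = (u # map snd p) ! i"
    using assms by (subst take_Suc_conv_app_nth) auto
  finally have "w = (u # map snd p) ! i"
    using walk_last[OF w(1)] by simp
  with w show "walk B u (take i p) ((u # map snd p) ! i)" "walk B ((u # map snd p) ! i) (drop i p) v"
    by auto
qed

lemma walk_through:
  assumes "walk B u p v" "z \<in> set (u # map snd p)"
  obtains p1 p2 where "p = p1 @ p2" "walk B u p1 z" "walk B z p2 v"
proof -
  obtain i where i: "i < length (u # map snd p)" "(u # map snd p) ! i = z"
    using assms(2) by (metis in_set_conv_nth)
  with walk_take[OF assms(1), of i] that[of "take i p" "drop i p"] show ?thesis by auto
qed

lemma walk_arc_through:
  assumes "walk B u p v" "e \<in> set p"
  shows "fst e \<in> set (u # map snd p)" "snd e \<in> set (u # map snd p)"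
  using assms by (induction p arbitrary: u) auto

lemma walk_levels:
  "walk B u p v \<Longrightarrow> snd u \<le> snd v + length p"
  by (induction p arbitrary: u) (force dest: arcs_simps)+

lemma walk_descend:
  "y \<in> carrier G \<Longrightarrow> \<exists>p z. walk {..n} (y, n) p (z, 0) \<and> length p = n"
proof (induction n arbitrary: y)
  case 0
  then show ?case by (intro exI[of _ "[]"]) auto
next
  case (Suc n)
  obtain z where z: "((y, Suc n), (z, n)) \<in> E"
    using descend Suc.prems by blast
  obtain p z' where "walk {..n} (z, n) p (z', 0)" "length p = n"
    using Suc.IH[of z] arcs_simps[OF z] by auto
  with z show ?case
    by (intro exI[of _ "((y, Suc n), (z, n)) # p"] exI[of _ z']) (auto elim: walk_mono)
qed

lemma path_take: "path u p v \<Longrightarrow> i \<le> length p \<Longrightarrow> \<exists>w. path u (take i p) w"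
  unfolding path_def using walk_take(1)[of UNIV u p v i]
  by (auto simp: take_map[symmetric] dest: in_set_takeD)

lemma path_ConsD: "path u (e # p) v \<Longrightarrow> path (snd e) p v"
  by (auto simp: path_def)

text \<open>An arc sharing the label of the first arc is that arc or its reverse, and either one
  would bring the path back to its starting vertex.\<close>

lemma path_distinct_labels: "path u p v \<Longrightarrow> distinct (map \<kappa> p)"
proof (induction p arbitrary: u)
  case (Cons e p)
  have p: "path (snd e) p v" and e: "e \<in> E" "fst e = u"
    using Cons.prems path_ConsD by (auto simp: path_def)
  have "\<kappa> e \<noteq> \<kappa> f" if f: "f \<in> set p" for f
  proof
    assume "\<kappa> e = \<kappa> f"
    with e p f have "f = e \<or> f = (snd e, fst e)"
      by (intro label_eq) (auto simp: path_def dest: walk_subset)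
    then have "u \<in> {fst f, snd f}" using e by auto
    moreover have "fst f \<in> set (snd e # map snd p)" "snd f \<in> set (snd e # map snd p)"
      using walk_arc_through[of UNIV "snd e" p v f] p f by (auto simp: path_def)
    ultimately have "u \<in> set (map snd (e # p))" by auto
    with Cons.prems show False by (auto simp: path_def)
  qed
  with Cons.IH[OF p] show ?case by auto
qed auto

text \<open>The label of the last arc \<open>a\<close> of \<open>p\<close> also occurs on
  \<open>q\<close>. If \<open>q\<close> contains \<open>a\<close>, it must stop there, since from
  \<open>v\<close> it could only step back to the vertex it came from. If \<open>q\<close> contains
  the reverse of \<open>a\<close>, then it starts at \<open>v\<close> or has entered
  \<open>v\<close> from the vertex to which it now returns; both are impossible.\<close>

lemma path_labels_root:
  assumes p: "path u p v" "snd v = 0" and q: "path u q w" "snd w = 0"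
    and eq: "\<kappa> ` set p = \<kappa> ` set q"
  shows "v = w"
proof (cases "p = []")
  case True
  with eq have "q = []" by auto
  with True p q show ?thesis by (simp add: path_def)
next
  case False
  then obtain p' a where pa: "p = p' @ [a]" by (metis rev_exhaust)
  have walkp: "walk UNIV u p' (fst a)" "a \<in> E" "snd a = v"
    using p pa by (auto simp: path_def walk_append)
  have "\<kappa> a \<in> \<kappa> ` set q" using eq pa by auto
  then obtain b where b: "b \<in> set q" "\<kappa> a = \<kappa> b" by auto
  have wq: "walk UNIV u q w" using q by (simp add: path_def)
  have bE: "b \<in> E" using walk_subset[OF wq] b by auto
  obtain q1 q2 where q12: "q = q1 @ b # q2" using b by (meson split_list)
  have w1: "walk UNIV u q1 (fst b)" and w2: "walk UNIV (snd b) q2 w"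
    using wq q12 by (auto simp: walk_append)
  have dq: "distinct (u # map snd q1 @ snd b # map snd q2)"
    using q q12 by (simp add: path_def)
  have out: "f = fst a" if "(v, f) \<in> E" for f
  proof -
    have "((fst v, 0), f) \<in> E" "(fst a, (fst v, 0)) \<in> E"
      using that walkp p by (metis prod.collapse)+
    then show ?thesis using root_arcs by metis
  qed
  show ?thesis
  proof (cases "b = a")
    case True
    show ?thesis
    proof (cases q2)
      case Nil
      with w2 True walkp show ?thesis by simp
    next
      case (Cons c q3)
      with w2 have c: "c \<in> E" "fst c = v" using True walkp by auto
      then have "snd c = fst a" using out by (metis prod.collapse)
      moreover have "fst b \<in> set (u # map snd q1)"
        using w1 walk_last by (metis last_in_set list.distinct(1))
      ultimately show ?thesis using dq Cons True by auto
    qed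
  next
    case False
    then have b': "b = (v, fst a)" using label_eq[OF walkp(2) bE b(2)] walkp by auto
    show ?thesis
    proof (cases q1 rule: rev_cases)
      case Nil
      with w1 b' have "u = v" by simp
      moreover have "v \<in> set (map snd p)" using pa walkp by auto
      ultimately show ?thesis using p by (auto simp: path_def)
    next
      case (snoc q3 c)
      with w1 b' have c: "c \<in> E" "snd c = v" "walk UNIV u q3 (fst c)" by (auto simp: walk_append)
      have "((fst v, 0), fst a) \<in> E" "(fst c, (fst v, 0)) \<in> E"
        using c bE b' p by (metis prod.collapse)+
      then have "fst c = fst a" using root_arcs by metis
      moreover have "fst c \<in> set (u # map snd q3)"
        using c walk_last by (metis last_in_set list.distinct(1))
      ultimately show ?thesis using dq b' snoc by auto
    qed
  qed
qed

section \<open>Geodesics: existence, uniqueness of the root, cutting and splicing\<close>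

lemma weight_nonneg:
  assumes "\<forall>e\<in>E. 0 < \<omega> (\<kappa> e)" "set p \<subseteq> E"
  shows "0 \<le> weight \<omega> p"
  using assms by (induction p) (auto intro: add_nonneg_nonneg less_imp_le)

lemma weight_pos:
  assumes "\<forall>e\<in>E. 0 < \<omega> (\<kappa> e)" "set p \<subseteq> E" "p \<noteq> []"
  shows "0 < weight \<omega> p"
  using assms weight_nonneg[of \<omega> "tl p"] by (cases p) (auto intro: add_pos_nonneg)

text \<open>Loop erasure. The strict inequality for walks with a loop is recorded because it forces
  geodesics to be paths.\<close>

lemma walk_shorten:
  assumes pos: "\<forall>e\<in>E. 0 < \<omega> (\<kappa> e)"
  shows "walk B u p v \<Longrightarrow> \<exists>q. walk B u q v \<and> distinct (u # map snd q) \<and> weight \<omega> q \<le> weight \<omega> p \<and>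
    (\<not> distinct (u # map snd p) \<longrightarrow> weight \<omega> q < weight \<omega> p)"
proof (induction "length p" arbitrary: p rule: less_induct)
  case less
  show ?case
  proof (cases "distinct (u # map snd p)")
    case True
    with less.prems show ?thesis by auto
  next
    case False
    then obtain i j where ij: "i < j" "j < length (u # map snd p)"
      "(u # map snd p) ! i = (u # map snd p) ! j"
      unfolding distinct_conv_nth by (metis nat_neq_iff)
    then have j: "j \<le> length p" "i \<le> length p" by auto
    let ?q = "take i p @ drop j p"
    have q: "walk B u ?q v"
      using walk_take(1)[OF less.prems j(2)] walk_take(2)[OF less.prems j(1)] ij(3)
      by (auto intro: walk_appendI)
    have pq: "p = take i p @ take (j - i) (drop i p) @ drop j p"
      using ij(1) by (metis add_diff_inverse_nat append_assoc append_take_drop_id less_imp_not_less take_add)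
    have "0 < weight \<omega> (take (j - i) (drop i p))"
      using walk_subset[OF less.prems] ij j
      by (intro weight_pos[OF pos]) (auto dest!: in_set_takeD in_set_dropD)
    then have lt: "weight \<omega> ?q < weight \<omega> p"
      by (subst (2) pq) simp
    have "length ?q < length p" using ij j by auto
    from less.hyps[OF this q] obtain q' where "walk B u q' v" "distinct (u # map snd q')"
      "weight \<omega> q' \<le> weight \<omega> ?q" by (elim exE conjE)
    with lt show ?thesis by (intro exI[of _ q']) auto
  qed
qed

lemma goodD:
  assumes "good \<omega>"
  shows "\<forall>e\<in>E. 0 < \<omega> (\<kappa> e)"
    "\<exists>L. \<forall>p v. path u p v \<and> L \<le> length p \<longrightarrow> t < weight \<omega> p"
proof -
  show "\<forall>e\<in>E. 0 < \<omega> (\<kappa> e)" using assms unfolding good_def by (elim conjE)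
  have "\<forall>u t. \<exists>L. \<forall>p v. path u p v \<and> L \<le> length p \<longrightarrow> t < weight \<omega> p"
    using assms unfolding good_def by (elim conjE)
  then show "\<exists>L. \<forall>p v. path u p v \<and> L \<le> length p \<longrightarrow> t < weight \<omega> p" by (elim allE)
qed

lemma good_root_weights:
  assumes "good \<omega>" "path u p v" "path u q w" "snd v = 0" "snd w = 0" "v \<noteq> w"
  shows "weight \<omega> p \<noteq> weight \<omega> q"
proof -
  have "\<forall>u p v q w. path u p v \<and> path u q w \<and> snd v = 0 \<and> snd w = 0 \<and> v \<noteq> w \<longrightarrow>
        weight \<omega> p \<noteq> weight \<omega> q"
    using assms(1) unfolding good_def by (elim conjE)
  from this[rule_format, of u p v q w] assms(2-) show ?thesis by simp
qed

lemma geod_distinct: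
  assumes "\<forall>e\<in>E. 0 < \<omega> (\<kappa> e)" "geod B \<omega> u p v"
  shows "path u p v"
proof -
  have w: "walk B u p v" "snd v = 0" using assms by (auto simp: geod_def)
  obtain q where "walk B u q v" "\<not> distinct (u # map snd p) \<longrightarrow> weight \<omega> q < weight \<omega> p"
    using walk_shorten[OF assms(1) w(1)] by auto
  with assms(2) w have "distinct (u # map snd p)" by (auto simp: geod_def leD)
  with w show ?thesis by (auto simp: path_def intro: walk_mono)
qed

lemma root_unique:
  assumes "good \<omega>" "root B \<omega> u v" "root B \<omega> u w"
  shows "v = w"
proof -
  obtain p q where pq: "geod B \<omega> u p v" "geod B \<omega> u q w" using assms by (auto simp: root_def)
  then have "weight \<omega> p = weight \<omega> q" by (auto simp: geod_def intro: antisym)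
  moreover have "path u p v" "path u q w" using geod_distinct[OF goodD(1)[OF assms(1)]] pq by auto
  moreover have "snd v = 0" "snd w = 0" using pq by (auto simp: geod_def)
  ultimately show ?thesis using good_root_weights[OF assms(1)] by metis
qed

lemma finite_walks:
  assumes fin: "\<And>v. finite {w. (v, w) \<in> E}"
  shows "finite {p. length p = n \<and> (\<exists>v. walk B u p v)}"
proof (induction n arbitrary: u)
  case 0
  have "{p. length p = 0 \<and> (\<exists>v. walk B u p v)} \<subseteq> {[]}" by auto
  then show ?case using finite_subset by blast
next
  case (Suc n)
  have "{p. length p = Suc n \<and> (\<exists>v. walk B u p v)} \<subseteq>
     (\<Union>w\<in>{w. (u, w) \<in> E}. (#) (u, w) ` {p. length p = n \<and> (\<exists>v. walk B w p v)})"
  proof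
    fix p assume p: "p \<in> {p. length p = Suc n \<and> (\<exists>v. walk B u p v)}"
    then obtain e q where pe: "p = e # q" by (cases p) auto
    obtain u' w where ew: "e = (u', w)" by (cases e)
    with pe p have "u' = u" "(u, w) \<in> E" "q \<in> {p. length p = n \<and> (\<exists>v. walk B w p v)}" by auto
    then show "p \<in> (\<Union>w\<in>{w. (u, w) \<in> E}. (#) (u, w) ` {p. length p = n \<and> (\<exists>v. walk B w p v)})"
      using pe ew by (intro UN_I[of w] image_eqI[of _ _ q]) auto
  qed
  moreover have "finite (\<Union>w\<in>{w. (u, w) \<in> E}. (#) (u, w) ` {p. length p = n \<and> (\<exists>v. walk B w p v)})"
    using fin Suc by auto
  ultimately show ?case by (rule finite_subset)
qed

text \<open>A descending walk \<open>p0\<close> exists inside \<open>B\<close> because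
  \<open>B\<close> is closed downwards. By \<open>good\<close>, long paths weigh more than
  \<open>p0\<close>, so the minimum is taken over finitely many paths; loop erasure extends it to
  all walks.\<close>

lemma geod_exists:
  assumes fin: "\<And>v. finite {w. (v, w) \<in> E}" and good: "good \<omega>"
    and B: "\<forall>i\<in>B. {..i} \<subseteq> B" and u: "u \<in> carrier G \<times> B"
  shows "\<exists>p v. geod B \<omega> u p v"
proof -
  note pos = goodD(1)[OF good]
  obtain p0 z where "walk {..snd u} u p0 (z, 0)"
    using walk_descend[of "fst u" "snd u"] u by (auto simp: mem_Times_iff)
  then have p0: "walk B u p0 (z, 0)" using B u by (auto simp: mem_Times_iff elim!: walk_mono)
  obtain L where L: "\<And>p v. path u p v \<Longrightarrow> L \<le> length p \<Longrightarrow> weight \<omega> p0 < weight \<omega> p"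
    using goodD(2)[OF good] by blast
  let ?A = "{p. \<exists>v. path u p v \<and> walk B u p v \<and> snd v = 0 \<and> weight \<omega> p \<le> weight \<omega> p0}"
  have "?A \<subseteq> (\<Union>n<L. {p. length p = n \<and> (\<exists>v. walk B u p v)})"
  proof
    fix p assume "p \<in> ?A"
    then obtain v where v: "path u p v" "walk B u p v" "weight \<omega> p \<le> weight \<omega> p0" by blast
    then have "length p < L" using L[OF v(1)] by (meson not_less)
    with v(2) show "p \<in> (\<Union>n<L. {p. length p = n \<and> (\<exists>v. walk B u p v)})" by auto
  qed
  moreover have "finite (\<Union>n<L. {p. length p = n \<and> (\<exists>v. walk B u p v)})"
    using finite_walks[OF fin] by blast
  ultimately have finA: "finite ?A" by (rule finite_subset)
  have sh: "\<exists>p'\<in>?A. weight \<omega> p' \<le> weight \<omega> q" if q: "walk B u q w" "snd w = 0" "weight \<omega> q \<le> weight \<omega> p0" for q w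
  proof -
    obtain p' where p': "walk B u p' w" "distinct (u # map snd p')" "weight \<omega> p' \<le> weight \<omega> q"
      using walk_shorten[OF pos q(1)] by blast
    then have "path u p' w" by (auto simp: path_def elim: walk_mono)
    with p' q have "p' \<in> ?A" by (blast intro: order_trans)
    with p'(3) show ?thesis by blast
  qed
  then have "?A \<noteq> {}" using p0 by (metis empty_iff order_refl snd_conv)
  then obtain p where p: "p \<in> ?A" "\<And>q. q \<in> ?A \<Longrightarrow> weight \<omega> p \<le> weight \<omega> q"
    using finA by (metis (no_types, lifting) arg_min_if_finite(1) arg_min_least)
  then obtain v where v: "walk B u p v" "snd v = 0" by auto
  have "weight \<omega> p \<le> weight \<omega> q" if "walk B u q w" "snd w = 0" for q w
  proof (cases "weight \<omega> q \<le> weight \<omega> p0")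
    case True
    then show ?thesis using sh[OF that] p(2) by (meson order_trans)
  next
    case False
    then show ?thesis using p(1) by auto
  qed
  with v have "geod B \<omega> u p v" by (auto simp: geod_def)
  then show ?thesis by blast
qed

lemma geod_suffix:
  assumes "geod B \<omega> u (p @ q) v" "walk B u p w"
  shows "geod B \<omega> w q v"
proof -
  have "walk B w q v" using assms by (auto simp: geod_def walk_append dest: walk_unique)
  moreover have "weight \<omega> q \<le> weight \<omega> q'" if "walk B w q' v'" "snd v' = 0" for q' v'
  proof -
    have "walk B u (p @ q') v'" using assms(2) that(1) by (rule walk_appendI)
    then have "weight \<omega> (p @ q) \<le> weight \<omega> (p @ q')" using assms(1) that(2) unfolding geod_def by blast
    then show ?thesis by simp
  qed
  ultimately show ?thesis using assms(1) by (auto simp: geod_def)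
qed

lemma geod_splice:
  assumes "geod B \<omega> u (p @ q) v" "walk B u p w" "geod B \<omega> w q' v'"
  shows "geod B \<omega> u (p @ q') v'"
proof -
  have q: "geod B \<omega> w q v" using geod_suffix assms by blast
  have "weight \<omega> q' \<le> weight \<omega> q" using q assms(3) unfolding geod_def by blast
  moreover have "walk B u (p @ q') v'"
    using assms by (auto simp: geod_def intro: walk_appendI)
  ultimately show ?thesis using assms unfolding geod_def by (smt (verit) weight_simps(3))
qed

lemma geod_restrict:
  assumes "geod B \<omega> u p v" "walk B' u p v" "B' \<subseteq> B"
  shows "geod B' \<omega> u p v"
  using assms walk_mono unfolding geod_def by blast

lemma geod_cong:
  assumes "\<And>e. e \<in> E \<Longrightarrow> snd (fst e) \<in> B \<Longrightarrow> snd (snd e) \<in> B \<Longrightarrow> \<omega> (\<kappa> e) = \<omega>' (\<kappa> e)"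
  shows "geod B \<omega> u p v \<longleftrightarrow> geod B \<omega>' u p v"
proof -
  have *: "weight \<omega> q = weight \<omega>' q" if "walk B u q w" for q w
    using walk_arcs[OF that] assms unfolding weight_def
    by (intro arg_cong[where f = sum_list] map_cong) auto
  then show ?thesis unfolding geod_def by (auto simp: *)
qed

text \<open>This is the first index from which the walk never rises above level \<open>j\<close>
  again; it may still return to level \<open>j\<close> later. The choice makes the whole remaining
  walk a walk of the truncated graph.\<close>

definition last_visit :: "'g vertex \<Rightarrow> 'g arc list \<Rightarrow> 'g vertex \<Rightarrow> nat \<Rightarrow> nat" where
  "last_visit u p v j = (LEAST i. i \<le> length p \<and> walk {..j} ((u # map snd p) ! i) (drop i p) v)"

text \<open>By minimality the preceding vertex lies above level \<open>j\<close>, and an arc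
  descends at most one level, so the chosen vertex lies on level \<open>j\<close> itself. For index
  0 this is where \<open>j \<le> snd u\<close> enters.\<close>

lemma last_visit:
  assumes w: "walk B u p v" "snd v = 0" "j \<le> snd u"
  defines "i \<equiv> last_visit u p v j"
  shows "i \<le> length p" "walk {..j} ((u # map snd p) ! i) (drop i p) v" "snd ((u # map snd p) ! i) = j"
proof -
  let ?P = "\<lambda>i. i \<le> length p \<and> walk {..j} ((u # map snd p) ! i) (drop i p) v"
  have "?P (length p)"
    using walk_last[OF w(1)] walk_end[OF w(1)] w(2) by (auto simp: last_conv_nth mem_Times_iff)
  then have i: "?P i" unfolding i_def last_visit_def by (rule LeastI)
  then show le: "i \<le> length p" and wi: "walk {..j} ((u # map snd p) ! i) (drop i p) v" by auto
  show "snd ((u # map snd p) ! i) = j"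
  proof (cases i)
    case 0
    with walk_start[OF wi] w(3) show ?thesis by (auto simp: mem_Times_iff)
  next
    case (Suc i')
    let ?z = "(u # map snd p) ! i'"
    have "\<not> ?P i'" unfolding i_def using not_less_Least[of i' ?P] Suc
      by (auto simp: i_def last_visit_def)
    then have nP: "\<not> walk {..j} ?z (drop i' p) v" using le Suc by auto
    have d: "drop i' p = p ! i' # drop i p" using le Suc by (simp add: Cons_nth_drop_Suc)
    have "walk B ?z (drop i' p) v" using walk_take(2)[OF w(1), of i'] le Suc by auto
    with d have e: "p ! i' \<in> E" "fst (p ! i') = ?z" by auto
    have s: "snd (p ! i') = (u # map snd p) ! i" using le Suc by simp
    from nP d e s wi have "j < snd ?z" by auto
    then show ?thesis
      using arcs_simps(3)[OF e(1)] walk_start[OF wi] e s by (auto simp: mem_Times_iff)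
  qed
qed

lemma last_visit_antimono:
  assumes "walk B u p v" "snd v = 0" "j \<le> snd u" "i \<le> j"
  shows "last_visit u p v j \<le> last_visit u p v i"
  unfolding last_visit_def[of u p v j]
  using last_visit(1,2)[OF assms(1,2), of i] assms
  by (intro Least_le) (auto elim: walk_mono)

text \<open>The passage from larger graphs to truncated ones: the part of a geodesic after
  \<open>last_visit\<close> lies in \<open>{..n}\<close>, and a geodesic contained in a smaller
  graph is a geodesic of that graph.\<close>

lemma alive_if_geod:
  assumes "geod B \<omega> u p v" "n \<le> snd u" "{..n} \<subseteq> B"
  shows "alive n \<omega> v"
proof -
  have w: "walk B u p v" "snd v = 0" using assms by (auto simp: geod_def)
  let ?i = "last_visit u p v n" and ?z = "(u # map snd p) ! last_visit u p v n"
  note lv = last_visit[OF w assms(2)]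
  have "geod B \<omega> u (take ?i p @ drop ?i p) v" using assms by simp
  then have "geod B \<omega> ?z (drop ?i p) v"
    using walk_take(1)[OF w(1) lv(1)] by (rule geod_suffix)
  then have "geod {..n} \<omega> ?z (drop ?i p) v"
    using lv(2) assms(3) by (rule geod_restrict)
  then show ?thesis
    unfolding alive_def root_def using lv(3) by (metis prod.collapse)
qed

lemma alive_antimono:
  assumes "alive n \<omega> v" "m \<le> n"
  shows "alive m \<omega> v"
  using assms(1) unfolding alive_def[of n] root_def
  using assms(2) by (auto intro!: alive_if_geod)

text \<open>At a level where \<open>near\<close> fails, the geodesic makes more than
  \<open>\<rho>\<close> steps between its indices for \<open>n\<close> and \<open>n - q\<close>.
  Summed over \<open>n\<close>, these gaps cover each step of the geodesic at most \<open>q\<close>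
  times.\<close>

lemma near_count:
  assumes g: "geod B \<omega> U p v" and q: "q \<le> snd U" and len: "length p \<le> l"
  shows "card {n \<in> {q..snd U}. \<not> near B \<omega> \<rho> n (n - q) U} * \<rho> \<le> q * l"
proof -
  have w: "walk B U p v" "snd v = 0" using g by (auto simp: geod_def)
  let ?lv = "last_visit U p v" and ?N = "snd U"
  let ?bad = "{n \<in> {q..?N}. \<not> near B \<omega> \<rho> n (n - q) U}"
  have anti: "?lv n \<le> ?lv (n - q)" if "n \<le> ?N" for n
    using last_visit_antimono[OF w, of n "n - q"] that by auto
  have bad: "\<rho> < ?lv (n - q) - ?lv n" if n: "n \<in> ?bad" for n
  proof (rule ccontr)
    assume "\<not> \<rho> < ?lv (n - q) - ?lv n"
    then have \<rho>: "?lv (n - q) - ?lv n \<le> \<rho>" by simp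
    have nN: "n \<le> ?N" "n - q \<le> ?N" using n by auto
    let ?i = "?lv n" and ?k = "?lv (n - q)"
    let ?vs = "U # map snd p"
    note lvn = last_visit[OF w nN(1)] and lvq = last_visit[OF w nN(2)]
    have eq: "take ?i p @ take (?k - ?i) (drop ?i p) @ drop ?k p = p"
      using anti[OF nN(1)] by (metis append_assoc append_take_drop_id le_add_diff_inverse take_add)
    have 1: "walk B U (take ?i p) (?vs ! ?i)" and 2: "walk B (?vs ! ?i) (drop ?i p) v"
      using walk_take[OF w(1) lvn(1)] by auto
    have "walk B U (take ?k p) (?vs ! ?k)" using walk_take(1)[OF w(1) lvq(1)] .
    moreover have "take ?k p = take ?i p @ take (?k - ?i) (drop ?i p)"
      using anti[OF nN(1)] by (metis le_add_diff_inverse take_add)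
    ultimately obtain z where "walk B U (take ?i p) z" "walk B z (take (?k - ?i) (drop ?i p)) (?vs ! ?k)"
      by (auto simp: walk_append)
    then have 3: "walk B (?vs ! ?i) (take (?k - ?i) (drop ?i p)) (?vs ! ?k)"
      using walk_unique[OF 1] by metis
    have 5: "length (take (?k - ?i) (drop ?i p)) \<le> \<rho>" using \<rho> by simp
    have "near_walk B \<rho> n (n - q) U p v" unfolding near_walk_def
      by (intro exI conjI) (rule eq[symmetric], rule 1, rule lvn(3), rule 3, rule 5, rule lvq(3), rule lvq(2))
    with g have "near B \<omega> \<rho> n (n - q) U" unfolding near_def by (intro exI conjI)
    with n show False by auto
  qed
  have "card ?bad * \<rho> \<le> (\<Sum>n\<in>?bad. ?lv (n - q) - ?lv n)"
    using bad sum_mono[of ?bad "\<lambda>_. \<rho>" "\<lambda>n. ?lv (n - q) - ?lv n"] by (auto simp: less_imp_le)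
  also have "\<dots> \<le> (\<Sum>n\<in>{q..?N}. ?lv (n - q) - ?lv n)"
    by (intro sum_mono2) auto
  also have "\<dots> = (\<Sum>n\<in>{q..?N}. ?lv (n - q)) - (\<Sum>n\<in>{q..?N}. ?lv n)"
    using anti by (intro sum_subtractf_nat) auto
  \<comment> \<open>After this shift the two sums cancel except for the indices of the levels below
    \<open>q\<close>, each of which is at most the length of \<open>p\<close>.\<close>
  also have "(\<Sum>n\<in>{q..?N}. ?lv (n - q)) = (\<Sum>n\<in>{..?N - q}. ?lv n)"
    by (rule sum.reindex_bij_witness[of _ "\<lambda>n. n + q" "\<lambda>n. n - q"]) (use q in auto)
  also have "\<dots> - (\<Sum>n\<in>{q..?N}. ?lv n) \<le> (\<Sum>n\<in>{..<q}. ?lv n)"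
  proof -
    have "(\<Sum>n\<in>{..?N - q}. ?lv n) \<le> (\<Sum>n\<in>{..<q} \<union> {q..?N}. ?lv n)"
      by (intro sum_mono2) auto
    also have "\<dots> = (\<Sum>n\<in>{..<q}. ?lv n) + (\<Sum>n\<in>{q..?N}. ?lv n)"
      by (intro sum.union_disjoint) auto
    finally show ?thesis by simp
  qed
  also have "\<dots> \<le> (\<Sum>n\<in>{..<q}. length p)"
    using last_visit(1)[OF w] q by (intro sum_mono) auto
  also have "\<dots> \<le> q * l" using len by simp
  finally show ?thesis .
qed

text \<open>
  A walk to \<open>x\<close> that is optimal after the weights on \<open>F\<close> have been lowered and that uses an arc in \<open>F\<close>
  could be improved after its last such arc, since there the weights have not changed.
\<close>
lemma lowering_kills_tree:
  assumes fin: "\<And>v. finite {w. (v, w) \<in> E}" and good: "good \<omega>"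
    and B: "\<forall>i\<in>B. {..i} \<subseteq> B"
    and off: "\<And>e. e \<in> E \<Longrightarrow> \<kappa> e \<notin> F \<Longrightarrow> \<omega>' (\<kappa> e) = \<omega> (\<kappa> e)"
    and le: "\<And>e. e \<in> E \<Longrightarrow> \<omega>' (\<kappa> e) \<le> \<omega> (\<kappa> e)"
    and ends: "\<And>e. e \<in> E \<Longrightarrow> \<kappa> e \<in> F \<Longrightarrow> \<not> root B \<omega> (snd e) x"
    and better: "root B \<omega> U x \<Longrightarrow> \<exists>q w v p. walk B U q w \<and> snd w = 0 \<and> geod B \<omega> U p v \<and> weight \<omega>' q < weight \<omega> p"
  shows "\<not> root B \<omega>' U x"
proof
  assume "root B \<omega>' U x"
  then obtain \<gamma> where \<gamma>: "geod B \<omega>' U \<gamma> x" by (auto simp: root_def)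
  have wle: "weight \<omega>' p \<le> weight \<omega> p" if "set p \<subseteq> E" for p
    using that le by (induction p) (auto intro: add_mono)
  have weq: "weight \<omega>' p = weight \<omega> p" if "set p \<subseteq> E" "\<forall>e\<in>set p. \<kappa> e \<notin> F" for p
    using that off by (induction p) auto
  \<comment> \<open>From a vertex that does not have root \<open>x\<close>, a geodesic is strictly
    lighter than any walk to \<open>x\<close>, since a tie would make \<open>x\<close> a root.
    Lowering weights only helps the geodesic.\<close>
  have strict: "\<exists>q w. walk B z q w \<and> snd w = 0 \<and> weight \<omega>' q < weight \<omega> p"
    if z: "\<not> root B \<omega> z x" and p: "walk B z p x" for z p
  proof -
    obtain q w where q: "geod B \<omega> z q w"
      using geod_exists[OF fin good B walk_start[OF p]] by (elim exE)
    have "snd x = 0" using \<gamma> by (auto simp: geod_def)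
    have "weight \<omega> q < weight \<omega> p"
    proof (rule ccontr)
      assume "\<not> weight \<omega> q < weight \<omega> p"
      then have "weight \<omega> p \<le> weight \<omega> q'" if "walk B z q' w'" "snd w' = 0" for q' w'
        using q that unfolding geod_def by (meson not_less order_trans)
      then have "geod B \<omega> z p x" using p \<open>snd x = 0\<close> unfolding geod_def by blast
      with z show False by (auto simp: root_def)
    qed
    moreover have qw: "walk B z q w" "snd w = 0" using q unfolding geod_def by blast+
    moreover have "weight \<omega>' q \<le> weight \<omega> q"
      using wle walk_subset[OF qw(1)] by blast
    ultimately show ?thesis by (intro exI[of _ q] exI[of _ w]) auto
  qed
  have w\<gamma>: "walk B U \<gamma> x" and x0: "snd x = 0" using \<gamma> by (auto simp: geod_def)
  show False
  proof (cases "\<exists>e\<in>set \<gamma>. \<kappa> e \<in> F")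
    case False
    then have eq: "weight \<omega>' \<gamma> = weight \<omega> \<gamma>" using weq walk_subset[OF w\<gamma>] by blast
    have "\<exists>q w. walk B U q w \<and> snd w = 0 \<and> weight \<omega>' q < weight \<omega> \<gamma>"
    proof (cases "root B \<omega> U x")
      case True
      from better[OF this] obtain q w v p where "walk B U q w" "snd w = 0" "geod B \<omega> U p v"
        "weight \<omega>' q < weight \<omega> p" by (elim exE conjE)
      moreover from this have "weight \<omega> p \<le> weight \<omega> \<gamma>" using w\<gamma> x0 unfolding geod_def by blast
      ultimately show ?thesis by (intro exI[of _ q] exI[of _ w]) auto
    qed (rule strict[OF _ w\<gamma>])
    then obtain q w where "walk B U q w" "snd w = 0" "weight \<omega>' q < weight \<omega>' \<gamma>"
      using eq by auto
    with \<gamma> show False unfolding geod_def by (meson not_less)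
  next
    case True
    then obtain \<gamma>1 a \<gamma>2 where s: "\<gamma> = \<gamma>1 @ a # \<gamma>2" "\<kappa> a \<in> F" "\<forall>e\<in>set \<gamma>2. \<kappa> e \<notin> F"
      using split_list_last_prop[OF True] by (elim exE conjE) blast
    have a: "a \<in> E" and w2: "walk B (snd a) \<gamma>2 x" and w1: "walk B U (\<gamma>1 @ [a]) (snd a)"
      using w\<gamma> s by (auto simp: walk_append mem_Times_iff dest: walk_start)
    obtain q w where q: "walk B (snd a) q w" "snd w = 0" "weight \<omega>' q < weight \<omega> \<gamma>2"
      using strict[OF ends[OF a s(2)] w2] by (elim exE conjE)
    have "walk B U ((\<gamma>1 @ [a]) @ q) w" using w1 q(1) by (rule walk_appendI)
    then have "weight \<omega>' \<gamma> \<le> weight \<omega>' ((\<gamma>1 @ [a]) @ q)" using \<gamma> q(2) unfolding geod_def by blast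
    moreover have "weight \<omega>' \<gamma>2 = weight \<omega> \<gamma>2"
      using weq[OF walk_subset[OF w2] s(3)] .
    ultimately show False using s q(3) by simp
  qed
qed

end

section \<open>Countable quantifiers\<close>

lemma pred_countable_Bex:
  assumes "countable X" "\<And>i. i \<in> X \<Longrightarrow> Measurable.pred M (Q i)"
  shows "Measurable.pred M (\<lambda>x. \<exists>i\<in>X. Q i x)"
proof -
  have "{x \<in> space M. \<exists>i\<in>X. Q i x} = (\<Union>i\<in>X. {x \<in> space M. Q i x})" by auto
  also have "\<dots> \<in> sets M" using assms by (intro sets.countable_UN'') (auto simp: pred_def)
  finally show ?thesis by (simp add: pred_def)
qed

lemma pred_countable_Ball:
  assumes "countable X" "\<And>i. i \<in> X \<Longrightarrow> Measurable.pred M (Q i)"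
  shows "Measurable.pred M (\<lambda>x. \<forall>i\<in>X. Q i x)"
proof -
  have "Measurable.pred M (\<lambda>x. \<not> (\<exists>i\<in>X. \<not> Q i x))"
    using assms by (intro pred_intros_logic pred_countable_Bex)
  then show ?thesis by simp
qed

section \<open>Resampling finitely many coordinates\<close>

definition override :: "'i set \<Rightarrow> 'i set \<Rightarrow> ('i \<Rightarrow> 'a) \<Rightarrow> ('i \<Rightarrow> 'a) \<Rightarrow> 'i \<Rightarrow> 'a" where
  "override I F \<omega> \<eta> = (\<lambda>i\<in>I. if i \<in> F then \<eta> i else \<omega> i)"

lemma measurable_override [measurable]:
  "(\<lambda>(\<omega>, \<eta>). override I F \<omega> \<eta>) \<in> measurable (PiM I (\<lambda>_. M) \<Otimes>\<^sub>M PiM I (\<lambda>_. M)) (PiM I (\<lambda>_. M))"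
  unfolding override_def split_beta' 
  by (intro measurable_restrict, case_tac "i \<in> F") (auto intro: measurable_compose measurable_component_singleton)

text \<open>On a cylinder the condition splits into one on \<open>\<omega>\<close> outside
  \<open>F\<close> and one on \<open>\<eta>\<close> inside \<open>F\<close>, so the probability
  factorises; cylinders determine the measure.\<close>

lemma distr_override_PiM:
  assumes "prob_space M"
  shows "distr (PiM I (\<lambda>_. M) \<Otimes>\<^sub>M PiM I (\<lambda>_. M)) (PiM I (\<lambda>_. M)) (\<lambda>(\<omega>, \<eta>). override I F \<omega> \<eta>) =
    PiM I (\<lambda>_. M)"
proof -
  interpret prob_space M by fact
  interpret product_prob_space "\<lambda>_. M" I by unfold_locales
  show ?thesis
  proof (rule PiM_eq)
    fix J A assume J: "finite J" "J \<subseteq> I" "\<And>j. j \<in> J \<Longrightarrow> A j \<in> sets M"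
    let ?X = "prod_emb I (\<lambda>_. M) J (\<Pi>\<^sub>E j\<in>J. A j)"
    let ?P = "PiM I (\<lambda>_. M)"
    let ?A = "prod_emb I (\<lambda>_. M) (J - F) (\<Pi>\<^sub>E j\<in>J - F. A j)"
    let ?B = "prod_emb I (\<lambda>_. M) (J \<inter> F) (\<Pi>\<^sub>E j\<in>J \<inter> F. A j)"
    have "(\<lambda>(\<omega>, \<eta>). override I F \<omega> \<eta>) -` ?X \<inter> space (?P \<Otimes>\<^sub>M ?P) = ?A \<times> ?B"
      using J(2) by (auto simp: override_def prod_emb_def space_pair_measure space_PiM PiE_iff subset_eq split: if_splits)
    then have "emeasure (distr (?P \<Otimes>\<^sub>M ?P) ?P (\<lambda>(\<omega>, \<eta>). override I F \<omega> \<eta>)) ?X = emeasure (?P \<Otimes>\<^sub>M ?P) (?A \<times> ?B)"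
      using J by (subst emeasure_distr) (auto intro!: sets_PiM_I)
    also have "\<dots> = emeasure ?P ?A * emeasure ?P ?B"
      using J by (intro P.emeasure_pair_measure_Times) (auto intro!: sets_PiM_I)
    also have "\<dots> = (\<Prod>j\<in>J - F. emeasure M (A j)) * (\<Prod>j\<in>J \<inter> F. emeasure M (A j))"
      using J by (intro arg_cong2[where f = "(*)"] emeasure_PiM_emb) auto
    also have "\<dots> = (\<Prod>j\<in>(J - F) \<union> (J \<inter> F). emeasure M (A j))"
      using J by (intro prod.union_disjoint[symmetric]) auto
    also have "(J - F) \<union> (J \<inter> F) = J" by auto
    finally show "emeasure (distr (?P \<Otimes>\<^sub>M ?P) ?P (\<lambda>(\<omega>, \<eta>). override I F \<omega> \<eta>)) ?X = (\<Prod>j\<in>J. emeasure M (A j))" .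
  qed simp
qed

lemma emeasure_override:
  assumes "prob_space M" and A: "A \<in> sets (PiM I (\<lambda>_. M))"
  defines "P \<equiv> PiM I (\<lambda>_. M)"
  shows "emeasure P A = (\<integral>\<^sup>+\<omega>. emeasure P {\<eta> \<in> space P. override I F \<omega> \<eta> \<in> A} \<partial>P)"
    and "(\<lambda>\<omega>. emeasure P {\<eta> \<in> space P. override I F \<omega> \<eta> \<in> A}) \<in> borel_measurable P"
proof -
  interpret prob_space M by fact
  interpret product_prob_space "\<lambda>_. M" I by unfold_locales
  have P: "sigma_finite_measure P" unfolding P_def by unfold_locales
  let ?f = "\<lambda>(\<omega>, \<eta>). override I F \<omega> \<eta>"
  let ?X = "?f -` A \<inter> space (P \<Otimes>\<^sub>M P)"
  have X: "?X \<in> sets (P \<Otimes>\<^sub>M P)" using A unfolding P_def by (intro measurable_sets[OF measurable_override])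
  have slice: "emeasure P (Pair \<omega> -` ?X) = emeasure P {\<eta> \<in> space P. override I F \<omega> \<eta> \<in> A}"
    if "\<omega> \<in> space P" for \<omega>
    using that by (intro arg_cong[where f = "emeasure P"]) (auto simp: space_pair_measure)
  have "emeasure P A = emeasure (distr (P \<Otimes>\<^sub>M P) P ?f) A"
    unfolding P_def by (simp add: distr_override_PiM[OF assms(1)])
  also have "\<dots> = emeasure (P \<Otimes>\<^sub>M P) ?X"
    using A unfolding P_def by (intro emeasure_distr measurable_override)
  also have "\<dots> = (\<integral>\<^sup>+\<omega>. emeasure P (Pair \<omega> -` ?X) \<partial>P)"
    by (rule sigma_finite_measure.emeasure_pair_measure_alt[OF P X])
  also have "\<dots> = (\<integral>\<^sup>+\<omega>. emeasure P {\<eta> \<in> space P. override I F \<omega> \<eta> \<in> A} \<partial>P)"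
    by (intro nn_integral_cong slice)
  finally show "emeasure P A = (\<integral>\<^sup>+\<omega>. emeasure P {\<eta> \<in> space P. override I F \<omega> \<eta> \<in> A} \<partial>P)" .
  show "(\<lambda>\<omega>. emeasure P {\<eta> \<in> space P. override I F \<omega> \<eta> \<in> A}) \<in> borel_measurable P"
    using sigma_finite_measure.measurable_emeasure_Pair[OF P X] slice
    by (subst measurable_cong[symmetric]) auto
qed

text \<open>Resample one coordinate \<open>e\<close> of the symmetric difference: given all the
  others, equality of the sums prescribes the value at \<open>e\<close>, and single values have
  measure 0.\<close>

lemma AE_PiM_sum_neq:
  fixes M :: "real measure"
  assumes M: "prob_space M" "sets M = sets borel" "\<And>t. emeasure M {t} = 0"
    and QR: "finite Q" "finite R" "Q \<subseteq> I" "R \<subseteq> I" "Q \<noteq> R"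
  shows "AE \<omega> in PiM I (\<lambda>_. M). sum \<omega> Q \<noteq> sum \<omega> R"
proof -
  interpret prob_space M by fact
  interpret product_prob_space "\<lambda>_. M" I by unfold_locales
  let ?P = "PiM I (\<lambda>_. M)"
  note [measurable_cong] = M(2)
  have *: "AE \<omega> in ?P. sum \<omega> Q \<noteq> sum \<omega> R"
    if QR: "finite Q" "finite R" "Q \<subseteq> I" "R \<subseteq> I" and e: "e \<in> Q" "e \<notin> R" for Q R e
  proof (rule AE_I)
    let ?A = "{\<omega> \<in> space ?P. sum \<omega> Q = sum \<omega> R}"
    have [measurable]: "(\<lambda>\<omega>. sum \<omega> Q) \<in> borel_measurable ?P" "(\<lambda>\<omega>. sum \<omega> R) \<in> borel_measurable ?P"
      using QR by (auto intro!: borel_measurable_sum measurable_component_singleton simp: subset_eq)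
    show A: "?A \<in> sets ?P" by measurable
    have "emeasure ?P {\<eta> \<in> space ?P. override I {e} \<omega> \<eta> \<in> ?A} = 0" if "\<omega> \<in> space ?P" for \<omega>
    proof -
      have "{\<eta> \<in> space ?P. override I {e} \<omega> \<eta> \<in> ?A} \<subseteq>
          {\<eta> \<in> space ?P. \<eta> e \<in> {sum \<omega> R - sum \<omega> (Q - {e})}}"
      proof safe
        fix \<eta> assume eq: "sum (override I {e} \<omega> \<eta>) Q = sum (override I {e} \<omega> \<eta>) R"
        have "sum (override I {e} \<omega> \<eta>) (Q - {e}) = sum \<omega> (Q - {e})" "sum (override I {e} \<omega> \<eta>) R = sum \<omega> R"
          using QR e by (auto intro!: sum.cong simp: override_def subset_eq)
        moreover have "sum (override I {e} \<omega> \<eta>) Q = \<eta> e + sum (override I {e} \<omega> \<eta>) (Q - {e})"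
          using QR e by (subst sum.remove[of Q e]) (auto simp: override_def)
        ultimately show "\<eta> e = sum \<omega> R - sum \<omega> (Q - {e})" using eq by simp
      qed
      then have "emeasure ?P {\<eta> \<in> space ?P. override I {e} \<omega> \<eta> \<in> ?A} \<le>
          emeasure ?P {\<eta> \<in> space ?P. \<eta> e \<in> {sum \<omega> R - sum \<omega> (Q - {e})}}"
        using e QR by (intro emeasure_mono) (auto intro!: measurable_sets_Collect[OF measurable_component_singleton] simp: M(2) subset_eq)
      also have "\<dots> = emeasure M {sum \<omega> R - sum \<omega> (Q - {e})}"
        using e QR M(2) by (intro emeasure_PiM_Collect_single) auto
      finally show ?thesis using M(3) by simp
    qed
    then show "emeasure ?P ?A = 0"
      by (subst emeasure_override(1)[OF M(1) A, of "{e}"]) (simp cong: nn_integral_cong)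
    show "{\<omega> \<in> space ?P. \<not> sum \<omega> Q \<noteq> sum \<omega> R} \<subseteq> ?A" by auto
  qed
  from QR(5) consider e where "e \<in> Q" "e \<notin> R" | e where "e \<in> R" "e \<notin> Q" by blast
  then show ?thesis
  proof cases
    case 1
    then show ?thesis using *[of Q R] QR by auto
  next
    case 2
    then have "AE \<omega> in ?P. sum \<omega> R \<noteq> sum \<omega> Q" using *[of R Q] QR by auto
    then show ?thesis by eventually_elim simp
  qed
qed

section \<open>Percolation on layered graphs\<close>

definition translate :: "('g, 'm) monoid_scheme \<Rightarrow> 'g \<Rightarrow> 'g vertex \<Rightarrow> 'g vertex" where
  "translate G g u = (g \<otimes>\<^bsub>G\<^esub> fst u, snd u)"

text \<open>
  A generator step descends by \<open>\<delta>\<close> levels: \<open>\<delta> = 1\<close> in the directed graph and \<open>\<delta> = 0\<close> in the undirected one.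
  The map \<open>act g\<close> is the action of \<open>g\<close> on the labels \<open>\<kappa> ` E\<close>, which are the undirected edges in the latter case.
\<close>

locale layered_percolation = layered_graph G E \<kappa> + group G
  for G :: "('g, 'm) monoid_scheme" (structure)
    and E :: "'g arc set"
    and \<kappa> :: "'g arc \<Rightarrow> 'e" +
  fixes act :: "'g \<Rightarrow> 'e \<Rightarrow> 'e" and \<mu> :: "real measure" and \<Delta> \<delta> :: nat and lo hi :: real
  assumes arcs_translate: "g \<in> carrier G \<Longrightarrow> (u, v) \<in> E \<Longrightarrow> (translate G g u, translate G g v) \<in> E"
    and label_translate: "g \<in> carrier G \<Longrightarrow> (u, v) \<in> E \<Longrightarrow>
      \<kappa> (translate G g u, translate G g v) = act g (\<kappa> (u, v))"
    and out_degree: "finite {v. (u, v) \<in> E}" "card {v. (u, v) \<in> E} \<le> \<Delta>"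
    and in_degree: "finite {u. (u, v) \<in> E}" "card {u. (u, v) \<in> E} \<le> \<Delta>"
    and degree_pos: "0 < \<Delta>"
    and countable_carrier: "countable (carrier G)"
    and drop_le: "\<delta> \<le> 1"
    and connectors: "\<exists>J. \<forall>y\<in>carrier G. \<forall>n>J. M <
      card {v. \<exists>\<sigma>. walk {..n} (y, n) \<sigma> v \<and> length \<sigma> = J \<and> snd v = n - \<delta> * J}"
    and prob_\<mu>: "prob_space \<mu>" and sets_\<mu>: "sets \<mu> = sets borel"
    and no_atoms: "emeasure \<mu> {t} = 0"
    and \<mu>_pos: "AE t in \<mu>. 0 < t"
    and \<mu>_mean: "integrable \<mu> (\<lambda>t. t)"
    and lo_hi: "lo < hi" "0 < hi" "0 < measure \<mu> {..lo}" "measure \<mu> {..<hi} = 1 / (4 * real \<Delta>)"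
begin

declare split_paired_All [simp del] split_paired_Ex [simp del]

abbreviation "P \<equiv> PiM (\<kappa> ` E) (\<lambda>_. \<mu>)"

lemma space_\<mu>: "space \<mu> = UNIV"
  using sets_eq_imp_space_eq[OF sets_\<mu>] by simp

sublocale \<mu>: prob_space \<mu> by (rule prob_\<mu>)

sublocale P: product_prob_space "\<lambda>_. \<mu>" "\<kappa> ` E" by unfold_locales

lemma countable_E: "countable E"
proof -
  have "E \<subseteq> V \<times> V"
    using arcs_simps by (auto simp: mem_Times_iff)
  moreover have "countable (V \<times> V)"
    using countable_carrier by auto
  ultimately show ?thesis by (rule countable_subset)
qed

lemma countable_lists_E: "countable (lists E)"
  using countable_E by (rule countable_lists)

lemma measurable_label: "e \<in> E \<Longrightarrow> (\<lambda>\<omega>. \<omega> (\<kappa> e)) \<in> borel_measurable P"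
  using measurable_component_singleton[of "\<kappa> e" "\<kappa> ` E" "\<lambda>_. \<mu>"] measurable_cong_sets[OF refl sets_\<mu>, of P]
  by blast

lemma measurable_weight: "set p \<subseteq> E \<Longrightarrow> (\<lambda>\<omega>. weight \<omega> p) \<in> borel_measurable P"
  by (induction p) (auto intro!: borel_measurable_add measurable_label)

section \<open>Long paths carry many high weights\<close>

definition nhigh :: "('e \<Rightarrow> real) \<Rightarrow> 'g arc list \<Rightarrow> nat" where
  "nhigh \<omega> p = length (filter (\<lambda>e. hi \<le> \<omega> (\<kappa> e)) p)"

lemma measurable_nhigh: "set p \<subseteq> E \<Longrightarrow> (\<lambda>\<omega>. nhigh \<omega> p) \<in> measurable P (count_space UNIV)"
proof (induction p)
  case (Cons e p)
  have [measurable]: "(\<lambda>\<omega>. \<omega> (\<kappa> e)) \<in> borel_measurable P" using Cons by (auto intro!: measurable_label)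
  have [measurable]: "(\<lambda>\<omega>. nhigh \<omega> p) \<in> measurable P (count_space UNIV)" using Cons by auto
  have "(\<lambda>\<omega>. nhigh \<omega> (e # p)) = (\<lambda>\<omega>. if hi \<le> \<omega> (\<kappa> e) then Suc (nhigh \<omega> p) else nhigh \<omega> p)"
    by (auto simp: nhigh_def)
  then show ?case by simp
qed (simp add: nhigh_def)

lemma weight_ge_nhigh:
  assumes "\<forall>e\<in>E. 0 < \<omega> (\<kappa> e)" "set p \<subseteq> E"
  shows "hi * nhigh \<omega> p \<le> weight \<omega> p"
  using assms(2)
proof (induction p)
  case (Cons e p)
  with assms(1) have "0 < \<omega> (\<kappa> e)" by auto
  with Cons show ?case by (auto simp: nhigh_def algebra_simps)
qed (simp add: nhigh_def)

text \<open>Union bound over the set of labels whose weight is below \<open>hi\<close>.\<close>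
lemma few_high_weights:
  assumes p: "set p \<subseteq> E" "distinct (map \<kappa> p)"
  shows "\<P>(\<omega> in P. nhigh \<omega> p \<le> r) \<le> (4 * real \<Delta>) ^ r / (2 * real \<Delta>) ^ length p"
proof -
  define \<beta> where "\<beta> = measure \<mu> {..<hi}"
  have \<beta>: "\<beta> = 1 / (4 * real \<Delta>)" "0 < \<beta>" "\<beta> \<le> 1"
    using lo_hi(4) degree_pos unfolding \<beta>_def by auto
  let ?Q = "\<kappa> ` set p" and ?k = "length p"
  let ?low = "\<lambda>R. {\<omega> \<in> space P. \<forall>e\<in>R. \<omega> e \<in> {..<hi}}"
  let ?RR = "{R. R \<subseteq> ?Q \<and> ?k - r \<le> card R}"
  have fQ: "finite ?RR" by auto
  have low: "?low R \<in> sets P" "measure P (?low R) = \<beta> ^ card R" if "R \<subseteq> ?Q" for R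
  proof -
    have R: "R \<subseteq> \<kappa> ` E" "finite R" using that p by (auto intro: finite_subset)
    have "?low R = prod_emb (\<kappa> ` E) (\<lambda>_. \<mu>) R (\<Pi>\<^sub>E e\<in>R. {..<hi})"
      using R by (auto simp: prod_emb_def space_PiM PiE_iff extensional_def)
    then show "?low R \<in> sets P" using R sets_\<mu> by (auto intro!: sets_PiM_I)
    have "emeasure P (?low R) = (\<Prod>e\<in>R. emeasure \<mu> {..<hi})"
      using R sets_\<mu> by (intro P.emeasure_PiM_Collect) auto
    also have "\<dots> = ennreal (\<beta> ^ card R)"
      by (simp add: \<beta>_def \<mu>.emeasure_eq_measure ennreal_power)
    finally show "measure P (?low R) = \<beta> ^ card R"
      using \<beta> by (simp add: P.emeasure_eq_measure)
  qed
  have "{\<omega> \<in> space P. nhigh \<omega> p \<le> r} \<subseteq> (\<Union>R\<in>?RR. ?low R)"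
  proof
    fix \<omega> assume \<omega>: "\<omega> \<in> {\<omega> \<in> space P. nhigh \<omega> p \<le> r}"
    let ?R = "\<kappa> ` set (filter (\<lambda>e. \<not> hi \<le> \<omega> (\<kappa> e)) p)"
    have "distinct (map \<kappa> (filter (\<lambda>e. \<not> hi \<le> \<omega> (\<kappa> e)) p))" using p(2) by (rule distinct_map_filter)
    then have "card ?R = length (filter (\<lambda>e. \<not> hi \<le> \<omega> (\<kappa> e)) p)"
      using distinct_card[of "map \<kappa> (filter (\<lambda>e. \<not> hi \<le> \<omega> (\<kappa> e)) p)"] by simp
    moreover have "length (filter (\<lambda>e. hi \<le> \<omega> (\<kappa> e)) p) \<le> r" using \<omega> by (simp add: nhigh_def)
    ultimately have "?k - r \<le> card ?R"
      using sum_length_filter_compl[of "\<lambda>e. hi \<le> \<omega> (\<kappa> e)" p] by linarith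
    then have "?R \<in> ?RR" by auto
    moreover have "\<omega> \<in> ?low ?R" using \<omega> by auto
    ultimately show "\<omega> \<in> (\<Union>R\<in>?RR. ?low R)" by (rule UN_I)
  qed
  then have "\<P>(\<omega> in P. nhigh \<omega> p \<le> r) \<le> measure P (\<Union>R\<in>?RR. ?low R)"
    using low(1) fQ by (intro P.finite_measure_mono sets.finite_UN) auto
  also have "\<dots> \<le> (\<Sum>R\<in>?RR. measure P (?low R))"
    using low(1) fQ by (intro P.finite_measure_subadditive_finite) auto
  also have "\<dots> \<le> (\<Sum>R\<in>?RR. \<beta> ^ (?k - r))"
  proof (intro sum_mono)
    fix R assume "R \<in> ?RR"
    then show "measure P (?low R) \<le> \<beta> ^ (?k - r)"
      using low(2)[of R] \<beta>(2,3) by (simp add: power_decreasing)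
  qed
  also have "\<dots> \<le> 2 ^ ?k * \<beta> ^ (?k - r)"
  proof -
    have "card ?RR \<le> card (Pow ?Q)" by (intro card_mono) auto
    also have "\<dots> = 2 ^ card ?Q" by (simp add: card_Pow)
    also have "\<dots> \<le> 2 ^ ?k" using order_trans[OF card_image_le[of "set p" \<kappa>] card_length[of p]] by (intro power_increasing) auto
    finally have "real (card ?RR) \<le> real (2 ^ ?k)" by (rule of_nat_mono)
    then have "real (card ?RR) * \<beta> ^ (?k - r) \<le> 2 ^ ?k * \<beta> ^ (?k - r)"
      using \<beta>(2) by (intro mult_right_mono) simp_all
    then show ?thesis by simp
  qed
  \<comment> \<open>For \<open>r > ?k\<close> the natural number difference is 0, and the right-hand
    side is then at least 1.\<close>
  also have "\<beta> ^ (?k - r) \<le> \<beta> ^ ?k / \<beta> ^ r"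
  proof (cases "r \<le> ?k")
    case True
    then show ?thesis using \<beta> by (simp add: power_diff)
  next
    case False
    then have "\<beta> ^ r \<le> \<beta> ^ ?k" using \<beta> by (intro power_decreasing) auto
    then show ?thesis using False \<beta> by (simp add: le_divide_eq)
  qed
  then have "2 ^ ?k * \<beta> ^ (?k - r) \<le> 2 ^ ?k * (\<beta> ^ ?k / \<beta> ^ r)" by (intro mult_left_mono) auto
  also have "\<dots> = (4 * real \<Delta>) ^ r / (2 * real \<Delta>) ^ length p"
  proof -
    have "(4 * real \<Delta>) ^ ?k = 2 ^ ?k * (2 * real \<Delta>) ^ ?k" by (subst power_mult_distrib[symmetric]) simp
    then show ?thesis unfolding \<beta>(1) using degree_pos by (simp add: power_divide)
  qed
  finally show ?thesis .
qed

lemma card_walks: "card {p. length p = n \<and> (\<exists>v. walk B u p v)} \<le> \<Delta> ^ n"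
proof (induction n arbitrary: u)
  case 0
  have "{p. length p = 0 \<and> (\<exists>v. walk B u p v)} \<subseteq> {[]}" by auto
  then show ?case using card_mono[of "{[]}"] by simp
next
  case (Suc n)
  let ?W = "\<lambda>u n. {p. length p = n \<and> (\<exists>v. walk B u p v)}"
  have fin: "finite (?W u n)" for u n by (rule finite_walks[OF out_degree(1)])
  have "?W u (Suc n) \<subseteq> (\<Union>w\<in>{w. (u, w) \<in> E}. (#) (u, w) ` ?W w n)"
  proof
    fix p assume p: "p \<in> ?W u (Suc n)"
    then obtain e q where pe: "p = e # q" by (cases p) auto
    obtain u' w where ew: "e = (u', w)" by (cases e)
    with pe p have "u' = u" "(u, w) \<in> E" "q \<in> ?W w n" by auto
    then show "p \<in> (\<Union>w\<in>{w. (u, w) \<in> E}. (#) (u, w) ` ?W w n)"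
      using pe ew by (intro UN_I[of w] image_eqI[of _ _ q]) auto
  qed
  then have "card (?W u (Suc n)) \<le> card (\<Union>w\<in>{w. (u, w) \<in> E}. (#) (u, w) ` ?W w n)"
    using fin out_degree by (intro card_mono) auto
  also have "\<dots> \<le> (\<Sum>w\<in>{w. (u, w) \<in> E}. card ((#) (u, w) ` ?W w n))"
    using out_degree by (intro card_UN_le) auto
  also have "\<dots> \<le> (\<Sum>w\<in>{w. (u, w) \<in> E}. \<Delta> ^ n)"
    using Suc fin by (intro sum_mono) (auto intro: order_trans[OF card_image_le])
  also have "\<dots> \<le> \<Delta> * \<Delta> ^ n" using out_degree(2)[of u] by simp
  finally show ?case by simp
qed

definition few_high :: "nat \<Rightarrow> nat \<Rightarrow> 'g vertex \<Rightarrow> ('e \<Rightarrow> real) \<Rightarrow> bool" where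
  "few_high k r u \<omega> \<longleftrightarrow> (\<exists>p\<in>{p \<in> lists E. (\<exists>v. path u p v) \<and> length p = k}. nhigh \<omega> p \<le> r)"

lemma pred_few_high [measurable]: "Measurable.pred P (few_high k r u)"
  unfolding few_high_def
proof (rule pred_countable_Bex)
  show "countable {p \<in> lists E. (\<exists>v. path u p v) \<and> length p = k}"
    using countable_lists_E by (rule countable_subset[rotated]) auto
  fix p assume "p \<in> {p \<in> lists E. (\<exists>v. path u p v) \<and> length p = k}"
  then have [measurable]: "(\<lambda>\<omega>. nhigh \<omega> p) \<in> measurable P (count_space UNIV)"
    by (intro measurable_nhigh) auto
  show "Measurable.pred P (\<lambda>\<omega>. nhigh \<omega> p \<le> r)" by measurable
qed

lemma prob_Union_walks:
  assumes W: "W \<subseteq> {p. length p = k \<and> (\<exists>v. walk B u p v)}" and X: "X \<subseteq> (\<Union>p\<in>W. A p)"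
    and A: "\<And>p. p \<in> W \<Longrightarrow> A p \<in> sets P \<and> measure P (A p) \<le> b" and b: "0 \<le> b"
  shows "measure P X \<le> real \<Delta> ^ k * b"
proof -
  have fin: "finite W" using finite_subset[OF W finite_walks[OF out_degree(1)]] .
  have "card W \<le> \<Delta> ^ k"
    using card_mono[OF finite_walks[OF out_degree(1)] W] card_walks by (rule order_trans)
  then have card: "real (card W) \<le> real \<Delta> ^ k" using of_nat_mono[of "card W" "\<Delta> ^ k", where 'a = real] by simp
  have "measure P X \<le> measure P (\<Union>p\<in>W. A p)"
    using X A fin by (intro P.finite_measure_mono) auto
  also have "\<dots> \<le> (\<Sum>p\<in>W. measure P (A p))"
    using A fin by (intro P.finite_measure_subadditive_finite) auto
  also have "\<dots> \<le> (\<Sum>p\<in>W. b)" using A by (intro sum_mono) blast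
  also have "\<dots> \<le> real \<Delta> ^ k * b" using card b by (simp add: mult_right_mono)
  finally show ?thesis .
qed

text \<open>Here the value \<open>1 / (4 * real \<Delta>)\<close> for the probability of a low
  weight is spent: per arc, a factor 2 pays for the choice of the set of low labels and a factor
  \<open>\<Delta>\<close> for the choice of the path, which leaves 1/2.\<close>

lemma prob_few_high: "\<P>(\<omega> in P. few_high k r u \<omega>) \<le> (4 * real \<Delta>) ^ r / 2 ^ k"
proof -
  let ?W = "{p \<in> lists E. (\<exists>v. path u p v) \<and> length p = k}"
  have "\<P>(\<omega> in P. few_high k r u \<omega>) \<le> real \<Delta> ^ k * ((4 * real \<Delta>) ^ r / (2 * real \<Delta>) ^ k)"
  proof (rule prob_Union_walks)
    show "?W \<subseteq> {p. length p = k \<and> (\<exists>v. walk UNIV u p v)}" by (auto simp: path_def)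
    show "{\<omega> \<in> space P. few_high k r u \<omega>} \<subseteq> (\<Union>p\<in>?W. {\<omega> \<in> space P. nhigh \<omega> p \<le> r})"
      unfolding few_high_def by blast
    fix p assume "p \<in> ?W"
    then obtain v where p: "set p \<subseteq> E" "path u p v" "length p = k" by auto
    have [measurable]: "(\<lambda>\<omega>. nhigh \<omega> p) \<in> measurable P (count_space UNIV)" using p(1) by (rule measurable_nhigh)
    have "{\<omega> \<in> space P. nhigh \<omega> p \<le> r} \<in> sets P" by measurable
    with few_high_weights[OF p(1) path_distinct_labels[OF p(2)], of r] p(3)
    show "{\<omega> \<in> space P. nhigh \<omega> p \<le> r} \<in> sets P \<and>
        \<P>(\<omega> in P. nhigh \<omega> p \<le> r) \<le> (4 * real \<Delta>) ^ r / (2 * real \<Delta>) ^ k" by simp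
  qed simp
  also have "\<dots> = (4 * real \<Delta>) ^ r / 2 ^ k"
    using degree_pos by (simp add: power_mult_distrib)
  finally show ?thesis .
qed

lemma not_few_highD:
  assumes pos: "\<forall>e\<in>E. 0 < \<omega> (\<kappa> e)" and nf: "\<not> few_high k r u \<omega>" and p: "path u p v" "k \<le> length p"
  shows "hi * (r + 1) \<le> weight \<omega> p"
proof -
  have sub: "set p \<subseteq> E" using p by (auto simp: path_def dest: walk_subset)
  have "take k p \<in> lists E" using sub by (auto dest: in_set_takeD)
  moreover have "\<exists>w. path u (take k p) w" using path_take[OF p] .
  moreover have "length (take k p) = k" using p(2) by simp
  ultimately have "take k p \<in> {p \<in> lists E. (\<exists>v. path u p v) \<and> length p = k}" by simp
  then have "r < nhigh \<omega> (take k p)" using nf unfolding few_high_def by (meson not_le)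
  then have "hi * (r + 1) \<le> hi * nhigh \<omega> (take k p)" using lo_hi(2) by (intro mult_left_mono) auto
  also have "\<dots> \<le> weight \<omega> (take k p)"
    using sub by (intro weight_ge_nhigh[OF pos]) (auto dest: in_set_takeD)
  also have "\<dots> \<le> weight \<omega> (take k p) + weight \<omega> (drop k p)"
    using sub weight_nonneg[OF pos, of "drop k p"] by (auto dest: in_set_dropD)
  also have "\<dots> = weight \<omega> (take k p @ drop k p)" by (simp only: weight_simps)
  finally show ?thesis by simp
qed

section \<open>Almost every configuration is good\<close>

lemma AE_pos: "AE \<omega> in P. \<forall>e\<in>E. 0 < \<omega> (\<kappa> e)"
  using countable_E prob_\<mu> \<mu>_pos
  by (subst AE_ball_countable) (auto intro!: AE_PiM_component)

lemma AE_not_few_high: "AE \<omega> in P. \<exists>k. \<not> few_high k r u \<omega>"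
proof (rule AE_I)
  let ?A = "{\<omega> \<in> space P. \<forall>k. few_high k r u \<omega>}"
  show "?A \<in> sets P" by measurable
  have "measure P ?A \<le> (4 * real \<Delta>) ^ r / 2 ^ k" for k
    by (rule order_trans[OF P.finite_measure_mono prob_few_high]) auto
  moreover have "(\<lambda>k. (4 * real \<Delta>) ^ r / 2 ^ k) \<longlonglongrightarrow> 0"
    by (rule LIMSEQ_divide_realpow_zero) simp
  ultimately have "measure P ?A \<le> 0" by (intro LIMSEQ_le_const) auto
  then show "emeasure P ?A = 0" by (simp add: P.emeasure_eq_measure measure_le_0_iff)
  show "{\<omega> \<in> space P. \<not> (\<exists>k. \<not> few_high k r u \<omega>)} \<subseteq> ?A" by auto
qed

lemma AE_weights_neq:
  assumes "p \<in> lists E" "q \<in> lists E" "distinct (map \<kappa> p)" "distinct (map \<kappa> q)" "\<kappa> ` set p \<noteq> \<kappa> ` set q"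
  shows "AE \<omega> in P. weight \<omega> p \<noteq> weight \<omega> q"
proof -
  have *: "weight \<omega> p = sum \<omega> (\<kappa> ` set p)" if "distinct (map \<kappa> p)" for \<omega> p
    using that by (induction p) auto
  have "AE \<omega> in P. sum \<omega> (\<kappa> ` set p) \<noteq> sum \<omega> (\<kappa> ` set q)"
    using assms by (intro AE_PiM_sum_neq prob_\<mu> sets_\<mu> no_atoms) auto
  then show ?thesis using assms by (simp add: *)
qed

lemma AE_good: "AE \<omega> in P. good \<omega>"
proof -
  let ?PP = "{(p, q). p \<in> lists E \<and> q \<in> lists E \<and> distinct (map \<kappa> p) \<and> distinct (map \<kappa> q) \<and>
    \<kappa> ` set p \<noteq> \<kappa> ` set q}"
  have "countable V" using countable_carrier by auto
  then have 1: "AE \<omega> in P. \<forall>u\<in>V. \<forall>r. \<exists>k. \<not> few_high k r u \<omega>"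
    by (subst AE_ball_countable) (auto simp del: not_all simp: AE_all_countable intro: AE_not_few_high)
  have "countable ?PP"
    by (rule countable_subset[of _ "lists E \<times> lists E"]) (use countable_lists_E in auto)
  then have 2: "AE \<omega> in P. \<forall>x\<in>?PP. weight \<omega> (fst x) \<noteq> weight \<omega> (snd x)"
  proof (subst AE_ball_countable, assumption, intro ballI)
    fix x assume "x \<in> ?PP"
    then obtain p q where x: "x = (p, q)" and pq: "p \<in> lists E" "q \<in> lists E" "distinct (map \<kappa> p)"
      "distinct (map \<kappa> q)" "\<kappa> ` set p \<noteq> \<kappa> ` set q" by blast
    show "AE \<omega> in P. weight \<omega> (fst x) \<noteq> weight \<omega> (snd x)"
      unfolding x fst_conv snd_conv using pq by (rule AE_weights_neq)
  qed
  show ?thesis using AE_pos 1 2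
  proof eventually_elim
    case (elim \<omega>)
    have "\<exists>L. \<forall>p v. path u p v \<and> L \<le> length p \<longrightarrow> t < weight \<omega> p" for u and t :: real
    proof (cases "u \<in> V")
      case True
      obtain r :: nat where r: "t / hi < r" using reals_Archimedean2 by blast
      obtain k where k: "\<not> few_high k r u \<omega>" using elim(2) True by blast
      have large: "t < weight \<omega> p" if "path u p v" "k \<le> length p" for p v
      proof -
        have "t < hi * (r + 1)" using r lo_hi(2) by (simp add: field_simps)
        also have "\<dots> \<le> weight \<omega> p" by (rule not_few_highD[OF elim(1) k that])
        finally show ?thesis .
      qed
      show ?thesis by (intro exI[of _ k] allI impI) (elim conjE, rule large)
    next
      case False
      then have "\<not> path u p v" for p v using walk_start[of UNIV u p v] by (auto simp: path_def)
      then show ?thesis by simp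
    qed
    moreover have "weight \<omega> p \<noteq> weight \<omega> q"
      if "path u p v \<and> path u q w \<and> snd v = 0 \<and> snd w = 0 \<and> v \<noteq> w" for u p v q w
    proof -
      from that have pq: "path u p v" "path u q w" "snd v = 0" "snd w = 0" "v \<noteq> w" by auto
      \<comment> \<open>This puts the pair among the countably many pairs of arc lists for which
        ties have been excluded; paths with equal label sets would have equal weights for every
        configuration.\<close>
      then have "\<kappa> ` set p \<noteq> \<kappa> ` set q" using path_labels_root by metis
      moreover have "set p \<subseteq> E" "set q \<subseteq> E" using pq by (auto simp: path_def dest: walk_subset)
      ultimately have "(p, q) \<in> ?PP"
        using pq(1,2)[THEN path_distinct_labels] by (auto simp: in_lists_conv_set)
      from bspec[OF elim(3) this] show ?thesis by simp
    qed
    ultimately show ?case using elim(1) unfolding good_def by simp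
  qed
qed

section \<open>Measurability\<close>

lemma countable_V: "countable (carrier G \<times> (B :: nat set))"
  using countable_carrier by auto

lemma pred_geod [measurable]: "Measurable.pred P (\<lambda>\<omega>. geod B \<omega> u p v)"
proof (cases "walk B u p v \<and> snd v = 0")
  case True
  let ?W = "{q. \<exists>w. walk B u q w \<and> snd w = 0}"
  have "?W \<subseteq> lists E" by (auto dest: walk_subset)
  then have W: "countable ?W" using countable_lists_E by (rule countable_subset)
  have "Measurable.pred P (\<lambda>\<omega>. \<forall>q\<in>?W. weight \<omega> p \<le> weight \<omega> q)"
  proof (rule pred_countable_Ball[OF W])
    fix q assume "q \<in> ?W"
    then have "set p \<subseteq> E" "set q \<subseteq> E" using True by (auto dest: walk_subset)
    then show "Measurable.pred P (\<lambda>\<omega>. weight \<omega> p \<le> weight \<omega> q)"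
      unfolding pred_def by (intro borel_measurable_le measurable_weight)
  qed
  moreover have "geod B \<omega> u p v \<longleftrightarrow> (\<forall>q\<in>?W. weight \<omega> p \<le> weight \<omega> q)" for \<omega>
    using True unfolding geod_def by blast
  ultimately show ?thesis by simp
next
  case False
  then have "\<not> geod B \<omega> u p v" for \<omega> unfolding geod_def by blast
  then show ?thesis by simp
qed

lemma geod_lists: "geod B \<omega> u p v \<Longrightarrow> p \<in> lists E"
  by (auto simp: geod_def dest: walk_subset)

lemma pred_root [measurable]: "Measurable.pred P (\<lambda>\<omega>. root B \<omega> u v)"
proof -
  have "root B \<omega> u v \<longleftrightarrow> (\<exists>p\<in>lists E. geod B \<omega> u p v)" for \<omega>
    using geod_lists unfolding root_def by blast
  then show ?thesis by (simp add: pred_countable_Bex countable_lists_E)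
qed

lemma root_in_V:
  assumes "root B \<omega> u v"
  shows "u \<in> carrier G \<times> B" "v \<in> carrier G \<times> {0}"
proof -
  obtain p where "walk B u p v" "snd v = 0" using assms unfolding root_def geod_def by blast
  with walk_start[of B u p v] walk_end[of B u p v] show "u \<in> carrier G \<times> B" "v \<in> carrier G \<times> {0}"
    by (auto simp: mem_Times_iff)
qed

lemma pred_alive [measurable]: "Measurable.pred P (\<lambda>\<omega>. alive n \<omega> v)"
proof -
  have "alive n \<omega> v \<longleftrightarrow> (\<exists>y\<in>carrier G. root {..n} \<omega> (y, n) v)" for \<omega>
    using root_in_V(1)[of "{..n}" \<omega> "(_, n)" v] unfolding alive_def by auto
  then show ?thesis by (simp add: pred_countable_Bex countable_carrier)
qed

lemma pred_near [measurable]: "Measurable.pred P (\<lambda>\<omega>. near B \<omega> \<rho> n m U)"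
proof -
  have "v \<in> V" if "geod B \<omega> U p v" for \<omega> p v
    using walk_end[of B U p v] that by (simp add: geod_def mem_Times_iff)
  then have "near B \<omega> \<rho> n m U \<longleftrightarrow> (\<exists>p\<in>lists E. \<exists>v\<in>V. geod B \<omega> U p v \<and> near_walk B \<rho> n m U p v)" for \<omega>
    using geod_lists unfolding near_def by blast
  moreover have "Measurable.pred P (\<lambda>\<omega>. \<exists>p\<in>lists E. \<exists>v\<in>V. geod B \<omega> U p v \<and> near_walk B \<rho> n m U p v)"
    by (intro pred_countable_Bex countable_lists_E countable_V pred_intros_logic pred_geod) simp
  ultimately show ?thesis by simp
qed

text \<open>The passage time to level \<open>0\<close>, truncated at \<open>0\<close> on the null event of negative weights.\<close>
definition ptime :: "nat set \<Rightarrow> 'g vertex \<Rightarrow> ('e \<Rightarrow> real) \<Rightarrow> ennreal" where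
  "ptime B u \<omega> = (INF p\<in>{p. \<exists>v. walk B u p v \<and> snd v = 0}. ennreal (weight \<omega> p))"

lemma measurable_ptime [measurable]: "ptime B u \<in> borel_measurable P"
proof -
  let ?W = "{q. \<exists>w. walk B u q w \<and> snd w = 0}"
  have sub: "?W \<subseteq> lists E" by (auto dest: walk_subset)
  then have W: "countable ?W" using countable_lists_E by (rule countable_subset)
  have "(\<lambda>\<omega>. INF q\<in>?W. ennreal (weight \<omega> q)) \<in> borel_measurable P"
    using sub by (intro borel_measurable_INF W measurable_compose[OF measurable_weight measurable_ennreal]) auto
  then show ?thesis by (simp add: ptime_def[abs_def])
qed

lemma ptime_geod:
  assumes "geod B \<omega> u p v"
  shows "ptime B u \<omega> = ennreal (weight \<omega> p)"
  unfolding ptime_def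
proof (rule antisym)
  show "(INF p\<in>{p. \<exists>v. walk B u p v \<and> snd v = 0}. ennreal (weight \<omega> p)) \<le> ennreal (weight \<omega> p)"
    using assms unfolding geod_def by (intro INF_lower) blast
  show "ennreal (weight \<omega> p) \<le> (INF p\<in>{p. \<exists>v. walk B u p v \<and> snd v = 0}. ennreal (weight \<omega> p))"
  proof (rule INF_greatest)
    fix q assume "q \<in> {p. \<exists>v. walk B u p v \<and> snd v = 0}"
    then have "weight \<omega> p \<le> weight \<omega> q" using assms unfolding geod_def by blast
    then show "ennreal (weight \<omega> p) \<le> ennreal (weight \<omega> q)" by (rule ennreal_leI)
  qed
qed

lemma ptime_le: "walk B u p v \<Longrightarrow> snd v = 0 \<Longrightarrow> ptime B u \<omega> \<le> ennreal (weight \<omega> p)"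
  unfolding ptime_def by (intro INF_lower) blast

section \<open>Translation invariance and mass transport\<close>

abbreviation tr :: "'g \<Rightarrow> 'g vertex \<Rightarrow> 'g vertex" where "tr g u \<equiv> translate G g u"

definition tra :: "'g \<Rightarrow> 'g arc \<Rightarrow> 'g arc" where
  "tra g e = (tr g (fst e), tr g (snd e))"

definition shift :: "'g \<Rightarrow> ('e \<Rightarrow> real) \<Rightarrow> 'e \<Rightarrow> real" where
  "shift g \<omega> = (\<lambda>e\<in>\<kappa> ` E. \<omega> (act g e))"

lemma tra_E: "g \<in> carrier G \<Longrightarrow> e \<in> E \<Longrightarrow> tra g e \<in> E"
  using arcs_translate[of g "fst e" "snd e"] by (simp add: tra_def)

lemma label_tra: "g \<in> carrier G \<Longrightarrow> e \<in> E \<Longrightarrow> \<kappa> (tra g e) = act g (\<kappa> e)"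
  using label_translate[of g "fst e" "snd e"] by (simp add: tra_def)

lemma snd_tr [simp]: "snd (tr g u) = snd u"
  by (simp add: translate_def)

lemma tr_V: "g \<in> carrier G \<Longrightarrow> u \<in> carrier G \<times> B \<Longrightarrow> tr g u \<in> carrier G \<times> B"
  by (auto simp: translate_def mem_Times_iff)

lemma tr_inv [simp]:
  assumes "g \<in> carrier G" "fst u \<in> carrier G"
  shows "tr (inv g) (tr g u) = u" "tr g (tr (inv g) u) = u"
  using assms by (simp_all add: translate_def m_assoc[symmetric])

lemma tra_inv:
  assumes "g \<in> carrier G" "e \<in> E"
  shows "tra (inv g) (tra g e) = e" "tra g (tra (inv g) e) = e"
  using assms arcs_simps(1,2)[OF assms(2)] by (simp_all add: tra_def)

lemma map_tra_inv:
  assumes "g \<in> carrier G" "set p \<subseteq> E"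
  shows "map (tra (inv g)) (map (tra g) p) = p" "map (tra g) (map (tra (inv g)) p) = p"
  using assms(2) tra_inv[OF assms(1)] by (induction p) auto

lemma walk_translate: "g \<in> carrier G \<Longrightarrow> walk B u p v \<Longrightarrow> walk B (tr g u) (map (tra g) p) (tr g v)"
  by (induction p arbitrary: u) (auto simp: tra_E tr_V, auto simp: tra_def)

lemma walk_untranslate:
  assumes "g \<in> carrier G" "u \<in> V" "walk B (tr g u) q w"
  shows "walk B u (map (tra (inv g)) q) (tr (inv g) w)"
  using walk_translate[OF inv_closed[OF assms(1)] assms(3)] assms(1,2) by (simp add: mem_Times_iff)

lemma shift_label: "g \<in> carrier G \<Longrightarrow> e \<in> E \<Longrightarrow> shift g \<omega> (\<kappa> e) = \<omega> (\<kappa> (tra g e))"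
  by (simp add: shift_def label_tra)

lemma weight_shift: "g \<in> carrier G \<Longrightarrow> set p \<subseteq> E \<Longrightarrow> weight (shift g \<omega>) p = weight \<omega> (map (tra g) p)"
  by (induction p) (auto simp: shift_label)

lemma nhigh_shift: "g \<in> carrier G \<Longrightarrow> set p \<subseteq> E \<Longrightarrow> nhigh (shift g \<omega>) p = nhigh \<omega> (map (tra g) p)"
  by (induction p) (auto simp: shift_label nhigh_def)

lemma shift_inv:
  assumes g: "g \<in> carrier G" and \<omega>: "\<omega> \<in> space P"
  shows "shift (inv g) (shift g \<omega>) = \<omega>"
proof
  fix i
  show "shift (inv g) (shift g \<omega>) i = \<omega> i"
  proof (cases "i \<in> \<kappa> ` E")
    case True
    then obtain e where e: "e \<in> E" "i = \<kappa> e" by blast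
    then show ?thesis using g tra_E[of "inv g" e] tra_inv(2)[OF g e(1)] by (simp add: shift_label)
  next
    case False
    then show ?thesis using \<omega> by (simp add: shift_def space_PiM PiE_iff extensional_def)
  qed
qed

lemma geod_shift:
  assumes g: "g \<in> carrier G" and p: "geod B (shift g \<omega>) u p v"
  shows "geod B \<omega> (tr g u) (map (tra g) p) (tr g v)"
  unfolding geod_def
proof (intro conjI allI impI)
  have w: "walk B u p v" using p by (simp add: geod_def)
  then show "walk B (tr g u) (map (tra g) p) (tr g v)" by (rule walk_translate[OF g])
  show "snd (tr g v) = 0" using p by (simp add: geod_def)
  fix q w' assume "walk B (tr g u) q w' \<and> snd w' = 0"
  then have q: "walk B (tr g u) q w'" "snd w' = 0" by auto
  let ?q = "map (tra (inv g)) q"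
  have u: "u \<in> V" using walk_start[OF w] by (simp add: mem_Times_iff)
  have q': "walk B u ?q (tr (inv g) w')" using walk_untranslate[OF g u q(1)] .
  then have "weight (shift g \<omega>) p \<le> weight (shift g \<omega>) ?q"
    using p q(2) unfolding geod_def by (metis snd_tr)
  then show "weight \<omega> (map (tra g) p) \<le> weight \<omega> q"
    using weight_shift[OF g walk_subset[OF w]] weight_shift[OF g walk_subset[OF q']]
      map_tra_inv(2)[OF g walk_subset[OF q(1)]] by simp
qed

lemma root_shift:
  assumes g: "g \<in> carrier G" and \<omega>: "\<omega> \<in> space P" and uv: "u \<in> V" "v \<in> V"
  shows "root B (shift g \<omega>) u v \<longleftrightarrow> root B \<omega> (tr g u) (tr g v)"
proof
  assume "root B \<omega> (tr g u) (tr g v)"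
  then have "root B (shift (inv g) (shift g \<omega>)) (tr g u) (tr g v)" by (simp add: shift_inv[OF g \<omega>])
  then have "root B (shift g \<omega>) (tr (inv g) (tr g u)) (tr (inv g) (tr g v))"
    using geod_shift[OF inv_closed[OF g]] unfolding root_def by blast
  then show "root B (shift g \<omega>) u v" using g uv by (simp add: mem_Times_iff)
next
  assume "root B (shift g \<omega>) u v"
  then show "root B \<omega> (tr g u) (tr g v)" using geod_shift[OF g] unfolding root_def by blast
qed

lemma ptime_shift:
  assumes g: "g \<in> carrier G" and \<omega>: "\<omega> \<in> space P" and u: "u \<in> V"
  shows "ptime B u (shift g \<omega>) = ptime B (tr g u) \<omega>"
proof -
  have ge: "ptime B (tr h u) \<eta> \<le> ptime B u (shift h \<eta>)" if h: "h \<in> carrier G" for h u \<eta>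
    unfolding ptime_def[of B u]
  proof (rule INF_greatest)
    fix p assume "p \<in> {p. \<exists>v. walk B u p v \<and> snd v = 0}"
    then obtain v where p: "walk B u p v" "snd v = 0" by blast
    show "ptime B (tr h u) \<eta> \<le> ennreal (weight (shift h \<eta>) p)"
      using ptime_le[OF walk_translate[OF h p(1)]] p(2) weight_shift[OF h walk_subset[OF p(1)]] by simp
  qed
  have "ptime B u (shift g \<omega>) \<le> ptime B (tr g u) \<omega>"
    using ge[OF inv_closed[OF g], of "tr g u" "shift g \<omega>"] g \<omega> u by (simp add: shift_inv mem_Times_iff)
  then show ?thesis by (rule antisym[OF _ ge[OF g]])
qed

lemma path_translate:
  assumes "g \<in> carrier G" "path u p v"
  shows "path (tr g u) (map (tra g) p) (tr g v)"
proof -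
  have w: "walk UNIV u p v" using assms(2) by (simp add: path_def)
  let ?vs = "u # map snd p"
  have eq: "tr g u # map snd (map (tra g) p) = map (tr g) ?vs" by (simp add: tra_def)
  have "inj_on (tr g) (set ?vs)"
  proof (rule inj_onI)
    fix a b assume ab: "a \<in> set ?vs" "b \<in> set ?vs" "tr g a = tr g b"
    then have "fst a \<in> carrier G" "fst b \<in> carrier G"
      using walk_start[OF w] walk_subset[OF w] arcs_simps(2) by (auto simp: mem_Times_iff)
    then show "a = b" using ab(3) tr_inv(1)[OF assms(1)] by metis
  qed
  then have "distinct (tr g u # map snd (map (tra g) p))"
    unfolding eq using assms(2) by (simp only: distinct_map path_def)
  then show ?thesis using walk_translate[OF assms(1) w] unfolding path_def by blast
qed

lemma few_high_shift:
  assumes g: "g \<in> carrier G" and few: "few_high k r u (shift g \<omega>)"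
  shows "few_high k r (tr g u) \<omega>"
proof -
  obtain p v where p: "p \<in> lists E" "path u p v" "length p = k" "nhigh (shift g \<omega>) p \<le> r"
    using few unfolding few_high_def by blast
  then have E: "set p \<subseteq> E" by auto
  have "map (tra g) p \<in> lists E"
    using E tra_E[OF g] unfolding in_lists_conv_set set_map by blast
  moreover have "path (tr g u) (map (tra g) p) (tr g v)" using path_translate[OF g p(2)] .
  moreover have "nhigh \<omega> (map (tra g) p) \<le> r" using p(4) nhigh_shift[OF g E] by simp
  ultimately show ?thesis unfolding few_high_def using p(3)
    by (intro bexI[of _ "map (tra g) p"]) auto
qed

lemma near_shift:
  assumes g: "g \<in> carrier G" and near: "near B (shift g \<omega>) \<rho> n m U"
  shows "near B \<omega> \<rho> n m (tr g U)"
proof -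
  obtain p v where p: "geod B (shift g \<omega>) U p v" "near_walk B \<rho> n m U p v"
    using near unfolding near_def by (elim exE conjE)
  from p(2) obtain p0 p1 p2 u w where *: "p = p0 @ p1 @ p2" "walk B U p0 u"
      "snd u = n" "walk B u p1 w" "length p1 \<le> \<rho>" "snd w = m" "walk {..m} w p2 v"
    unfolding near_walk_def by (elim exE conjE)
  have "map (tra g) p = map (tra g) p0 @ map (tra g) p1 @ map (tra g) p2" using *(1) by simp
  moreover note walk_translate[OF g *(2)] walk_translate[OF g *(4)] walk_translate[OF g *(7)]
  moreover have "snd (tr g u) = n" "length (map (tra g) p1) \<le> \<rho>" "snd (tr g w) = m" using * by auto
  ultimately have "near_walk B \<rho> n m (tr g U) (map (tra g) p) (tr g v)"
    unfolding near_walk_def by (intro exI conjI)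
  with geod_shift[OF g p(1)] show ?thesis unfolding near_def by (intro exI conjI)
qed

text \<open>All weights have the same law, so it suffices that \<open>act g\<close> maps the labels
  injectively into themselves. Injectivity is seen on arcs, which can be translated back by
  \<open>inv g\<close>.\<close>

lemma distr_shift:
  assumes g: "g \<in> carrier G"
  shows "distr P P (shift g) = P"
proof -
  have "inj_on (act g) (\<kappa> ` E)"
  proof (rule inj_onI)
    fix x y assume xy: "x \<in> \<kappa> ` E" "y \<in> \<kappa> ` E" "act g x = act g y"
    then obtain a b where ab: "a \<in> E" "b \<in> E" "x = \<kappa> a" "y = \<kappa> b" by blast
    then have "\<kappa> (tra g a) = \<kappa> (tra g b)" using xy(3) g by (simp add: label_tra)
    then have "\<kappa> (tra (inv g) (tra g a)) = \<kappa> (tra (inv g) (tra g b))"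
      using g ab tra_E[OF g] by (simp add: label_tra[of "inv g"])
    then show "x = y" using ab tra_inv[OF g] by simp
  qed
  moreover have "act g \<in> \<kappa> ` E \<rightarrow> \<kappa> ` E"
    using label_tra[OF g] tra_E[OF g] by (auto simp: Pi_iff) (metis imageI)
  ultimately have "distr (PiM (\<kappa> ` E) (\<lambda>_. \<mu>)) (PiM (\<kappa> ` E) (\<lambda>i. (\<lambda>_. \<mu>) (act g i))) (\<lambda>\<omega>. \<lambda>n\<in>\<kappa> ` E. \<omega> (act g n)) =
      PiM (\<kappa> ` E) (\<lambda>i. (\<lambda>_. \<mu>) (act g i))"
    by (intro distr_PiM_reindex prob_\<mu>)
  then show ?thesis by (simp add: shift_def[abs_def])
qed

lemma measurable_shift [measurable]:
  assumes g: "g \<in> carrier G"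
  shows "shift g \<in> measurable P P"
  unfolding shift_def[abs_def]
proof (rule measurable_restrict)
  fix i assume "i \<in> \<kappa> ` E"
  then obtain e where "e \<in> E" "i = \<kappa> e" by blast
  then have "act g i \<in> \<kappa> ` E" using label_tra[OF g, of e] tra_E[OF g, of e] by (metis imageI)
  then show "(\<lambda>\<omega>. \<omega> (act g i)) \<in> measurable P \<mu>" by (rule measurable_component_singleton)
qed

lemma shift_space: "g \<in> carrier G \<Longrightarrow> \<omega> \<in> space P \<Longrightarrow> shift g \<omega> \<in> space P"
  using measurable_space[OF measurable_shift] .

lemma emeasure_shift:
  assumes g: "g \<in> carrier G" and A: "Measurable.pred P A"
  shows "emeasure P {\<omega> \<in> space P. A (shift g \<omega>)} = emeasure P {\<omega> \<in> space P. A \<omega>}"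
proof -
  have S: "{\<omega> \<in> space P. A \<omega>} \<in> sets P" using A by (simp add: pred_def)
  have "emeasure P {\<omega> \<in> space P. A \<omega>} = emeasure (distr P P (shift g)) {\<omega> \<in> space P. A \<omega>}"
    using distr_shift[OF g] by simp
  also have "\<dots> = emeasure P (shift g -` {\<omega> \<in> space P. A \<omega>} \<inter> space P)"
    by (rule emeasure_distr[OF measurable_shift[OF g] S])
  also have "shift g -` {\<omega> \<in> space P. A \<omega>} \<inter> space P = {\<omega> \<in> space P. A (shift g \<omega>)}"
    using shift_space[OF g] by auto
  finally show ?thesis by simp
qed

section \<open>Mass transport and first-moment bounds for a level of the tree\<close>

definition equivariant :: "('g vertex \<Rightarrow> ('e \<Rightarrow> real) \<Rightarrow> bool) \<Rightarrow> bool" where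
  "equivariant Q \<longleftrightarrow> (\<forall>u\<in>V. Measurable.pred P (Q u) \<and>
     (\<forall>g\<in>carrier G. \<forall>\<omega>\<in>space P. Q u (shift g \<omega>) \<longleftrightarrow> Q (tr g u) \<omega>))"

text \<open>One implication suffices, because \<open>shift (inv g)\<close> undoes \<open>shift g\<close>.\<close>
lemma equivariantI:
  assumes meas: "\<And>u. u \<in> V \<Longrightarrow> Measurable.pred P (Q u)"
    and imp: "\<And>u g \<omega>. u \<in> V \<Longrightarrow> g \<in> carrier G \<Longrightarrow> \<omega> \<in> space P \<Longrightarrow>
      Q u (shift g \<omega>) \<Longrightarrow> Q (tr g u) \<omega>"
  shows "equivariant Q"
  unfolding equivariant_def
proof (intro ballI conjI iffI)
  fix u g \<omega> assume u: "u \<in> V" and g: "g \<in> carrier G" and \<omega>: "\<omega> \<in> space P"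
  show "Q u (shift g \<omega>) \<Longrightarrow> Q (tr g u) \<omega>" using u g \<omega> by (rule imp)
  assume "Q (tr g u) \<omega>"
  then have "Q (tr g u) (shift (inv g) (shift g \<omega>))" by (simp add: shift_inv[OF g \<omega>])
  then have "Q (tr (inv g) (tr g u)) (shift g \<omega>)"
    using imp[OF tr_V[OF g u] inv_closed[OF g] shift_space[OF g \<omega>]] by simp
  then show "Q u (shift g \<omega>)" using g u by (simp add: mem_Times_iff)
qed (rule meas)

text \<open>
  Translating by \<open>x y\<^sup>-\<^sup>1\<close> turns the event that \<open>(y, n)\<close> has root \<open>x\<close> into the event that
  \<open>(x, n)\<close> has root \<open>x y\<^sup>-\<^sup>1 x\<close>; these events are disjoint for different \<open>y\<close>.
\<close>
lemma mass_transport: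
  assumes Q: "equivariant Q" and x: "x \<in> carrier G"
  shows "(\<integral>\<^sup>+y. emeasure P {\<omega> \<in> space P. root B \<omega> (y, n) (x, 0) \<and> Q (y, n) \<omega>} \<partial>count_space (carrier G)) \<le>
    emeasure P {\<omega> \<in> space P. Q (x, n) \<omega>}"
proof -
  have Qm [measurable]: "Measurable.pred P (Q (y, n))" if "y \<in> carrier G" for y
    using Q that by (auto simp: equivariant_def)
  let ?e = "\<lambda>z. emeasure P {\<omega> \<in> space P. root B \<omega> (x, n) (z, 0) \<and> Q (x, n) \<omega>}"
  have eq: "emeasure P {\<omega> \<in> space P. root B \<omega> (y, n) (x, 0) \<and> Q (y, n) \<omega>} = ?e (x \<otimes> inv y \<otimes> x)"
    if y: "y \<in> carrier G" for y
  proof -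
    let ?g = "x \<otimes> inv y"
    have g: "?g \<in> carrier G" using x y by simp
    have t: "tr ?g (y, n) = (x, n)" "tr ?g (x, 0) = (x \<otimes> inv y \<otimes> x, 0)"
      using x y by (simp_all add: translate_def m_assoc)
    note Qm[OF y, measurable]
    have "emeasure P {\<omega> \<in> space P. root B \<omega> (y, n) (x, 0) \<and> Q (y, n) \<omega>} =
        emeasure P {\<omega> \<in> space P. root B (shift ?g \<omega>) (y, n) (x, 0) \<and> Q (y, n) (shift ?g \<omega>)}"
      by (rule emeasure_shift[OF g, symmetric]) measurable
    also have "{\<omega> \<in> space P. root B (shift ?g \<omega>) (y, n) (x, 0) \<and> Q (y, n) (shift ?g \<omega>)} =
        {\<omega> \<in> space P. root B \<omega> (x, n) (x \<otimes> inv y \<otimes> x, 0) \<and> Q (x, n) \<omega>}"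
    proof (intro Collect_cong conj_cong refl)
      fix \<omega> assume \<omega>: "\<omega> \<in> space P"
      show "root B (shift ?g \<omega>) (y, n) (x, 0) = root B \<omega> (x, n) (x \<otimes> inv y \<otimes> x, 0)"
        using root_shift[OF g \<omega>, of "(y, n)" "(x, 0)"] x y t by simp
      have "(y, n) \<in> V" using y by simp
      then have "Q (y, n) (shift ?g \<omega>) = Q (tr ?g (y, n)) \<omega>"
        using Q g \<omega> unfolding equivariant_def by blast
      then show "Q (y, n) (shift ?g \<omega>) = Q (x, n) \<omega>" using t by simp
    qed
    finally show ?thesis .
  qed
  \<comment> \<open>This map is its own inverse; it reindexes the sum over the starting points as a
    sum over the possible roots of \<open>(x, n)\<close>.\<close>
  have bij: "bij_betw (\<lambda>y. x \<otimes> inv y \<otimes> x) (carrier G) (carrier G)"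
  proof (rule bij_betw_byWitness[where f' = "\<lambda>z. x \<otimes> inv z \<otimes> x"])
    show "\<forall>a\<in>carrier G. x \<otimes> inv (x \<otimes> inv a \<otimes> x) \<otimes> x = a"
      using x by (auto simp: inv_mult_group m_assoc) (simp add: m_assoc[symmetric])
    then show "\<forall>a\<in>carrier G. x \<otimes> inv (x \<otimes> inv a \<otimes> x) \<otimes> x = a" .
  qed (use x in auto)
  \<comment> \<open>Roots are unique only for good configurations, so a null set is removed to make
    the events disjoint everywhere.\<close>
  obtain N where N: "{\<omega> \<in> space P. \<not> good \<omega>} \<subseteq> N" "N \<in> null_sets P"
    using AE_good by (auto simp: eventually_ae_filter)
  let ?X = "\<lambda>z. {\<omega> \<in> space P. root B \<omega> (x, n) (z, 0) \<and> Q (x, n) \<omega>} - N"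
  have X: "?X z \<in> sets P" for z
    using N(2) Qm[OF x] by (intro sets.Diff) (auto simp: pred_def[symmetric])
  have "disjoint_family_on ?X (carrier G)"
    unfolding disjoint_family_on_def using root_unique N(1) by fastforce
  then have UN: "emeasure P (\<Union>z\<in>carrier G. ?X z) = (\<integral>\<^sup>+z. emeasure P (?X z) \<partial>count_space (carrier G))"
    using X countable_carrier by (intro emeasure_UN_countable) auto
  have "(\<integral>\<^sup>+y. emeasure P {\<omega> \<in> space P. root B \<omega> (y, n) (x, 0) \<and> Q (y, n) \<omega>} \<partial>count_space (carrier G)) =
      (\<integral>\<^sup>+y. ?e (x \<otimes> inv y \<otimes> x) \<partial>count_space (carrier G))"
    by (intro nn_integral_cong) (simp add: eq)
  also have "\<dots> = (\<integral>\<^sup>+z. ?e z \<partial>count_space (carrier G))"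
    by (rule nn_integral_bij_count_space[OF bij])
  also have "\<dots> = (\<integral>\<^sup>+z. emeasure P (?X z) \<partial>count_space (carrier G))"
    using Qm[OF x] by (intro nn_integral_cong emeasure_Diff_null_set[symmetric] N(2)) (auto simp: pred_def[symmetric])
  also have "\<dots> = emeasure P (\<Union>z\<in>carrier G. ?X z)" using UN by simp
  also have "\<dots> \<le> emeasure P {\<omega> \<in> space P. Q (x, n) \<omega>}"
    using Qm[OF x] by (intro emeasure_mono) (auto simp: pred_def)
  finally show ?thesis .
qed

text \<open>The indicator of the event is at most the number of bad vertices of the tree on level
  \<open>n\<close>, whose mean is controlled by \<open>mass_transport\<close>. An estimate at one
  fixed vertex thus covers all tree vertices of a level at once, however many there are.\<close>

lemma prob_tree_meets_bad:
  assumes Q: "equivariant Q" and x: "x \<in> carrier G"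
  shows "\<P>(\<omega> in P. \<exists>y\<in>carrier G. root B \<omega> (y, n) (x, 0) \<and> Q (y, n) \<omega>) \<le>
    \<P>(\<omega> in P. Q (x, n) \<omega>)"
proof -
  have Qm [measurable]: "Measurable.pred P (Q (y, n))" if "y \<in> carrier G" for y
    using Q that by (auto simp: equivariant_def)
  let ?X = "\<lambda>y. {\<omega> \<in> space P. root B \<omega> (y, n) (x, 0) \<and> Q (y, n) \<omega>}"
  have X: "?X y \<in> sets P" if "y \<in> carrier G" for y
    using Qm[OF that] by (auto simp: pred_def[symmetric])
  have eq: "{\<omega> \<in> space P. \<exists>y\<in>carrier G. root B \<omega> (y, n) (x, 0) \<and> Q (y, n) \<omega>} = (\<Union>y\<in>carrier G. ?X y)" by auto
  have UX: "(\<Union>y\<in>carrier G. ?X y) \<in> sets P" using X countable_carrier by (intro sets.countable_UN'') auto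
  have "emeasure P (\<Union>y\<in>carrier G. ?X y) = (\<integral>\<^sup>+\<omega>. indicator (\<Union>y\<in>carrier G. ?X y) \<omega> \<partial>P)"
    using UX by simp
  also have "\<dots> \<le> (\<integral>\<^sup>+\<omega>. (\<integral>\<^sup>+y. indicator (?X y) \<omega> \<partial>count_space (carrier G)) \<partial>P)"
  proof (rule nn_integral_mono)
    fix \<omega>
    show "indicator (\<Union>y\<in>carrier G. ?X y) \<omega> \<le> (\<integral>\<^sup>+y. indicator (?X y) \<omega> \<partial>count_space (carrier G))"
    proof (cases "\<omega> \<in> (\<Union>y\<in>carrier G. ?X y)")
      case True
      then obtain y where "y \<in> carrier G" "\<omega> \<in> ?X y" by blast
      then show ?thesis using nn_integral_ge_point[of y "carrier G" "\<lambda>y. indicator (?X y) \<omega>"] by (simp add: indicator_def)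
    qed simp
  qed
  also have "\<dots> = (\<integral>\<^sup>+y. (\<integral>\<^sup>+\<omega>. indicator (?X y) \<omega> \<partial>P) \<partial>count_space (carrier G))"
    using X by (intro nn_integral_count_space_nn_integral countable_carrier) auto
  also have "\<dots> = (\<integral>\<^sup>+y. emeasure P (?X y) \<partial>count_space (carrier G))"
    using X by (intro nn_integral_cong) simp
  also have "\<dots> \<le> emeasure P {\<omega> \<in> space P. Q (x, n) \<omega>}" by (rule mass_transport[OF Q x])
  finally show ?thesis unfolding eq by (simp add: P.emeasure_eq_measure)
qed

lemma borel_measurable_nn_integral_countable:
  fixes f :: "'i \<Rightarrow> 'a \<Rightarrow> ennreal"
  assumes "countable I" and f: "\<And>i. i \<in> I \<Longrightarrow> f i \<in> borel_measurable M"
  shows "(\<lambda>x. \<integral>\<^sup>+i. f i x \<partial>count_space I) \<in> borel_measurable M"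
proof (cases "finite I")
  case True
  then show ?thesis using f by (simp add: nn_integral_count_space_finite)
next
  case False
  note bij = bij_betw_from_nat_into[OF \<open>countable I\<close> False]
  have "(\<lambda>x. \<integral>\<^sup>+i. f i x \<partial>count_space I) = (\<lambda>x. \<Sum>n. f (from_nat_into I n) x)"
    by (simp add: nn_integral_bij_count_space[symmetric, OF bij] nn_integral_count_space_nat)
  moreover have "from_nat_into I n \<in> I" for n using False by (intro from_nat_into) auto
  ultimately show ?thesis using f by simp
qed

lemma prob_Markov:
  assumes f: "f \<in> borel_measurable P" "(\<integral>\<^sup>+\<omega>. f \<omega> \<partial>P) \<le> ennreal m" and c: "0 < c" "0 \<le> m"
  shows "\<P>(\<omega> in P. ennreal c \<le> f \<omega>) \<le> m / c"
proof -
  have "{\<omega> \<in> space P. ennreal c \<le> f \<omega>} \<subseteq> {\<omega> \<in> space P. 1 \<le> ennreal (1 / c) * f \<omega>}"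
  proof clarify
    fix \<omega> assume "ennreal c \<le> f \<omega>"
    then have "ennreal (1 / c) * ennreal c \<le> ennreal (1 / c) * f \<omega>" by (rule mult_left_mono) simp
    moreover have "ennreal (1 / c) * ennreal c = 1" using c by (subst ennreal_mult[symmetric]) auto
    ultimately show "1 \<le> ennreal (1 / c) * f \<omega>" by simp
  qed
  then have "emeasure P {\<omega> \<in> space P. ennreal c \<le> f \<omega>} \<le> emeasure P {\<omega> \<in> space P. 1 \<le> ennreal (1 / c) * f \<omega>}"
    using f(1) by (intro emeasure_mono) measurable
  also have "\<dots> \<le> ennreal (1 / c) * (\<integral>\<^sup>+\<omega>. f \<omega> * indicator (space P) \<omega> \<partial>P)"
    using f(1) nn_integral_Markov_inequality[where u = f and A = "space P" and M = P and c = "ennreal (1 / c)"] by simp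
  also have "(\<integral>\<^sup>+\<omega>. f \<omega> * indicator (space P) \<omega> \<partial>P) = (\<integral>\<^sup>+\<omega>. f \<omega> \<partial>P)" by (intro nn_integral_cong) simp
  also have "ennreal (1 / c) * (\<integral>\<^sup>+\<omega>. f \<omega> \<partial>P) \<le> ennreal (1 / c) * ennreal m" using f(2) by (rule mult_left_mono) simp
  also have "\<dots> = ennreal (m / c)" using c by (subst ennreal_mult[symmetric]) auto
  finally show ?thesis using c by (simp add: P.emeasure_eq_measure)
qed

text \<open>Finiteness is required separately because \<open>card\<close> of an infinite set is
  0.\<close>

definition small_level :: "nat \<Rightarrow> nat set \<Rightarrow> nat \<Rightarrow> 'g vertex \<Rightarrow> ('e \<Rightarrow> real) \<Rightarrow> bool" where
  "small_level M B n v \<omega> \<longleftrightarrow> finite {y \<in> carrier G. root B \<omega> (y, n) v} \<and>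
     card {y \<in> carrier G. root B \<omega> (y, n) v} \<le> M"

text \<open>Mass transport with the always true property gives mean size at most 1 for a level of
  the tree; failure means size at least \<open>M + 1\<close>, and Markov's inequality
  applies.\<close>

lemma small_level:
  assumes x: "x \<in> carrier G"
  shows "Measurable.pred P (small_level M B n (x, 0))"
    and "\<P>(\<omega> in P. \<not> small_level M B n (x, 0) \<omega>) \<le> 1 / (real M + 1)"
proof -
  let ?X = "\<lambda>y. {\<omega> \<in> space P. root B \<omega> (y, n) (x, 0)}"
  have X: "?X y \<in> sets P" for y by measurable
  define f where "f \<omega> = (\<integral>\<^sup>+y. indicator (?X y) \<omega> \<partial>count_space (carrier G))" for \<omega>
  have f [measurable]: "f \<in> borel_measurable P"
    unfolding f_def using X by (intro borel_measurable_nn_integral_countable countable_carrier) auto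
  have f_eq: "f \<omega> = emeasure (count_space (carrier G)) {y \<in> carrier G. root B \<omega> (y, n) (x, 0)}"
    if "\<omega> \<in> space P" for \<omega>
  proof -
    have "f \<omega> = (\<integral>\<^sup>+y. indicator {y \<in> carrier G. root B \<omega> (y, n) (x, 0)} y \<partial>count_space (carrier G))"
      unfolding f_def using that by (intro nn_integral_cong) (auto simp: indicator_def)
    then show ?thesis by (simp add: nn_integral_indicator)
  qed
  have iff: "small_level M B n (x, 0) \<omega> \<longleftrightarrow> f \<omega> \<le> of_nat M" if "\<omega> \<in> space P" for \<omega>
    unfolding f_eq[OF that] small_level_def
    by (cases "finite {y \<in> carrier G. root B \<omega> (y, n) (x, 0)}")
      (auto simp: emeasure_count_space_finite emeasure_count_space_infinite top_unique ennreal_of_nat_eq_real_of_nat)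
  then show "Measurable.pred P (small_level M B n (x, 0))"
    by (subst measurable_cong[where g = "\<lambda>\<omega>. f \<omega> \<le> of_nat M"]) auto
  have "(\<integral>\<^sup>+\<omega>. f \<omega> \<partial>P) = (\<integral>\<^sup>+y. (\<integral>\<^sup>+\<omega>. indicator (?X y) \<omega> \<partial>P) \<partial>count_space (carrier G))"
    unfolding f_def using X by (intro nn_integral_count_space_nn_integral countable_carrier) auto
  also have "\<dots> = (\<integral>\<^sup>+y. emeasure P {\<omega> \<in> space P. root B \<omega> (y, n) (x, 0) \<and> True} \<partial>count_space (carrier G))"
    using X by (intro nn_integral_cong) simp
  also have "\<dots> \<le> emeasure P {\<omega> \<in> space P. True}"
    using mass_transport[of "\<lambda>_ _. True"] x by (auto simp: equivariant_def)
  also have "\<dots> = 1" by (simp add: P.emeasure_space_1)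
  finally have int: "(\<integral>\<^sup>+\<omega>. f \<omega> \<partial>P) \<le> 1" .
  have "{\<omega> \<in> space P. \<not> small_level M B n (x, 0) \<omega>} \<subseteq> {\<omega> \<in> space P. ennreal (real M + 1) \<le> f \<omega>}"
  proof clarify
    fix \<omega> assume \<omega>: "\<omega> \<in> space P" "\<not> small_level M B n (x, 0) \<omega>"
    let ?Y = "{y \<in> carrier G. root B \<omega> (y, n) (x, 0)}"
    show "ennreal (real M + 1) \<le> f \<omega>"
    proof (cases "finite ?Y")
      case True
      then have "M + 1 \<le> card ?Y" using \<omega>(2) by (simp add: small_level_def)
      then have "real M + 1 \<le> real (card ?Y)" by linarith
      then show ?thesis unfolding f_eq[OF \<omega>(1)] using True
        by (simp add: emeasure_count_space_finite ennreal_of_nat_eq_real_of_nat ennreal_leI del: ennreal_plus)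
    next
      case False
      then show ?thesis unfolding f_eq[OF \<omega>(1)] by (simp add: emeasure_count_space_infinite)
    qed
  qed
  then have "\<P>(\<omega> in P. \<not> small_level M B n (x, 0) \<omega>) \<le> \<P>(\<omega> in P. ennreal (real M + 1) \<le> f \<omega>)"
    by (intro P.finite_measure_mono) measurable
  also have "\<dots> \<le> 1 / (real M + 1)" using int by (intro prob_Markov f) auto
  finally show "\<P>(\<omega> in P. \<not> small_level M B n (x, 0) \<omega>) \<le> 1 / (real M + 1)" .
qed

lemma AE_finite_level:
  assumes x: "x \<in> carrier G"
  shows "AE \<omega> in P. finite {y \<in> carrier G. root B \<omega> (y, n) (x, 0)}"
proof (rule AE_I)
  note small_level(1)[OF x, measurable]
  let ?A = "{\<omega> \<in> space P. \<forall>M. \<not> small_level M B n (x, 0) \<omega>}"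
  show "?A \<in> sets P" by measurable
  have "measure P ?A \<le> 1 / (real M + 1)" for M
    by (rule order_trans[OF P.finite_measure_mono small_level(2)[OF x, of M B n]]) auto
  moreover have "(\<lambda>M. 1 / (real M + 1)) \<longlonglongrightarrow> 0"
    using LIMSEQ_inverse_real_of_nat by (simp add: inverse_eq_divide add.commute)
  ultimately have "measure P ?A \<le> 0" by (intro LIMSEQ_le_const) auto
  then show "emeasure P ?A = 0" by (simp add: P.emeasure_eq_measure measure_le_0_iff)
  show "{\<omega> \<in> space P. \<not> finite {y \<in> carrier G. root B \<omega> (y, n) (x, 0)}} \<subseteq> ?A"
    by (auto simp: small_level_def)
qed

section \<open>Choice of the level\<close>

definition mean :: real where
  "mean = (\<integral>t. t \<partial>\<mu>)"

lemma mean_nonneg: "0 \<le> mean"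
  unfolding mean_def using \<mu>_pos by (intro integral_nonneg_AE) auto

lemma integral_label:
  assumes "e \<in> E"
  shows "integrable P (\<lambda>\<omega>. \<omega> (\<kappa> e))" "(\<integral>\<omega>. \<omega> (\<kappa> e) \<partial>P) = mean"
proof -
  have d: "distr P \<mu> (\<lambda>\<omega>. \<omega> (\<kappa> e)) = \<mu>" using assms by (intro P.PiM_component) auto
  have m: "(\<lambda>\<omega>. \<omega> (\<kappa> e)) \<in> measurable P \<mu>" using assms by (intro measurable_component_singleton) auto
  have f: "(\<lambda>t. t) \<in> borel_measurable \<mu>" using \<mu>_mean by (rule borel_measurable_integrable)
  show "integrable P (\<lambda>\<omega>. \<omega> (\<kappa> e))" using integrable_distr_eq[OF m f] d \<mu>_mean by simp
  show "(\<integral>\<omega>. \<omega> (\<kappa> e) \<partial>P) = mean" using integral_distr[OF m f] d by (simp add: mean_def)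
qed

lemma integral_weight:
  assumes "set p \<subseteq> E"
  shows "integrable P (\<lambda>\<omega>. weight \<omega> p) \<and> (\<integral>\<omega>. weight \<omega> p \<partial>P) = length p * mean"
  using assms by (induction p) (auto simp: integral_label algebra_simps)

lemma nn_integral_weight:
  assumes "set p \<subseteq> E"
  shows "(\<integral>\<^sup>+\<omega>. ennreal (weight \<omega> p) \<partial>P) = ennreal (length p * mean)"
proof -
  have "AE \<omega> in P. 0 \<le> weight \<omega> p"
    using AE_pos by eventually_elim (rule weight_nonneg[OF _ assms])
  then show ?thesis using integral_weight[OF assms] by (simp add: nn_integral_eq_integral)
qed

definition mtime :: "nat set \<Rightarrow> 'g vertex \<Rightarrow> ennreal" where
  "mtime B u = (\<integral>\<^sup>+\<omega>. ptime B u \<omega> \<partial>P)"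

lemma mtime_translate:
  assumes "g \<in> carrier G" "u \<in> V"
  shows "mtime B (tr g u) = mtime B u"
proof -
  have "mtime B u = (\<integral>\<^sup>+\<omega>. ptime B u \<omega> \<partial>distr P P (shift g))"
    using distr_shift[OF assms(1)] by (simp add: mtime_def)
  also have "\<dots> = (\<integral>\<^sup>+\<omega>. ptime B u (shift g \<omega>) \<partial>P)"
    using measurable_shift[OF assms(1)] by (intro nn_integral_distr) auto
  also have "\<dots> = mtime B (tr g u)" unfolding mtime_def
    by (intro nn_integral_cong ptime_shift assms)
  finally show ?thesis by simp
qed

lemma mtime_level:
  assumes "x \<in> carrier G" "y \<in> carrier G"
  shows "mtime B (y, n) = mtime B (x, n)"
  using mtime_translate[of "y \<otimes> inv x" "(x, n)" B] assms by (simp add: translate_def m_assoc)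

lemma mtime_le:
  assumes "y \<in> carrier G" "n \<le> N"
  shows "mtime {..N} (y, n) \<le> ennreal (n * mean)"
proof -
  obtain p z where p: "walk {..n} (y, n) p (z, 0)" "length p = n" using walk_descend[OF assms(1)] by blast
  then have w: "walk {..N} (y, n) p (z, 0)" using assms(2) by (auto elim: walk_mono)
  have "mtime {..N} (y, n) \<le> (\<integral>\<^sup>+\<omega>. ennreal (weight \<omega> p) \<partial>P)"
    unfolding mtime_def using ptime_le[OF w] by (intro nn_integral_mono) simp
  also have "\<dots> = ennreal (n * mean)" using nn_integral_weight[OF walk_subset[OF w]] p(2) by simp
  finally show ?thesis .
qed

lemma geod_exists':
  assumes "good \<omega>" "u \<in> carrier G \<times> {..N}"
  obtains p v where "geod {..N} \<omega> u p v"
proof -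
  have "\<forall>i\<in>{..N}. {..i} \<subseteq> {..N}" by auto
  from geod_exists[OF out_degree(1) assms(1) this assms(2)] show ?thesis using that by (elim exE)
qed

lemma ptime_triangle:
  assumes "good \<omega>" "walk {..N} u \<sigma> v"
  shows "ptime {..N} u \<omega> \<le> ptime {..N} v \<omega> + ennreal (weight \<omega> \<sigma>)"
proof -
  obtain p w where p: "geod {..N} \<omega> v p w" using geod_exists'[OF assms(1) walk_end[OF assms(2)]] .
  then have w: "walk {..N} v p w" "snd w = 0" by (auto simp: geod_def)
  have "ptime {..N} u \<omega> \<le> ennreal (weight \<omega> (\<sigma> @ p))"
    using walk_appendI[OF assms(2) w(1)] w(2) by (rule ptime_le)
  also have "\<dots> = ennreal (weight \<omega> p) + ennreal (weight \<omega> \<sigma>)"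
    using weight_nonneg[OF goodD(1)[OF assms(1)]] walk_subset[OF w(1)] walk_subset[OF assms(2)]
    by (simp add: ennreal_plus add.commute)
  finally show ?thesis using ptime_geod[OF p] by simp
qed

text \<open>The excess is what is lost by going from \<open>u\<close> along \<open>\<sigma>\<close>
  and on from \<open>v\<close> instead of taking a geodesic from \<open>u\<close>. It is compared
  with \<open>Z\<close> additively, which avoids truncated subtraction in
  \<open>ennreal\<close>.\<close>

definition bad_excess :: "nat \<Rightarrow> real \<Rightarrow> nat \<Rightarrow> 'g vertex \<Rightarrow> ('e \<Rightarrow> real) \<Rightarrow> bool" where
  "bad_excess J Z N u \<omega> \<longleftrightarrow> (\<exists>\<sigma>\<in>lists E. \<exists>v\<in>V. (walk {..snd u} u \<sigma> v \<and> length \<sigma> = J \<and>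
     snd v = snd u - \<delta> * J) \<and> ptime {..N} u \<omega> + ennreal Z \<le> ptime {..N} v \<omega> + ennreal (weight \<omega> \<sigma>))"

lemma equivariant_bad_excess: "equivariant (bad_excess J Z N)"
proof (rule equivariantI)
  fix u assume "u \<in> V"
  show "Measurable.pred P (bad_excess J Z N u)"
    unfolding bad_excess_def[abs_def]
  proof (intro pred_countable_Bex countable_lists_E countable_V pred_intros_logic)
    fix \<sigma> v assume "\<sigma> \<in> lists E"
    then have \<sigma>: "set \<sigma> \<subseteq> E" by auto
    show "Measurable.pred P (\<lambda>\<omega>. ptime {..N} u \<omega> + ennreal Z \<le> ptime {..N} v \<omega> + ennreal (weight \<omega> \<sigma>))"
      unfolding pred_def
      by (intro borel_measurable_le borel_measurable_add measurable_ptime borel_measurable_const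
          measurable_compose[OF measurable_weight[OF \<sigma>] measurable_ennreal])
  qed auto
next
  fix u g \<omega> assume u: "u \<in> V" and g: "g \<in> carrier G" and \<omega>: "\<omega> \<in> space P"
  assume "bad_excess J Z N u (shift g \<omega>)"
  then obtain \<sigma> v where *: "\<sigma> \<in> lists E" "v \<in> V" "walk {..snd u} u \<sigma> v" "length \<sigma> = J"
    "snd v = snd u - \<delta> * J"
    "ptime {..N} u (shift g \<omega>) + ennreal Z \<le> ptime {..N} v (shift g \<omega>) + ennreal (weight (shift g \<omega>) \<sigma>)"
    unfolding bad_excess_def by blast
  have E: "set \<sigma> \<subseteq> E" using *(1) by auto
  have "ptime {..N} (tr g u) \<omega> + ennreal Z \<le> ptime {..N} (tr g v) \<omega> + ennreal (weight \<omega> (map (tra g) \<sigma>))"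
    using *(6) ptime_shift[OF g \<omega>] u *(2) weight_shift[OF g E] by simp
  moreover have w: "walk {..snd (tr g u)} (tr g u) (map (tra g) \<sigma>) (tr g v)"
    using walk_translate[OF g *(3)] by simp
  moreover have "map (tra g) \<sigma> \<in> lists E" using walk_subset[OF w] unfolding in_lists_conv_set by blast
  moreover have "tr g v \<in> V" using tr_V[OF g *(2)] .
  ultimately show "bad_excess J Z N (tr g u) \<omega>" unfolding bad_excess_def
    using *(4,5) by (intro bexI[of _ "map (tra g) \<sigma>"] bexI[of _ "tr g v"]) auto
qed

definition rtime :: "'g \<Rightarrow> nat \<Rightarrow> nat \<Rightarrow> real" where
  "rtime x N n = enn2real (mtime {..N} (x, n))"

lemma rtime:
  assumes "x \<in> carrier G" "n \<le> N"
  shows "mtime {..N} (x, n) = ennreal (rtime x N n)" "0 \<le> rtime x N n" "rtime x N n \<le> n * mean"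
proof -
  have "mtime {..N} (x, n) \<le> ennreal (n * mean)" using assms by (rule mtime_le)
  moreover from this have "mtime {..N} (x, n) < \<infinity>" using ennreal_less_top le_less_trans infinity_ennreal_def by metis
  ultimately show "mtime {..N} (x, n) = ennreal (rtime x N n)" "rtime x N n \<le> n * mean"
    unfolding rtime_def using mean_nonneg by (auto simp: enn2real_leI)
qed (simp add: rtime_def)

text \<open>The excess of one detour is nonnegative by the triangle inequality, and by translation
  invariance its mean is a difference of mean passage times plus the mean weight of
  \<open>\<sigma>\<close>; Markov's inequality gives the bound.\<close>

lemma prob_excess_single:
  assumes x: "x \<in> carrier G" and n: "n \<le> N" and Z: "0 < Z"
    and \<sigma>: "walk {..n} (x, n) \<sigma> v" "snd v = n'" "n' \<le> N"
  shows "0 \<le> rtime x N n' + length \<sigma> * mean - rtime x N n"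
    and "\<P>(\<omega> in P. ptime {..N} (x, n) \<omega> + ennreal Z \<le> ptime {..N} v \<omega> + ennreal (weight \<omega> \<sigma>)) \<le>
      (rtime x N n' + length \<sigma> * mean - rtime x N n) / Z"
proof -
  let ?X = "\<lambda>\<omega>. ptime {..N} v \<omega> + ennreal (weight \<omega> \<sigma>) - ptime {..N} (x, n) \<omega>"
  let ?r = "rtime x N n' + length \<sigma> * mean - rtime x N n"
  have w: "walk {..N} (x, n) \<sigma> v" using \<sigma>(1) n by (auto elim: walk_mono)
  have v: "fst v \<in> carrier G" "v = (fst v, n')" using walk_end[OF w] \<sigma>(2) by (auto simp: mem_Times_iff)
  have [measurable]: "(\<lambda>\<omega>. weight \<omega> \<sigma>) \<in> borel_measurable P" using walk_subset[OF w] by (rule measurable_weight)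
  have le: "AE \<omega> in P. ptime {..N} (x, n) \<omega> \<le> ptime {..N} v \<omega> + ennreal (weight \<omega> \<sigma>)"
    using AE_good by eventually_elim (rule ptime_triangle[OF _ w])
  have "mtime {..N} v = ennreal (rtime x N n')"
    using mtime_level[OF x v(1), of "{..N}" n'] v(2) rtime(1)[OF x \<sigma>(3)] by simp
  then have sum: "(\<integral>\<^sup>+\<omega>. ptime {..N} v \<omega> + ennreal (weight \<omega> \<sigma>) \<partial>P) = ennreal (rtime x N n' + length \<sigma> * mean)"
    using nn_integral_weight[OF walk_subset[OF w]] rtime(2)[OF x \<sigma>(3)] mean_nonneg
    by (subst nn_integral_add) (auto simp: mtime_def ennreal_plus)
  have fin: "(\<integral>\<^sup>+\<omega>. ptime {..N} (x, n) \<omega> \<partial>P) = ennreal (rtime x N n)"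
    using rtime(1)[OF x n] by (simp add: mtime_def)
  have "ennreal (rtime x N n) \<le> ennreal (rtime x N n' + length \<sigma> * mean)"
    unfolding sum[symmetric] fin[symmetric] by (rule nn_integral_mono_AE[OF le])
  then show r: "0 \<le> ?r"
    using rtime(2)[OF x \<sigma>(3)] rtime(2)[OF x n] mean_nonneg by (subst (asm) ennreal_le_iff) auto
  have int: "(\<integral>\<^sup>+\<omega>. ?X \<omega> \<partial>P) = ennreal ?r"
    using fin sum rtime(2)[OF x n] by (subst nn_integral_diff) (auto simp: le ennreal_minus)
  have fin_AE: "AE \<omega> in P. ptime {..N} (x, n) \<omega> \<noteq> \<infinity>"
    using fin by (intro nn_integral_noteq_infinite) auto
  have "\<P>(\<omega> in P. ptime {..N} (x, n) \<omega> + ennreal Z \<le> ptime {..N} v \<omega> + ennreal (weight \<omega> \<sigma>)) \<le>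
      \<P>(\<omega> in P. ennreal Z \<le> ?X \<omega>)"
  proof (rule P.finite_measure_mono_AE)
    show "AE \<omega> in P. \<omega> \<in> {\<omega> \<in> space P. ptime {..N} (x, n) \<omega> + ennreal Z \<le> ptime {..N} v \<omega> + ennreal (weight \<omega> \<sigma>)}
      \<longrightarrow> \<omega> \<in> {\<omega> \<in> space P. ennreal Z \<le> ?X \<omega>}"
      using fin_AE by eventually_elim (simp add: ennreal_le_minus_iff add.commute)
  qed measurable
  also have "\<dots> \<le> ?r / Z" using int r Z by (intro prob_Markov) auto
  finally show "\<P>(\<omega> in P. ptime {..N} (x, n) \<omega> + ennreal Z \<le> ptime {..N} v \<omega> + ennreal (weight \<omega> \<sigma>)) \<le> ?r / Z" .
qed

lemma prob_bad_excess:
  assumes x: "x \<in> carrier G" and n: "n \<le> N" and Z: "0 < Z" and J: "0 \<le> rtime x N (n - \<delta> * J) + J * mean - rtime x N n"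
  shows "\<P>(\<omega> in P. bad_excess J Z N (x, n) \<omega>) \<le>
    real \<Delta> ^ J * ((rtime x N (n - \<delta> * J) + J * mean - rtime x N n) / Z)"
proof -
  let ?r = "rtime x N (n - \<delta> * J) + J * mean - rtime x N n"
  define last_vertex where "last_vertex \<sigma> = last ((x, n) # map snd \<sigma>)" for \<sigma> :: "'g arc list"
  let ?W = "{\<sigma>. length \<sigma> = J \<and> walk {..n} (x, n) \<sigma> (last_vertex \<sigma>) \<and> snd (last_vertex \<sigma>) = n - \<delta> * J}"
  let ?A = "\<lambda>\<sigma>. {\<omega> \<in> space P. ptime {..N} (x, n) \<omega> + ennreal Z \<le> ptime {..N} (last_vertex \<sigma>) \<omega> + ennreal (weight \<omega> \<sigma>)}"
  show ?thesis
  proof (rule prob_Union_walks[of ?W])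
    show "{\<omega> \<in> space P. bad_excess J Z N (x, n) \<omega>} \<subseteq> (\<Union>\<sigma>\<in>?W. ?A \<sigma>)"
    proof clarify
      fix \<omega> assume \<omega>: "\<omega> \<in> space P" "bad_excess J Z N (x, n) \<omega>"
      then obtain \<sigma> v where *: "walk {..n} (x, n) \<sigma> v" "length \<sigma> = J" "snd v = n - \<delta> * J"
        "ptime {..N} (x, n) \<omega> + ennreal Z \<le> ptime {..N} v \<omega> + ennreal (weight \<omega> \<sigma>)"
        unfolding bad_excess_def snd_conv by blast
      have v: "v = last_vertex \<sigma>" using walk_last[OF *(1)] unfolding last_vertex_def .
      have "\<sigma> \<in> ?W" using *(1-3) v by simp
      moreover have "\<omega> \<in> ?A \<sigma>" using \<omega>(1) *(4) v by simp
      ultimately show "\<omega> \<in> (\<Union>\<sigma>\<in>?W. ?A \<sigma>)" by (rule UN_I)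
    qed
    fix \<sigma> assume \<sigma>: "\<sigma> \<in> ?W"
    then have [measurable]: "(\<lambda>\<omega>. weight \<omega> \<sigma>) \<in> borel_measurable P"
      using walk_subset by (intro measurable_weight) blast
    have "?A \<sigma> \<in> sets P" by measurable
    with prob_excess_single(2)[OF x n Z, of \<sigma> "last_vertex \<sigma>" "n - \<delta> * J"] \<sigma> n
    show "?A \<sigma> \<in> sets P \<and> measure P (?A \<sigma>) \<le> (rtime x N (n - \<delta> * J) + J * mean - rtime x N n) / Z" by simp
  qed (use J Z in auto)
qed

lemma exists_connector:
  assumes "\<forall>y\<in>carrier G. \<forall>n>J. M < card {v. \<exists>\<sigma>. walk {..n} (y, n) \<sigma> v \<and> length \<sigma> = J \<and> snd v = n - \<delta> * J}"
    and "x \<in> carrier G" "J < n"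
  obtains \<sigma> v where "walk {..n} (x, n) \<sigma> v" "length \<sigma> = J" "snd v = n - \<delta> * J"
proof -
  have "M < card {v. \<exists>\<sigma>. walk {..n} (x, n) \<sigma> v \<and> length \<sigma> = J \<and> snd v = n - \<delta> * J}"
    using bspec[OF assms(1,2)] assms(3) by simp
  then have "{v. \<exists>\<sigma>. walk {..n} (x, n) \<sigma> v \<and> length \<sigma> = J \<and> snd v = n - \<delta> * J} \<noteq> {}"
    by (rule contrapos_pn) (simp only: card.empty not_less_zero not_False_eq_True)
  then show ?thesis using that by blast
qed

text \<open>For \<open>\<delta> = 0\<close> the mean passage times cancel. For
  \<open>\<delta> = 1\<close> the shift by \<open>J\<close> leaves \<open>J\<close> boundary levels,
  each contributing at most \<open>a * mean\<close>. Either way the mean excess, averaged over the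
  \<open>a\<close> levels of the block, is at most \<open>2 * J * mean\<close>, which does not
  depend on \<open>a\<close>.\<close>

lemma sum_rtime:
  assumes x: "x \<in> carrier G" and a: "J \<le> a"
  shows "(\<Sum>n\<in>{a<..2 * a}. rtime x (2 * a) (n - \<delta> * J) + J * mean - rtime x (2 * a) n) \<le> 2 * real a * J * mean"
proof -
  let ?m = "rtime x (2 * a)"
  have split: "(\<Sum>n\<in>{a<..2 * a}. ?m (n - \<delta> * J) + J * mean - ?m n) =
      (\<Sum>n\<in>{a<..2 * a}. ?m (n - \<delta> * J)) - (\<Sum>n\<in>{a<..2 * a}. ?m n) + a * (J * mean)"
    by (simp add: sum.distrib sum_subtractf)
  have "(\<Sum>n\<in>{a<..2 * a}. ?m (n - \<delta> * J)) - (\<Sum>n\<in>{a<..2 * a}. ?m n) \<le> a * (J * mean)"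
  proof (cases "\<delta> = 0")
    case True
    then show ?thesis using mean_nonneg by simp
  next
    case False
    with drop_le have \<delta>: "\<delta> = 1" by simp
    have "(\<Sum>n\<in>{a<..2 * a}. ?m (n - \<delta> * J)) = (\<Sum>n\<in>{a - J<..2 * a - J}. ?m n)"
      by (rule sum.reindex_bij_witness[of _ "\<lambda>n. n + J" "\<lambda>n. n - J"]) (use a \<delta> in auto)
    also have "\<dots> \<le> (\<Sum>n\<in>{a - J<..a} \<union> {a<..2 * a}. ?m n)"
      using rtime(2)[OF x] by (intro sum_mono2) auto
    also have "\<dots> = (\<Sum>n\<in>{a - J<..a}. ?m n) + (\<Sum>n\<in>{a<..2 * a}. ?m n)"
      by (intro sum.union_disjoint) auto
    also have "(\<Sum>n\<in>{a - J<..a}. ?m n) \<le> (\<Sum>n\<in>{a - J<..a}. a * mean)"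
    proof (rule sum_mono)
      fix n assume n: "n \<in> {a - J<..a}"
      then have "?m n \<le> n * mean" using rtime(3)[OF x] by simp
      also have "\<dots> \<le> a * mean" using n mean_nonneg by (intro mult_right_mono) auto
      finally show "?m n \<le> a * mean" .
    qed
    also have "\<dots> = J * (a * mean)" using a by simp
    finally show ?thesis by (simp add: algebra_simps)
  qed
  with split show ?thesis by (simp add: algebra_simps)
qed

lemma sum_bad_excess:
  assumes x: "x \<in> carrier G" and J: "J \<le> a" and Z: "0 < Z"
    and con: "\<forall>y\<in>carrier G. \<forall>n>J. M < card {v. \<exists>\<sigma>. walk {..n} (y, n) \<sigma> v \<and> length \<sigma> = J \<and> snd v = n - \<delta> * J}"
  shows "(\<Sum>n\<in>{a<..2 * a}. \<P>(\<omega> in P. bad_excess J Z (2 * a) (x, n) \<omega>)) \<le>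
    real \<Delta> ^ J * (2 * real J * mean / Z) * a"
proof -
  let ?r = "\<lambda>n. rtime x (2 * a) (n - \<delta> * J) + J * mean - rtime x (2 * a) n"
  have "(\<Sum>n\<in>{a<..2 * a}. \<P>(\<omega> in P. bad_excess J Z (2 * a) (x, n) \<omega>)) \<le>
      (\<Sum>n\<in>{a<..2 * a}. real \<Delta> ^ J * (?r n / Z))"
  proof (rule sum_mono)
    fix n assume n: "n \<in> {a<..2 * a}"
    then have "J < n" using J by simp
    \<comment> \<open>One actual detour is needed to know that the mean excess is
      nonnegative.\<close>
    obtain \<sigma> v where \<sigma>: "walk {..n} (x, n) \<sigma> v" "length \<sigma> = J" "snd v = n - \<delta> * J"
      using exists_connector[OF con x \<open>J < n\<close>] .
    have "n - \<delta> * J \<le> 2 * a" using n by auto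
    then have "0 \<le> ?r n" using prob_excess_single(1)[OF x _ Z \<sigma>(1,3), of "2 * a"] \<sigma>(2) n by simp
    then show "\<P>(\<omega> in P. bad_excess J Z (2 * a) (x, n) \<omega>) \<le> real \<Delta> ^ J * (?r n / Z)"
      using n by (intro prob_bad_excess x Z) auto
  qed
  also have "\<dots> = real \<Delta> ^ J / Z * (\<Sum>n\<in>{a<..2 * a}. ?r n)"
    by (simp add: sum_distrib_left)
  also have "\<dots> \<le> real \<Delta> ^ J / Z * (2 * real a * J * mean)"
    using sum_rtime[OF x J] Z by (intro mult_left_mono) auto
  also have "\<dots> = real \<Delta> ^ J * (2 * real J * mean / Z) * a" by simp
  finally show ?thesis .
qed

section \<open>Levels at which geodesics descend quickly\<close>

lemma prob_ptime_large:
  fixes C :: real and N :: nat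
  assumes "x \<in> carrier G" "0 < C" "0 < N"
  shows "\<P>(\<omega> in P. ennreal (C * N) \<le> ptime {..N} (x, N) \<omega>) \<le> mean / C"
proof -
  have "\<P>(\<omega> in P. ennreal (C * N) \<le> ptime {..N} (x, N) \<omega>) \<le> N * mean / (C * N)"
    using mtime_le[OF assms(1), of N N] assms mean_nonneg by (intro prob_Markov) (auto simp: mtime_def)
  then show ?thesis using assms by simp
qed

text \<open>
  A geodesic from level \<open>N\<close> has at most \<open>C N\<close> arcs with high probability, hence only few levels
  \<open>n\<close> for which it wanders far between its last visits to the levels \<open>n\<close> and \<open>n - q\<close>.
\<close>
lemma near_average:
  fixes \<epsilon> :: real
  assumes x: "x \<in> carrier G" and \<epsilon>: "0 < \<epsilon>"
  shows "\<exists>\<rho>. \<forall>\<^sub>F a in sequentially. (\<Sum>n\<in>{a<..2 * a}.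
    \<P>(\<omega> in P. \<not> near {..2 * a} \<omega> \<rho> n (n - q) (x, 2 * a))) \<le> \<epsilon> * a"
proof -
  \<comment> \<open>The constants form a chain. With high probability the passage time from level
    \<open>N\<close> is below \<open>C1 * N\<close>; by the choice of \<open>R1\<close>, a path that
    light has at most \<open>R1 * N\<close> high weights; by the choice of \<open>C\<close>, paths
    of length \<open>C * N\<close> with so few high weights have probability at most
    \<open>(1 / 2) ^ N\<close>, so geodesics are shorter; finally \<open>\<rho>\<close> makes the
    count of \<open>near_count\<close> at most \<open>\<epsilon> / 2 * a\<close>.\<close>
  define C1 where "C1 = 4 * mean / \<epsilon> + 1"
  have C1: "0 < C1" "mean / C1 \<le> \<epsilon> / 4"
  proof -
    show C1: "0 < C1" using mean_nonneg \<epsilon> by (simp add: C1_def add_nonneg_pos)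
    have "mean = \<epsilon> / 4 * (C1 - 1)" using \<epsilon> by (simp add: C1_def)
    also have "\<dots> \<le> \<epsilon> / 4 * C1" using \<epsilon> by (intro mult_left_mono) auto
    finally show "mean / C1 \<le> \<epsilon> / 4" using C1 by (simp add: divide_le_eq)
  qed
  obtain R1 :: nat where R1: "C1 / hi < R1" using reals_Archimedean2 by blast
  obtain C :: nat where C: "2 * (4 * real \<Delta>) ^ R1 < 2 ^ C" using real_arch_pow[of 2] by auto
  obtain \<rho> :: nat where \<rho>: "4 * q * C / \<epsilon> < \<rho>" using reals_Archimedean2 by blast
  have \<rho>0: "0 < real \<rho>" using \<rho> \<epsilon> by (metis divide_nonneg_pos le_less_trans mult_nonneg_nonneg of_nat_0_le_iff zero_le_numeral)
  have few: "(4 * real \<Delta>) ^ (R1 * N) / 2 ^ (C * N) \<le> (1 / 2) ^ N" for N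
  proof -
    have "(4 * real \<Delta>) ^ (R1 * N) / 2 ^ (C * N) = ((4 * real \<Delta>) ^ R1 / 2 ^ C) ^ N"
      by (simp add: power_mult power_divide)
    also have "\<dots> \<le> (1 / 2) ^ N" using C by (intro power_mono) (auto simp: field_simps)
    finally show ?thesis .
  qed
  have "(\<lambda>N. (1 / 2 :: real) ^ N) \<longlonglongrightarrow> 0" by (rule LIMSEQ_realpow_zero) auto
  then have "\<forall>\<^sub>F N in sequentially. (1 / 2 :: real) ^ N < \<epsilon> / 4" using \<epsilon> by (intro order_tendstoD) auto
  then obtain N0 where N0: "\<And>N. N0 \<le> N \<Longrightarrow> (1 / 2 :: real) ^ N < \<epsilon> / 4" by (auto simp: eventually_sequentially)
  have "(\<Sum>n\<in>{a<..2 * a}. \<P>(\<omega> in P. \<not> near {..2 * a} \<omega> \<rho> n (n - q) (x, 2 * a))) \<le> \<epsilon> * a"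
    if a: "N0 + q + 1 \<le> a" for a
  proof -
    let ?N = "2 * a"
    let ?bad = "\<lambda>n \<omega>. \<not> near {..?N} \<omega> \<rho> n (n - q) (x, ?N)"
    let ?LB = "\<lambda>\<omega>. ennreal (C1 * ?N) \<le> ptime {..?N} (x, ?N) \<omega> \<or> few_high (C * ?N) (R1 * ?N) (x, ?N) \<omega>"
    have LBm: "Measurable.pred P ?LB" by measurable
    have "\<P>(\<omega> in P. ?LB \<omega>) \<le> \<P>(\<omega> in P. ennreal (C1 * ?N) \<le> ptime {..?N} (x, ?N) \<omega>) +
        \<P>(\<omega> in P. few_high (C * ?N) (R1 * ?N) (x, ?N) \<omega>)"
      by (rule order_trans[OF P.finite_measure_mono measure_Un_le]) auto
    also have "\<dots> \<le> mean / C1 + (4 * real \<Delta>) ^ (R1 * ?N) / 2 ^ (C * ?N)"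
      using a by (intro add_mono prob_ptime_large prob_few_high x C1(1)) auto
    also have "\<dots> \<le> \<epsilon> / 4 + \<epsilon> / 4"
      using a by (intro add_mono C1(2) order_trans[OF few less_imp_le[OF N0]]) simp
    finally have LB: "\<P>(\<omega> in P. ?LB \<omega>) \<le> \<epsilon> / 2" by simp
    \<comment> \<open>If the passage time is large or some long path has few high weights, the
      trivial bound \<open>a\<close> is used; otherwise the geodesic is short and
      \<open>near_count\<close> applies. Integrating this inequality gives the claim.\<close>
    have card: "real (card {n \<in> {a<..?N}. ?bad n \<omega>}) \<le> real a * indicator {\<omega> \<in> space P. ?LB \<omega>} \<omega> + \<epsilon> / 2 * real a"
      if \<omega>: "\<omega> \<in> space P" "good \<omega>" for \<omega>
    proof (cases "?LB \<omega>")
      case True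
      have "card {n \<in> {a<..?N}. ?bad n \<omega>} \<le> card {a<..?N}" by (intro card_mono) auto
      then have "real (card {n \<in> {a<..?N}. ?bad n \<omega>}) \<le> real a" by simp
      moreover have "0 \<le> \<epsilon> / 2 * a" using \<epsilon> by simp
      ultimately show ?thesis using True \<omega>(1) by simp
    next
      case False
      have "(x, ?N) \<in> carrier G \<times> {..?N}" using x by simp
      then obtain p v where p: "geod {..?N} \<omega> (x, ?N) p v" using geod_exists'[OF \<omega>(2)] by metis
      have path: "path (x, ?N) p v" using geod_distinct[OF goodD(1)[OF \<omega>(2)] p] .
      have "ennreal (weight \<omega> p) < ennreal (C1 * ?N)" using False ptime_geod[OF p] by (simp add: not_le)
      then have wt: "weight \<omega> p < C1 * ?N" using ennreal_less_iff ennreal_leI not_le by metis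
      have len: "length p \<le> C * ?N"
      proof (rule ccontr)
        assume "\<not> length p \<le> C * ?N"
        then have "hi * (real (R1 * ?N) + 1) \<le> weight \<omega> p"
          using not_few_highD[OF goodD(1)[OF \<omega>(2)] _ path, of "C * ?N" "R1 * ?N"] False
          by (simp add: add.commute)
        moreover have "C1 * ?N \<le> hi * (real (R1 * ?N) + 1)"
        proof -
          have "C1 \<le> hi * R1" using R1 lo_hi(2) by (simp add: divide_less_eq mult.commute less_imp_le)
          then have "C1 * ?N \<le> hi * R1 * ?N" by (intro mult_right_mono) auto
          then show ?thesis using lo_hi(2) by (simp add: algebra_simps)
        qed
        ultimately show False using wt by simp
      qed
      have "card {n \<in> {q..snd (x, ?N)}. ?bad n \<omega>} * \<rho> \<le> q * (C * ?N)"
        using near_count[OF p _ len, of q \<rho>] a by simp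
      moreover have "card {n \<in> {a<..?N}. ?bad n \<omega>} \<le> card {n \<in> {q..snd (x, ?N)}. ?bad n \<omega>}"
        using a by (intro card_mono) auto
      ultimately have "card {n \<in> {a<..?N}. ?bad n \<omega>} * \<rho> \<le> q * (C * ?N)"
        by (meson mult_le_mono1 order_trans)
      then have "real (card {n \<in> {a<..?N}. ?bad n \<omega>} * \<rho>) \<le> real (q * (C * ?N))"
        by (rule of_nat_mono)
      then have "real (card {n \<in> {a<..?N}. ?bad n \<omega>}) * \<rho> \<le> real (q * (C * ?N))"
        by (simp only: of_nat_mult)
      also have "\<dots> = (4 * q * C / \<epsilon>) * (\<epsilon> / 2 * a)" using \<epsilon> by simp
      also have "\<dots> \<le> \<rho> * (\<epsilon> / 2 * a)" using \<rho> \<epsilon> by (intro mult_right_mono) auto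
      finally have "real (card {n \<in> {a<..?N}. ?bad n \<omega>}) \<le> \<epsilon> / 2 * a"
        using \<rho>0 by (simp add: mult.commute)
      then show ?thesis by (simp add: indicator_def)
    qed
    have prob: "measure P (space P) = 1" using P.emeasure_space_1 by (simp add: measure_def)
    have badm: "{\<omega> \<in> space P. ?bad n \<omega>} \<in> sets P" for n by measurable
    have LBs: "{\<omega> \<in> space P. ?LB \<omega>} \<in> sets P" using LBm by (simp add: pred_def)
    have "(\<Sum>n\<in>{a<..?N}. \<P>(\<omega> in P. ?bad n \<omega>)) =
        (\<integral>\<omega>. (\<Sum>n\<in>{a<..?N}. indicator {\<omega> \<in> space P. ?bad n \<omega>} \<omega>) \<partial>P)"
      using badm by (subst Bochner_Integration.integral_sum) (auto simp: P.emeasure_eq_measure)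
    also have "\<dots> \<le> (\<integral>\<omega>. real a * indicator {\<omega> \<in> space P. ?LB \<omega>} \<omega> + \<epsilon> / 2 * a \<partial>P)"
    proof (rule integral_mono_AE)
      show "integrable P (\<lambda>\<omega>. \<Sum>n\<in>{a<..?N}. indicator {\<omega> \<in> space P. ?bad n \<omega>} \<omega> :: real)"
        using badm by (intro Bochner_Integration.integrable_sum integrable_real_indicator) (auto simp: P.emeasure_eq_measure)
      show "integrable P (\<lambda>\<omega>. real a * indicator {\<omega> \<in> space P. ?LB \<omega>} \<omega> + \<epsilon> / 2 * a)"
        using LBs by (intro Bochner_Integration.integrable_add integrable_mult_right integrable_real_indicator)
          (auto simp: P.emeasure_eq_measure)
      show "AE \<omega> in P. (\<Sum>n\<in>{a<..?N}. indicator {\<omega> \<in> space P. ?bad n \<omega>} \<omega>) \<le>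
          real a * indicator {\<omega> \<in> space P. ?LB \<omega>} \<omega> + \<epsilon> / 2 * real a"
        using AE_good AE_space
      proof eventually_elim
        case (elim \<omega>)
        have "(\<Sum>n\<in>{a<..?N}. indicator {\<omega> \<in> space P. ?bad n \<omega>} \<omega> :: real) =
            (\<Sum>n\<in>{a<..?N}. if ?bad n \<omega> then 1 else 0)"
          using elim by (intro sum.cong) (auto simp: indicator_def)
        also have "\<dots> = real (card {n \<in> {a<..?N}. ?bad n \<omega>})"
          by (simp add: sum.If_cases Int_def)
        finally show ?case using card elim by simp
      qed
    qed
    also have "\<dots> = real a * \<P>(\<omega> in P. ?LB \<omega>) + \<epsilon> / 2 * real a"
      using LBs by (subst Bochner_Integration.integral_add)
        (auto simp: P.emeasure_eq_measure prob intro!: integrable_mult_right integrable_real_indicator)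
    also have "\<dots> \<le> real a * (\<epsilon> / 2) + \<epsilon> / 2 * real a"
      by (intro add_right_mono mult_left_mono LB) simp
    also have "\<dots> = \<epsilon> * a" by simp
    finally show ?thesis .
  qed
  then show ?thesis by (intro exI[of _ \<rho>]) (auto simp: eventually_sequentially)
qed

text \<open>Each of the two probabilities sums to at most \<open>\<epsilon> / 2 * a\<close> over the
  \<open>a\<close> levels of the block, so at some level both are at most \<open>\<epsilon>\<close>.
  The order of the quantifiers matters: \<open>q\<close> will be chosen in terms of
  \<open>Z\<close>, and only then is \<open>\<rho>\<close> determined by \<open>q\<close>.\<close>

lemma level_choice:
  fixes \<epsilon> :: real
  assumes x: "x \<in> carrier G" and \<epsilon>: "0 < \<epsilon>"
    and con: "\<forall>y\<in>carrier G. \<forall>n>J. M < card {v. \<exists>\<sigma>. walk {..n} (y, n) \<sigma> v \<and> length \<sigma> = J \<and> snd v = n - \<delta> * J}"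
  shows "\<exists>Z>0. \<forall>q. \<exists>\<rho>. \<forall>\<^sub>F a in sequentially. \<exists>n\<in>{a<..2 * a}.
    \<P>(\<omega> in P. bad_excess J Z (2 * a) (x, n) \<omega>) \<le> \<epsilon> \<and>
    \<P>(\<omega> in P. \<not> near {..2 * a} \<omega> \<rho> n (n - q) (x, 2 * a)) \<le> \<epsilon>"
proof -
  \<comment> \<open>Chosen so that the bound of \<open>sum_bad_excess\<close> becomes at most
    \<open>\<epsilon> / 2 * a\<close>; the summand 1 keeps \<open>Z\<close> positive when the first
    term vanishes.\<close>
  define Z where "Z = real \<Delta> ^ J * (2 * real J * mean) * 2 / \<epsilon> + 1"
  have Z: "0 < Z" using \<epsilon> mean_nonneg by (simp add: Z_def add_nonneg_pos)
  have "real \<Delta> ^ J * (2 * real J * mean / Z) \<le> \<epsilon> / 2"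
  proof -
    have "real \<Delta> ^ J * (2 * real J * mean) = \<epsilon> / 2 * (Z - 1)" using \<epsilon> by (simp add: Z_def)
    also have "\<dots> \<le> \<epsilon> / 2 * Z" using \<epsilon> by (intro mult_left_mono) auto
    finally show ?thesis using Z by (simp add: divide_le_eq)
  qed
  then have exc: "(\<Sum>n\<in>{a<..2 * a}. \<P>(\<omega> in P. bad_excess J Z (2 * a) (x, n) \<omega>)) \<le> \<epsilon> / 2 * a"
    if "J \<le> a" for a
    using sum_bad_excess[OF x that Z con] by (meson mult_right_mono of_nat_0_le_iff order_trans)
  have "\<exists>\<rho>. \<forall>\<^sub>F a in sequentially. \<exists>n\<in>{a<..2 * a}.
    \<P>(\<omega> in P. bad_excess J Z (2 * a) (x, n) \<omega>) \<le> \<epsilon> \<and>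
    \<P>(\<omega> in P. \<not> near {..2 * a} \<omega> \<rho> n (n - q) (x, 2 * a)) \<le> \<epsilon>" for q
  proof -
    obtain \<rho> where \<rho>: "\<forall>\<^sub>F a in sequentially. (\<Sum>n\<in>{a<..2 * a}.
      \<P>(\<omega> in P. \<not> near {..2 * a} \<omega> \<rho> n (n - q) (x, 2 * a))) \<le> \<epsilon> / 2 * a"
      using near_average[OF x, of "\<epsilon> / 2" q] \<epsilon> by auto
    have "\<forall>\<^sub>F a in sequentially. \<exists>n\<in>{a<..2 * a}.
      \<P>(\<omega> in P. bad_excess J Z (2 * a) (x, n) \<omega>) \<le> \<epsilon> \<and>
      \<P>(\<omega> in P. \<not> near {..2 * a} \<omega> \<rho> n (n - q) (x, 2 * a)) \<le> \<epsilon>"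
      using \<rho> eventually_ge_at_top[of J] eventually_gt_at_top[of 0]
    proof eventually_elim
      case (elim a)
      let ?b = "\<lambda>n. \<P>(\<omega> in P. bad_excess J Z (2 * a) (x, n) \<omega>)"
      let ?c = "\<lambda>n. \<P>(\<omega> in P. \<not> near {..2 * a} \<omega> \<rho> n (n - q) (x, 2 * a))"
      have "\<exists>n\<in>{a<..2 * a}. ?b n + ?c n \<le> \<epsilon>"
      proof (rule ccontr)
        assume "\<not> (\<exists>n\<in>{a<..2 * a}. ?b n + ?c n \<le> \<epsilon>)"
        then have "\<epsilon> < ?b n + ?c n" if "n \<in> {a<..2 * a}" for n using that by (meson not_le)
        then have "(\<Sum>n\<in>{a<..2 * a}. \<epsilon>) < (\<Sum>n\<in>{a<..2 * a}. ?b n + ?c n)"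
          using elim(3) by (intro sum_strict_mono) auto
        then have "\<epsilon> * a < (\<Sum>n\<in>{a<..2 * a}. ?b n) + (\<Sum>n\<in>{a<..2 * a}. ?c n)"
          by (simp add: sum.distrib mult.commute)
        with exc[OF elim(2)] elim(1) show False by simp
      qed
      then obtain n where n: "n \<in> {a<..2 * a}" "?b n + ?c n \<le> \<epsilon>" by blast
      have "0 \<le> ?b n" "0 \<le> ?c n" by simp_all
      with n show ?case by (intro bexI[of _ n]) linarith+
    qed
    then show ?thesis by blast
  qed
  with Z show ?thesis by blast
qed

section \<open>Killing a tree by lowering weights next to it\<close>

text \<open>Arcs are followed in both directions: from level \<open>m\<close> a geodesic is traced
  backwards up to level \<open>n\<close>, and from there a detour is followed forwards.\<close>

definition nbrs :: "'g vertex set \<Rightarrow> 'g vertex set" where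
  "nbrs X = X \<union> (\<Union>u\<in>X. {v. (u, v) \<in> E} \<union> {v. (v, u) \<in> E})"

definition ball :: "nat \<Rightarrow> 'g vertex set \<Rightarrow> 'g vertex set" where
  "ball i = nbrs ^^ i"

lemma ball_simps [simp]: "ball 0 X = X" "ball (Suc i) X = nbrs (ball i X)"
  by (simp_all add: ball_def)

lemma finite_ball: "finite X \<Longrightarrow> finite (ball i X) \<and> card (ball i X) \<le> (1 + 2 * \<Delta>) ^ i * card X"
proof (induction i)
  case (Suc i)
  let ?Y = "ball i X"
  have fin: "finite ?Y" and card: "card ?Y \<le> (1 + 2 * \<Delta>) ^ i * card X" using Suc by auto
  let ?U = "\<Union>u\<in>?Y. {v. (u, v) \<in> E} \<union> {v. (v, u) \<in> E}"
  have "card ?U \<le> (\<Sum>u\<in>?Y. card ({v. (u, v) \<in> E} \<union> {v. (v, u) \<in> E}))"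
    using fin by (rule card_UN_le)
  also have "\<dots> \<le> (\<Sum>u\<in>?Y. 2 * \<Delta>)"
  proof (rule sum_mono)
    fix u
    have "card ({v. (u, v) \<in> E} \<union> {v. (v, u) \<in> E}) \<le> card {v. (u, v) \<in> E} + card {v. (v, u) \<in> E}"
      by (rule card_Un_le)
    also have "\<dots> \<le> 2 * \<Delta>" using out_degree(2)[of u] in_degree(2)[of u] by simp
    finally show "card ({v. (u, v) \<in> E} \<union> {v. (v, u) \<in> E}) \<le> 2 * \<Delta>" .
  qed
  finally have U: "card ?U \<le> 2 * \<Delta> * card ?Y" by (simp add: mult.commute)
  have "card (nbrs ?Y) \<le> card ?Y + card ?U" unfolding nbrs_def by (rule card_Un_le)
  also have "\<dots> \<le> (1 + 2 * \<Delta>) * card ?Y" using U by simp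
  also have "\<dots> \<le> (1 + 2 * \<Delta>) * ((1 + 2 * \<Delta>) ^ i * card X)" using card by (rule mult_le_mono2)
  finally have "card (nbrs ?Y) \<le> (1 + 2 * \<Delta>) ^ Suc i * card X" by (simp only: power_Suc mult.assoc)
  moreover have "finite (nbrs ?Y)" using fin out_degree(1) in_degree(1) by (auto simp: nbrs_def)
  ultimately show ?case by simp
qed simp

lemma ball_mono: "i \<le> j \<Longrightarrow> ball i X \<subseteq> ball j X"
  by (induction j rule: dec_induct) (auto simp: nbrs_def)

lemma ball_arc:
  assumes "(u, v) \<in> E"
  shows "u \<in> ball i X \<Longrightarrow> v \<in> ball (Suc i) X" "v \<in> ball i X \<Longrightarrow> u \<in> ball (Suc i) X"
  using assms by (auto simp: nbrs_def)

lemma ball_walk: "walk B u p v \<Longrightarrow> u \<in> ball i X \<Longrightarrow> v \<in> ball (i + length p) X"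
proof (induction p arbitrary: u i)
  case (Cons e p)
  then have "(u, snd e) \<in> E" by (metis prod.collapse walk.simps(2))
  then have "snd e \<in> ball (Suc i) X" using Cons.prems(2) by (rule ball_arc(1))
  with Cons show ?case by fastforce
qed simp

lemma ball_walk_back: "walk B u p v \<Longrightarrow> v \<in> ball i X \<Longrightarrow> u \<in> ball (i + length p) X"
proof (induction p arbitrary: u)
  case (Cons e p)
  then have "(u, snd e) \<in> E" by (metis prod.collapse walk.simps(2))
  moreover have "snd e \<in> ball (i + length p) X" using Cons by simp
  ultimately have "u \<in> ball (Suc (i + length p)) X" by (rule ball_arc(2))
  then show ?case by simp
qed simp

lemma walk_take_ball:
  "walk B u p v \<Longrightarrow> u \<in> ball i X \<Longrightarrow> e \<in> set (take k p) \<Longrightarrow> fst e \<in> ball (i + k) X"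
proof (induction p arbitrary: u i k)
  case (Cons e' p)
  then obtain k' where k: "k = Suc k'" by (cases k) auto
  from Cons.prems(3) k consider "e = e'" | "e \<in> set (take k' p)" by auto
  then show ?case
  proof cases
    case 1
    then show ?thesis using Cons.prems ball_mono[of i "i + k" X] by auto
  next
    case 2
    have "(u, snd e') \<in> E" using Cons.prems(1) by (metis prod.collapse walk.simps(2))
    then have "snd e' \<in> ball (Suc i) X" using Cons.prems(2) by (rule ball_arc(1))
    then have "fst e \<in> ball (Suc i + k') X" using Cons.IH[of "snd e'" "Suc i" k'] 2 Cons.prems(1) by simp
    then show ?thesis using k by simp
  qed
qed simp

lemma walk_take_level:
  "walk B u p v \<Longrightarrow> e \<in> set (take k p) \<Longrightarrow> snd u < snd (fst e) + k"
proof (induction p arbitrary: u k)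
  case (Cons e' p)
  then obtain k' where k: "k = Suc k'" by (cases k) auto
  from Cons.prems(2) k consider "e = e'" | "e \<in> set (take k' p)" by auto
  then show ?case
  proof cases
    case 1
    then show ?thesis using Cons.prems k by auto
  next
    case 2
    have "e' \<in> E" "fst e' = u" using Cons.prems(1) by auto
    then have "snd u \<le> Suc (snd (snd e'))" using arcs_simps(3) by metis
    moreover have "snd (snd e') < snd (fst e) + k'" using Cons.IH[OF _ 2] Cons.prems(1) by simp
    ultimately show ?thesis using k by simp
  qed
qed simp

text \<open>Otherwise a geodesic from \<open>z\<close> to \<open>x\<close>, spliced in at
  \<open>z\<close>, would give a geodesic from \<open>v\<close> to \<open>x\<close>.\<close>

lemma not_root_geod_vertex:
  assumes "geod B \<omega> v p w" "\<not> root B \<omega> v x" "z \<in> set (v # map snd p)"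
  shows "\<not> root B \<omega> z x"
proof
  assume "root B \<omega> z x"
  then obtain q where q: "geod B \<omega> z q x" by (auto simp: root_def)
  have "walk B v p w" using assms(1) by (simp add: geod_def)
  then obtain p1 p2 where p: "p = p1 @ p2" "walk B v p1 z" using walk_through[OF _ assms(3)] by metis
  have "geod B \<omega> v (p1 @ q) x" using assms(1) p q by (auto intro: geod_splice)
  with assms(2) show False by (auto simp: root_def)
qed

definition level_tree :: "nat set \<Rightarrow> nat \<Rightarrow> ('e \<Rightarrow> real) \<Rightarrow> 'g vertex \<Rightarrow> 'g set" where
  "level_tree B n \<omega> v = {y \<in> carrier G. root B \<omega> (y, n) v}"

text \<open>It depends on the configuration only through \<open>A\<close>, so it is fixed once the
  level set of the tree has been fixed.\<close>

definition region :: "nat \<Rightarrow> nat \<Rightarrow> 'g set \<Rightarrow> 'e set" where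
  "region i m A = \<kappa> ` {e \<in> E. fst e \<in> ball i (A \<times> {m})}"

lemma finite_region:
  assumes "finite A"
  shows "finite (region i m A)" "card (region i m A) \<le> \<Delta> * ((1 + 2 * \<Delta>) ^ i * card A)"
proof -
  let ?Y = "ball i (A \<times> {m})"
  have Y: "finite ?Y" "card ?Y \<le> (1 + 2 * \<Delta>) ^ i * card A"
    using finite_ball[of "A \<times> {m}" i] assms by (auto simp: card_cartesian_product)
  have eq: "{e \<in> E. fst e \<in> ?Y} = (\<Union>u\<in>?Y. Pair u ` {v. (u, v) \<in> E})"
    by (auto simp: image_iff)
  have fin: "finite {e \<in> E. fst e \<in> ?Y}" unfolding eq using Y(1) out_degree(1) by auto
  then show "finite (region i m A)" by (simp add: region_def)
  have "card (region i m A) \<le> card {e \<in> E. fst e \<in> ?Y}"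
    unfolding region_def using fin by (rule card_image_le)
  also have "\<dots> \<le> (\<Sum>u\<in>?Y. card (Pair u ` {v. (u, v) \<in> E}))"
    unfolding eq using Y(1) by (rule card_UN_le)
  also have "\<dots> \<le> (\<Sum>u\<in>?Y. \<Delta>)"
    using out_degree by (intro sum_mono) (auto intro: order_trans[OF card_image_le])
  also have "\<dots> = \<Delta> * card ?Y" by simp
  also have "\<dots> \<le> \<Delta> * ((1 + 2 * \<Delta>) ^ i * card A)" using Y(2) by (rule mult_le_mono2)
  finally show "card (region i m A) \<le> \<Delta> * ((1 + 2 * \<Delta>) ^ i * card A)" .
qed

text \<open>
  On each geodesic that starts next to the tree of \<open>x\<close> and ends elsewhere, all weights above \<open>hi\<close>
  among the first \<open>k\<close> arcs are lowered to at most \<open>lo\<close>. This saves more than the excess \<open>Z\<close>.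
\<close>
lemma kill_tree:
  assumes good: "good \<omega>" and x: "snd x = 0"
    and levels: "J < n" "n \<le> N" "m + k = n - \<delta> * J"
    and con: "\<forall>y\<in>carrier G. \<forall>n>J. M < card {v. \<exists>\<sigma>. walk {..n} (y, n) \<sigma> v \<and> length \<sigma> = J \<and> snd v = n - \<delta> * J}"
    and small: "small_level M {..N} (n - \<delta> * J) x \<omega>"
    and excess: "\<And>y. y \<in> carrier G \<Longrightarrow> root {..N} \<omega> (y, n) x \<Longrightarrow> \<not> bad_excess J Z N (y, n) \<omega>"
    and high: "\<And>y \<sigma> v. root {..N} \<omega> (y, n) x \<Longrightarrow> walk UNIV (y, n) \<sigma> v \<Longrightarrow> length \<sigma> = J \<Longrightarrow> \<not> few_high k r v \<omega>"
    and near: "\<And>y. y \<in> carrier G \<Longrightarrow> root {..N} \<omega> (y, N) x \<Longrightarrow> near {..N} \<omega> \<rho> n m (y, N)"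
    and Z: "0 < Z" "Z \<le> (real r + 1) * (hi - lo)"
  shows "\<exists>F \<subseteq> region (\<rho> + J + k) m (level_tree {..m} m \<omega> x). \<forall>\<omega>'.
    (\<forall>e\<in>E. \<kappa> e \<notin> F \<longrightarrow> \<omega>' (\<kappa> e) = \<omega> (\<kappa> e)) \<and> (\<forall>e\<in>F. \<omega>' e \<le> lo) \<longrightarrow>
    level_tree {..m} m \<omega>' x = level_tree {..m} m \<omega> x \<and> \<not> alive N \<omega>' x"
proof -
  let ?B = "{..N}" and ?A = "level_tree {..m} m \<omega> x" and ?n' = "n - \<delta> * J"
  have down: "\<forall>i\<in>?B. {..i} \<subseteq> ?B" by auto
  note pos = goodD(1)[OF good]
  \<comment> \<open>Geodesics may tie, so one is selected from each vertex; this makes the set of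
    lowered labels definite.\<close>
  define gp where "gp v = (SOME p. \<exists>w. geod ?B \<omega> v p w)" for v
  have gp: "\<exists>w. geod ?B \<omega> v (gp v) w" if v: "v \<in> carrier G \<times> ?B" for v
  proof -
    obtain p w where "geod ?B \<omega> v p w" using geod_exists'[OF good v] .
    then have "\<exists>p. \<exists>w. geod ?B \<omega> v p w" by (intro exI)
    then show ?thesis unfolding gp_def by (rule someI_ex)
  qed
  let ?start = "\<lambda>v. v \<in> carrier G \<times> ?B \<and> v \<in> ball (\<rho> + J) (?A \<times> {m}) \<and> snd v = ?n' \<and> \<not> root ?B \<omega> v x"
  define F where "F = {f. \<exists>v e. ?start v \<and> e \<in> set (take k (gp v)) \<and> hi \<le> \<omega> (\<kappa> e) \<and> f = \<kappa> e}"
  have F_D: "\<exists>v w e'. ?start v \<and> geod ?B \<omega> v (gp v) w \<and> e' \<in> set (take k (gp v)) \<and> e' \<in> E \<and>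
      hi \<le> \<omega> (\<kappa> e) \<and> \<kappa> e = \<kappa> e' \<and> (e' = e \<or> e' = (snd e, fst e))"
    if e: "e \<in> E" "\<kappa> e \<in> F" for e
  proof -
    obtain v e' where v: "?start v" "e' \<in> set (take k (gp v))" "hi \<le> \<omega> (\<kappa> e')" "\<kappa> e = \<kappa> e'"
      using e(2) unfolding F_def by blast
    obtain w where w: "geod ?B \<omega> v (gp v) w" using gp v(1) by blast
    then have "walk ?B v (gp v) w" by (simp add: geod_def)
    then have e': "e' \<in> E" using v(2) walk_subset in_set_takeD by fastforce
    moreover have "e' = e \<or> e' = (snd e, fst e)" using label_eq[OF e(1) e' v(4)] .
    ultimately show ?thesis using v w
      by (intro exI[of _ v] exI[of _ w] exI[of _ e']) simp
  qed
  have F_region: "F \<subseteq> region (\<rho> + J + k) m ?A"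
  proof
    fix f assume "f \<in> F"
    then obtain v e where v: "?start v" "e \<in> set (take k (gp v))" "f = \<kappa> e"
      unfolding F_def by blast
    obtain w where "geod ?B \<omega> v (gp v) w" using gp v(1) by blast
    then have w: "walk ?B v (gp v) w" by (simp add: geod_def)
    have "e \<in> E" using v(2) walk_subset[OF w] in_set_takeD by fastforce
    moreover have "fst e \<in> ball (\<rho> + J + k) (?A \<times> {m})" using w v(1,2) walk_take_ball by blast
    ultimately show "f \<in> region (\<rho> + J + k) m ?A" unfolding region_def using v(3) by blast
  qed
  \<comment> \<open>A lowered edge can be crossed in either direction, so both endpoints count. Both
    lie on a selected geodesic that starts outside the tree, and such a geodesic never meets the
    tree.\<close>
  have ends: "\<not> root ?B \<omega> (snd e) x" if e: "e \<in> E" "\<kappa> e \<in> F" for e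
  proof -
    obtain v w e' where v: "?start v" "geod ?B \<omega> v (gp v) w" "e' \<in> set (take k (gp v))"
      "e' = e \<or> e' = (snd e, fst e)" using F_D[OF e] by blast
    have "walk ?B v (gp v) w" using v(2) by (simp add: geod_def)
    then have "{fst e', snd e'} \<subseteq> set (v # map snd (gp v))"
      using walk_arc_through[of ?B v "gp v" w e'] in_set_takeD[OF v(3)] by blast
    moreover have "snd e \<in> {fst e', snd e'}" using v(4) by auto
    ultimately have "snd e \<in> set (v # map snd (gp v))" by blast
    then show ?thesis using not_root_geod_vertex[OF v(2)] v(1) by blast
  qed
  \<comment> \<open>The selected geodesics start on level \<open>m + k\<close> and descend at most
    one level per arc, so each of the first \<open>k\<close> arcs starts above level
    \<open>m\<close>. Hence lowering does not affect the graph truncated at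
    \<open>m\<close>.\<close>
  have low: "m < snd (fst e) \<or> m < snd (snd e)" if e: "e \<in> E" "\<kappa> e \<in> F" for e
  proof -
    obtain v w e' where v: "?start v" "geod ?B \<omega> v (gp v) w" "e' \<in> set (take k (gp v))"
      "e' = e \<or> e' = (snd e, fst e)" using F_D[OF e] by blast
    have "walk ?B v (gp v) w" using v(2) by (simp add: geod_def)
    then have "snd v < snd (fst e') + k" using v(3) by (rule walk_take_level)
    then have "m < snd (fst e')" using v(1) levels(3) by simp
    then show ?thesis using v(4) by auto
  qed
  have F_high: "hi \<le> \<omega> (\<kappa> e)" if "e \<in> E" "\<kappa> e \<in> F" for e
    using F_D[OF that] by blast
  have key: "level_tree {..m} m \<omega>' x = ?A \<and> \<not> alive N \<omega>' x"
    if off: "\<forall>e\<in>E. \<kappa> e \<notin> F \<longrightarrow> \<omega>' (\<kappa> e) = \<omega> (\<kappa> e)" and lo: "\<forall>e\<in>F. \<omega>' e \<le> lo" for \<omega>'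
  proof
    have "geod {..m} \<omega>' u p v \<longleftrightarrow> geod {..m} \<omega> u p v" for u p v
    proof (rule geod_cong)
      fix e assume "e \<in> E" "snd (fst e) \<in> {..m}" "snd (snd e) \<in> {..m}"
      then show "\<omega>' (\<kappa> e) = \<omega> (\<kappa> e)" using low[of e] off by fastforce
    qed
    then show "level_tree {..m} m \<omega>' x = ?A" by (simp add: level_tree_def root_def)
    have le: "\<omega>' (\<kappa> e) \<le> \<omega> (\<kappa> e)" if "e \<in> E" for e
      using that off lo F_high[OF that] lo_hi(1) by (cases "\<kappa> e \<in> F") fastforce+
    have wle: "weight \<omega>' p \<le> weight \<omega> p" if "set p \<subseteq> E" for p
      using that le by (induction p) (auto intro: add_mono)
    have saving: "weight \<omega>' p + nhigh \<omega> p * (hi - lo) \<le> weight \<omega> p"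
      if "set p \<subseteq> E" "\<And>e. e \<in> set p \<Longrightarrow> hi \<le> \<omega> (\<kappa> e) \<Longrightarrow> \<kappa> e \<in> F" for p
      using that
    proof (induction p)
      case (Cons e p)
      have IH: "weight \<omega>' p + nhigh \<omega> p * (hi - lo) \<le> weight \<omega> p" using Cons by auto
      show ?case
      proof (cases "hi \<le> \<omega> (\<kappa> e)")
        case True
        then have "\<kappa> e \<in> F" using Cons.prems(2) by simp
        then have "\<omega>' (\<kappa> e) + (hi - lo) \<le> \<omega> (\<kappa> e)" using lo True by fastforce
        moreover have "real (nhigh \<omega> (e # p)) = nhigh \<omega> p + 1" using True by (simp add: nhigh_def)
        ultimately show ?thesis using IH by (simp add: algebra_simps)
      next
        case False
        then have "nhigh \<omega> (e # p) = nhigh \<omega> p" by (simp add: nhigh_def)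
        moreover have "\<omega>' (\<kappa> e) \<le> \<omega> (\<kappa> e)" using le Cons.prems(1) by simp
        ultimately show ?thesis using IH by simp
      qed
    qed (simp add: nhigh_def)
    have "\<not> root ?B \<omega>' (y, N) x" for y
    proof (rule lowering_kills_tree[OF out_degree(1) good down])
      fix e assume e: "e \<in> E"
      show "\<kappa> e \<notin> F \<Longrightarrow> \<omega>' (\<kappa> e) = \<omega> (\<kappa> e)" using off e by blast
      show "\<omega>' (\<kappa> e) \<le> \<omega> (\<kappa> e)" using le[OF e] .
      show "\<kappa> e \<in> F \<Longrightarrow> \<not> root ?B \<omega> (snd e) x" using ends[OF e] .
    next
      let ?U = "(y, N)"
      assume root: "root ?B \<omega> ?U x"
      have y: "y \<in> carrier G" using root_in_V(1)[OF root] by simp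
      obtain p0 p1 p2 u w v where p: "geod ?B \<omega> ?U (p0 @ p1 @ p2) v" "walk ?B ?U p0 u" "snd u = n"
          "walk ?B u p1 w" "length p1 \<le> \<rho>" "snd w = m" "walk {..m} w p2 v"
        using near[OF y root] unfolding near_def near_walk_def by (elim exE conjE) simp
      have "root ?B \<omega> ?U v" using p(1) by (auto simp: root_def)
      then have v: "v = x" using root_unique[OF good _ root] by blast
      have gu: "geod ?B \<omega> u (p1 @ p2) x" using geod_suffix[OF p(1,2)] v by simp
      then have ru: "root ?B \<omega> u x" by (auto simp: root_def)
      obtain z where u: "u = (z, n)" "z \<in> carrier G"
        using root_in_V(1)[OF ru] p(3) by (cases u) auto
      \<comment> \<open>The tail stays on levels up to \<open>m\<close>, so \<open>w\<close> lies in
        the level set of the truncated tree, and \<open>u\<close> is within \<open>\<rho>\<close>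
        steps of it.\<close>
      have "geod ?B \<omega> w p2 x" using geod_suffix[OF gu p(4)] .
      moreover have "{..m} \<subseteq> ?B" using levels(2,3) by auto
      ultimately have "geod {..m} \<omega> w p2 x" using p(7) v by (metis geod_restrict)
      then have "root {..m} \<omega> w x" by (auto simp: root_def)
      then have "w \<in> ?A \<times> {m}"
        using root_in_V(1)[of "{..m}" \<omega> w x] p(6) by (cases w) (auto simp: level_tree_def)
      then have "u \<in> ball (0 + length p1) (?A \<times> {m})" using ball_walk_back[OF p(4), of 0] by simp
      then have uball: "u \<in> ball \<rho> (?A \<times> {m})" using ball_mono[OF p(5)] by auto
      \<comment> \<open>More than \<open>M\<close> vertices of level \<open>?n'\<close> can be
        reached by such walks, while the tree has at most \<open>M\<close> vertices there; one of
        the walks therefore leaves the tree.\<close>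
      let ?V = "{v. \<exists>\<sigma>. walk {..n} u \<sigma> v \<and> length \<sigma> = J \<and> snd v = ?n'}"
      have "M < card ?V" using con u levels(1) by blast
      moreover have "card {v. root ?B \<omega> v x \<and> snd v = ?n'} \<le> M"
        and finR: "finite {v. root ?B \<omega> v x \<and> snd v = ?n'}"
      proof -
        have eq: "{v. root ?B \<omega> v x \<and> snd v = ?n'} = (\<lambda>y. (y, ?n')) ` {y \<in> carrier G. root ?B \<omega> (y, ?n') x}"
        proof (intro equalityI subsetI)
          fix v assume "v \<in> {v. root ?B \<omega> v x \<and> snd v = ?n'}"
          then show "v \<in> (\<lambda>y. (y, ?n')) ` {y \<in> carrier G. root ?B \<omega> (y, ?n') x}"
            using root_in_V(1)[of ?B \<omega> v x] by (cases v) auto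
        qed auto
        show "finite {v. root ?B \<omega> v x \<and> snd v = ?n'}" using small unfolding eq small_level_def by auto
        show "card {v. root ?B \<omega> v x \<and> snd v = ?n'} \<le> M"
          unfolding eq using small card_image_le[of "{y \<in> carrier G. root ?B \<omega> (y, ?n') x}" "\<lambda>y. (y, ?n')"]
          by (simp add: small_level_def)
      qed
      ultimately have "\<not> ?V \<subseteq> {v. root ?B \<omega> v x \<and> snd v = ?n'}"
        using card_mono[OF finR, of ?V] by linarith
      then obtain v' where "v' \<in> ?V" and v'_root: "\<not> root ?B \<omega> v' x" by blast
      then obtain \<sigma> where \<sigma>: "walk {..n} u \<sigma> v'" "length \<sigma> = J" "snd v' = ?n'" by blast
      have w\<sigma>: "walk ?B u \<sigma> v'" using \<sigma>(1) levels(2) by (auto elim: walk_mono)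
      have v'V: "v' \<in> carrier G \<times> ?B" using walk_end[OF w\<sigma>] .
      have "v' \<in> ball (\<rho> + J) (?A \<times> {m})" using ball_walk[OF w\<sigma> uball] \<sigma>(2) by simp
      then have start: "?start v'" using v'V \<sigma>(3) v'_root by blast
      obtain w0 where w0: "geod ?B \<omega> v' (gp v') w0" using gp[OF v'V] by blast
      let ?\<pi> = "gp v'"
      have w\<pi>: "walk ?B v' ?\<pi> w0" "snd w0 = 0" using w0 by (auto simp: geod_def)
      have path: "path v' ?\<pi> w0" using geod_distinct[OF pos w0] .
      have k: "k \<le> length ?\<pi>" using walk_levels[OF w\<pi>(1)] w\<pi>(2) \<sigma>(3) levels(3) by simp
      have sub: "set ?\<pi> \<subseteq> E" "set \<sigma> \<subseteq> E" "set p0 \<subseteq> E" "set (p1 @ p2) \<subseteq> E"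
        using walk_subset[OF w\<pi>(1)] walk_subset[OF w\<sigma>] walk_subset[OF p(2)] geod_lists[OF gu]
        by auto
      have sub_k: "set (take k ?\<pi>) \<subseteq> E" "set (drop k ?\<pi>) \<subseteq> E"
        using sub(1) by (auto dest: in_set_takeD in_set_dropD)
      have "\<not> few_high k r v' \<omega>"
      proof (rule high)
        show "root ?B \<omega> (z, n) x" using ru u by simp
        show "walk UNIV (z, n) \<sigma> v'" using w\<sigma> u by (auto elim: walk_mono)
      qed (rule \<sigma>(2))
      moreover have "take k ?\<pi> \<in> {p \<in> lists E. (\<exists>v. path v' p v) \<and> length p = k}"
        using sub_k(1) path_take[OF path k] k by (simp add: in_lists_conv_set subset_iff)
      ultimately have "r < nhigh \<omega> (take k ?\<pi>)" unfolding few_high_def by (meson not_le)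
      then have "real r + 1 \<le> nhigh \<omega> (take k ?\<pi>)" by simp
      then have "(real r + 1) * (hi - lo) \<le> nhigh \<omega> (take k ?\<pi>) * (hi - lo)"
        using lo_hi(1) by (intro mult_right_mono) auto
      moreover have "weight \<omega>' (take k ?\<pi>) + nhigh \<omega> (take k ?\<pi>) * (hi - lo) \<le> weight \<omega> (take k ?\<pi>)"
      proof (rule saving[OF sub_k(1)])
        fix e assume "e \<in> set (take k ?\<pi>)" "hi \<le> \<omega> (\<kappa> e)"
        with start show "\<kappa> e \<in> F" unfolding F_def by blast
      qed
      moreover have "weight \<omega>' (drop k ?\<pi>) \<le> weight \<omega> (drop k ?\<pi>)" using wle[OF sub_k(2)] .
      moreover have "weight f ?\<pi> = weight f (take k ?\<pi>) + weight f (drop k ?\<pi>)" for f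
        by (metis append_take_drop_id weight_simps(3))
      ultimately have sav: "weight \<omega>' ?\<pi> + Z \<le> weight \<omega> ?\<pi>" using Z by (smt (verit))
      have "\<not> bad_excess J Z N u \<omega>" using excess u ru by blast
      moreover have "\<sigma> \<in> lists E" using sub(2) by auto
      moreover have "v' \<in> V" using v'V by auto
      moreover have "walk {..snd u} u \<sigma> v' \<and> length \<sigma> = J \<and> snd v' = snd u - \<delta> * J" using \<sigma> p(3) by simp
      ultimately have "\<not> ptime ?B u \<omega> + ennreal Z \<le> ptime ?B v' \<omega> + ennreal (weight \<omega> \<sigma>)"
        unfolding bad_excess_def by blast
      then have "ennreal (weight \<omega> ?\<pi>) + ennreal (weight \<omega> \<sigma>) < ennreal (weight \<omega> (p1 @ p2)) + ennreal Z"
        using ptime_geod[OF gu] ptime_geod[OF w0] by (simp only: not_le)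
      then have "ennreal (weight \<omega> ?\<pi> + weight \<omega> \<sigma>) < ennreal (weight \<omega> (p1 @ p2) + Z)"
        using weight_nonneg[OF pos sub(1)] weight_nonneg[OF pos sub(2)] weight_nonneg[OF pos sub(4)] Z(1)
        by (simp only: ennreal_plus less_imp_le)
      then have lt: "weight \<omega> ?\<pi> + weight \<omega> \<sigma> < weight \<omega> (p1 @ p2) + Z"
        using ennreal_leI not_le by metis
      \<comment> \<open>The detour through \<open>v'\<close> used to lose less than
        \<open>Z\<close>, and lowering gains at least \<open>Z\<close> on it.\<close>
      have "weight \<omega>' (p0 @ \<sigma> @ ?\<pi>) < weight \<omega> (p0 @ p1 @ p2)"
        using lt sav wle[OF sub(2)] wle[OF sub(3)] by simp
      moreover have "walk ?B ?U (p0 @ \<sigma> @ ?\<pi>) w0" using p(2) w\<sigma> w\<pi>(1) by (intro walk_appendI)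
      ultimately show "\<exists>q w v p. walk ?B ?U q w \<and> snd w = 0 \<and> geod ?B \<omega> ?U p v \<and> weight \<omega>' q < weight \<omega> p"
        using w\<pi>(2) p(1) by (intro exI conjI)
    qed
    then show "\<not> alive N \<omega>' x" by (simp add: alive_def)
  qed
  show ?thesis
    by (rule exI[of _ F], rule conjI, rule F_region, intro allI impI, elim conjE, rule key)
qed

section \<open>Almost surely no tree survives\<close>

lemma pred_level_tree: "Measurable.pred P (\<lambda>\<omega>. level_tree B n \<omega> v = A)"
proof (cases "A \<subseteq> carrier G")
  case True
  have "level_tree B n \<omega> v = A \<longleftrightarrow> (\<forall>y\<in>carrier G. root B \<omega> (y, n) v = (y \<in> A))" for \<omega>
    using True by (auto simp: level_tree_def)
  moreover have "Measurable.pred P (\<lambda>\<omega>. \<forall>y\<in>carrier G. root B \<omega> (y, n) v = (y \<in> A))"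
    by (intro pred_countable_Ball countable_carrier) measurable
  ultimately show ?thesis by simp
next
  case False
  then have "level_tree B n \<omega> v \<noteq> A" for \<omega> by (auto simp: level_tree_def)
  then show ?thesis by simp
qed

text \<open>Resampling preserves the measure only for a fixed set of coordinates, whereas
  \<open>F\<close> depends on the configuration. Once the level set \<open>A\<close> is fixed,
  \<open>F\<close> is one of at most \<open>2 ^ K\<close> subsets of a fixed region, and summing
  over all of them costs the factor \<open>2 ^ K\<close>. For the right \<open>F\<close>, all fresh
  weights are at most \<open>lo\<close> with probability at least
  \<open>measure \<mu> {..lo} ^ K\<close>.\<close>

lemma resampling_bound:
  assumes S: "S \<in> sets P"
    and tree: "\<And>\<omega>. \<omega> \<in> S \<Longrightarrow> finite (level_tree {..m} m \<omega> x) \<and> level_tree {..m} m \<omega> x \<noteq> {}"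
    and card: "\<And>\<omega>. \<omega> \<in> S \<Longrightarrow> card (region i m (level_tree {..m} m \<omega> x)) \<le> K"
    and kill: "\<And>\<omega>. \<omega> \<in> S \<Longrightarrow> \<exists>F \<subseteq> region i m (level_tree {..m} m \<omega> x). \<forall>\<omega>'.
      (\<forall>e\<in>E. \<kappa> e \<notin> F \<longrightarrow> \<omega>' (\<kappa> e) = \<omega> (\<kappa> e)) \<and> (\<forall>e\<in>F. \<omega>' e \<le> lo) \<longrightarrow>
      level_tree {..m} m \<omega>' x = level_tree {..m} m \<omega> x \<and> \<not> alive N \<omega>' x"
    and mN: "m \<le> N"
  shows "measure \<mu> {..lo} ^ K * measure P S \<le>
    2 ^ K * (\<P>(\<omega> in P. alive m \<omega> x) - \<P>(\<omega> in P. alive N \<omega> x))"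
proof -
  let ?c = "measure \<mu> {..lo}"
  have c: "0 < ?c" "?c \<le> 1" using lo_hi(3) by auto
  let ?SS = "{A. finite A \<and> A \<subseteq> carrier G} - {{}}"
  have SS: "countable ?SS" using countable_Collect_finite_subset[OF countable_carrier] by (rule countable_Diff)
  let ?T = "\<lambda>A. {\<omega> \<in> space P. level_tree {..m} m \<omega> x = A}"
  have T: "?T A \<in> sets P" for A using pred_level_tree by (simp add: pred_def)
  have al: "{\<omega> \<in> space P. alive n \<omega> x} \<in> sets P" for n by measurable
  let ?SA = "\<lambda>A. S \<inter> ?T A" and ?D = "\<lambda>A. ?T A - {\<omega> \<in> space P. alive N \<omega> x}"
  have SA: "?SA A \<in> sets P" and D: "?D A \<in> sets P" for A using S T al by auto
  have step: "ennreal (?c ^ K) * emeasure P (?SA A) \<le> 2 ^ K * emeasure P (?D A)" for A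
  proof (cases "?SA A = {}")
    case False
    then obtain \<omega>0 where "\<omega>0 \<in> S" "level_tree {..m} m \<omega>0 x = A" by blast
    then have A: "finite A" "card (region i m A) \<le> K" using tree card by blast+
    have R: "finite (region i m A)" using finite_region(1)[OF A(1)] .
    let ?f = "\<lambda>F \<omega>. emeasure P {\<eta> \<in> space P. override (\<kappa> ` E) F \<omega> \<eta> \<in> ?D A}"
    \<comment> \<open>The summand of the suitable \<open>F\<close> alone is large enough; the others
      are nonnegative. After integration each summand equals the probability of \<open>?D A\<close>,
      by \<open>emeasure_override\<close>.\<close>
    have pointwise: "ennreal (?c ^ K) * indicator (?SA A) \<omega> \<le> (\<Sum>F\<in>Pow (region i m A). ?f F \<omega>)"
      if \<omega>: "\<omega> \<in> space P" for \<omega>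
    proof (cases "\<omega> \<in> ?SA A")
      case True
      then obtain F where F: "F \<subseteq> region i m A" and FK: "\<And>\<omega>'.
        (\<forall>e\<in>E. \<kappa> e \<notin> F \<longrightarrow> \<omega>' (\<kappa> e) = \<omega> (\<kappa> e)) \<Longrightarrow> (\<forall>e\<in>F. \<omega>' e \<le> lo) \<Longrightarrow>
        level_tree {..m} m \<omega>' x = A \<and> \<not> alive N \<omega>' x"
        using kill[of \<omega>] by blast
      have FE: "F \<subseteq> \<kappa> ` E" and finF: "finite F" and cardF: "card F \<le> K"
        using F R A(2) card_mono[OF R F] finite_subset[OF F R] by (auto simp: region_def)
      let ?L = "{\<eta> \<in> space P. \<forall>e\<in>F. \<eta> e \<in> {..lo}}"
      have "?L \<subseteq> {\<eta> \<in> space P. override (\<kappa> ` E) F \<omega> \<eta> \<in> ?D A}"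
      proof clarify
        fix \<eta> assume \<eta>: "\<eta> \<in> space P" "\<forall>e\<in>F. \<eta> e \<in> {..lo}"
        let ?o = "override (\<kappa> ` E) F \<omega> \<eta>"
        have "?o \<in> space P" by (auto simp: override_def space_PiM space_\<mu>)
        moreover have "level_tree {..m} m ?o x = A \<and> \<not> alive N ?o x"
          using \<eta>(2) FE by (intro FK) (auto simp: override_def)
        ultimately show "?o \<in> ?D A" by simp
      qed
      moreover have "{\<eta> \<in> space P. override (\<kappa> ` E) F \<omega> \<eta> \<in> ?D A} \<in> sets P"
      proof -
        have "(\<lambda>\<eta>. (\<omega>, \<eta>)) \<in> measurable P (P \<Otimes>\<^sub>M P)" using \<omega> by measurable
        from measurable_compose[OF this measurable_override]
        have "(\<lambda>\<eta>. override (\<kappa> ` E) F \<omega> \<eta>) \<in> measurable P P" by simp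
        then have "(\<lambda>\<eta>. override (\<kappa> ` E) F \<omega> \<eta>) -` ?D A \<inter> space P \<in> sets P" using D by (rule measurable_sets)
        also have "(\<lambda>\<eta>. override (\<kappa> ` E) F \<omega> \<eta>) -` ?D A \<inter> space P =
          {\<eta> \<in> space P. override (\<kappa> ` E) F \<omega> \<eta> \<in> ?D A}" by blast
        finally show ?thesis .
      qed
      ultimately have L: "emeasure P ?L \<le> ?f F \<omega>" by (rule emeasure_mono)
      have "ennreal (?c ^ K) \<le> ennreal (?c ^ card F)"
        using cardF c by (intro ennreal_leI power_decreasing) auto
      also have "ennreal (?c ^ card F) = (\<Prod>e\<in>F. emeasure \<mu> {..lo})"
        by (simp add: \<mu>.emeasure_eq_measure ennreal_power)
      also have "\<dots> = emeasure P ?L"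
        using FE finF sets_\<mu> by (intro P.emeasure_PiM_Collect[symmetric]) auto
      also note L
      also have "?f F \<omega> \<le> (\<Sum>F\<in>Pow (region i m A). ?f F \<omega>)"
        using F R by (intro member_le_sum) auto
      finally have "ennreal (?c ^ K) \<le> (\<Sum>F\<in>Pow (region i m A). ?f F \<omega>)" .
      then show ?thesis using True by simp
    qed simp
    have "ennreal (?c ^ K) * emeasure P (?SA A) = (\<integral>\<^sup>+\<omega>. ennreal (?c ^ K) * indicator (?SA A) \<omega> \<partial>P)"
      by (rule nn_integral_cmult_indicator[OF SA, symmetric])
    also have "\<dots> \<le> (\<integral>\<^sup>+\<omega>. (\<Sum>F\<in>Pow (region i m A). ?f F \<omega>) \<partial>P)"
      by (intro nn_integral_mono pointwise)
    also have "\<dots> = (\<Sum>F\<in>Pow (region i m A). \<integral>\<^sup>+\<omega>. ?f F \<omega> \<partial>P)"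
      using emeasure_override(2)[OF prob_\<mu> D] by (intro nn_integral_sum)
    also have "\<dots> = (\<Sum>F\<in>Pow (region i m A). emeasure P (?D A))"
      using emeasure_override(1)[OF prob_\<mu> D] by (intro sum.cong refl) simp
    also have "\<dots> = 2 ^ card (region i m A) * emeasure P (?D A)"
      using R by (simp add: card_Pow)
    also have "\<dots> \<le> 2 ^ K * emeasure P (?D A)"
      using A(2) by (intro mult_right_mono power_increasing) auto
    finally show ?thesis .
  qed simp
  have SU: "S = (\<Union>A\<in>?SS. ?SA A)"
  proof (intro equalityI subsetI)
    fix \<omega> assume \<omega>: "\<omega> \<in> S"
    then have "level_tree {..m} m \<omega> x \<in> ?SS" using tree[OF \<omega>] by (auto simp: level_tree_def)
    moreover have "\<omega> \<in> ?SA (level_tree {..m} m \<omega> x)" using \<omega> sets.sets_into_space[OF S] by auto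
    ultimately show "\<omega> \<in> (\<Union>A\<in>?SS. ?SA A)" by (rule UN_I)
  qed auto
  have disj: "disjoint_family_on ?SA ?SS" "disjoint_family_on ?D ?SS"
    by (auto simp: disjoint_family_on_def)
  have sub: "{\<omega> \<in> space P. alive N \<omega> x} \<subseteq> {\<omega> \<in> space P. alive m \<omega> x}"
    using alive_antimono[OF _ mN] by blast
  have "emeasure P S = (\<integral>\<^sup>+A. emeasure P (?SA A) \<partial>count_space ?SS)"
    by (subst SU) (rule emeasure_UN_countable[OF SA SS disj(1)])
  then have "ennreal (?c ^ K) * emeasure P S = ennreal (?c ^ K) * (\<integral>\<^sup>+A. emeasure P (?SA A) \<partial>count_space ?SS)"
    by (rule arg_cong)
  also have "\<dots> = (\<integral>\<^sup>+A. ennreal (?c ^ K) * emeasure P (?SA A) \<partial>count_space ?SS)"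
    by (rule nn_integral_cmult[symmetric]) simp
  also have "\<dots> \<le> (\<integral>\<^sup>+A. 2 ^ K * emeasure P (?D A) \<partial>count_space ?SS)"
    by (intro nn_integral_mono step)
  also have "\<dots> = 2 ^ K * (\<integral>\<^sup>+A. emeasure P (?D A) \<partial>count_space ?SS)"
    by (rule nn_integral_cmult) simp
  also have "(\<integral>\<^sup>+A. emeasure P (?D A) \<partial>count_space ?SS) = emeasure P (\<Union>A\<in>?SS. ?D A)"
    by (rule emeasure_UN_countable[OF D SS disj(2), symmetric])
  \<comment> \<open>The empty level set has been left out of \<open>?SS\<close>, so each
    \<open>?D A\<close> consists of configurations alive at \<open>m\<close> and dead at
    \<open>N\<close>.\<close>
  also have "\<dots> \<le> emeasure P ({\<omega> \<in> space P. alive m \<omega> x} - {\<omega> \<in> space P. alive N \<omega> x})"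
    using al by (intro emeasure_mono) (auto simp: alive_def level_tree_def)
  also have "\<dots> = ennreal (\<P>(\<omega> in P. alive m \<omega> x) - \<P>(\<omega> in P. alive N \<omega> x))"
    by (simp only: P.emeasure_eq_measure P.finite_measure_Diff[OF al al sub])
  finally have fin: "ennreal (?c ^ K) * emeasure P S \<le> 2 ^ K *
    ennreal (\<P>(\<omega> in P. alive m \<omega> x) - \<P>(\<omega> in P. alive N \<omega> x))"
    by (simp add: mult_left_mono)
  have diff: "0 \<le> \<P>(\<omega> in P. alive m \<omega> x) - \<P>(\<omega> in P. alive N \<omega> x)"
    using P.finite_measure_mono[OF sub al] by simp
  have "ennreal (?c ^ K * measure P S) \<le> ennreal (2 ^ K *
    (\<P>(\<omega> in P. alive m \<omega> x) - \<P>(\<omega> in P. alive N \<omega> x)))"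
    using fin c diff by (simp add: P.emeasure_eq_measure ennreal_mult ennreal_power[symmetric])
  then show ?thesis using diff by (subst (asm) ennreal_le_iff) auto
qed

section \<open>Bad events near the tree and the drop of the survival probability\<close>

definition bad_few :: "nat \<Rightarrow> nat \<Rightarrow> nat \<Rightarrow> 'g vertex \<Rightarrow> ('e \<Rightarrow> real) \<Rightarrow> bool" where
  "bad_few J k r u \<omega> \<longleftrightarrow> (\<exists>\<sigma>\<in>{\<sigma>. length \<sigma> = J \<and> (\<exists>v. walk UNIV u \<sigma> v)}. few_high k r (last (u # map snd \<sigma>)) \<omega>)"

lemma bad_fewI: "walk UNIV u \<sigma> v \<Longrightarrow> length \<sigma> = J \<Longrightarrow> few_high k r v \<omega> \<Longrightarrow> bad_few J k r u \<omega>"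
  unfolding bad_few_def using walk_last by blast

lemma bad_fewE:
  assumes "bad_few J k r u \<omega>"
  obtains \<sigma> v where "walk UNIV u \<sigma> v" "length \<sigma> = J" "few_high k r v \<omega>"
proof -
  obtain \<sigma> v where \<sigma>: "length \<sigma> = J" "walk UNIV u \<sigma> v" "few_high k r (last (u # map snd \<sigma>)) \<omega>"
    using assms unfolding bad_few_def by blast
  from \<sigma>(3) have "few_high k r v \<omega>" using walk_last[OF \<sigma>(2)] by simp
  with \<sigma> that show ?thesis by blast
qed

lemma pred_bad_few: "Measurable.pred P (bad_few J k r u)"
  unfolding bad_few_def[abs_def]
  by (rule pred_countable_Bex[OF countable_finite[OF finite_walks[OF out_degree(1)]] pred_few_high])

lemma equivariant_bad_few: "equivariant (bad_few J k r)"
proof (rule equivariantI)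
  fix u show "Measurable.pred P (bad_few J k r u)" by (rule pred_bad_few)
next
  fix u g \<omega> assume g: "g \<in> carrier G" and "bad_few J k r u (shift g \<omega>)"
  from this(2) obtain \<sigma> v where *: "walk UNIV u \<sigma> v" "length \<sigma> = J" "few_high k r v (shift g \<omega>)" by (rule bad_fewE)
  then show "bad_few J k r (tr g u) \<omega>"
    using few_high_shift[OF g *(3)] by (intro bad_fewI[OF walk_translate[OF g *(1)]]) simp_all
qed

lemma prob_bad_few: "\<P>(\<omega> in P. bad_few J k r u \<omega>) \<le> real \<Delta> ^ J * ((4 * real \<Delta>) ^ r / 2 ^ k)"
proof (rule prob_Union_walks)
  let ?W = "{\<sigma>. length \<sigma> = J \<and> (\<exists>v. walk UNIV u \<sigma> v)}"
  let ?A = "\<lambda>\<sigma>. {\<omega> \<in> space P. few_high k r (last (u # map snd \<sigma>)) \<omega>}"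
  show "?W \<subseteq> ?W" ..
  show "{\<omega> \<in> space P. bad_few J k r u \<omega>} \<subseteq> (\<Union>\<sigma>\<in>?W. ?A \<sigma>)" unfolding bad_few_def by blast
  show "?A \<sigma> \<in> sets P \<and> measure P (?A \<sigma>) \<le> (4 * real \<Delta>) ^ r / 2 ^ k" for \<sigma>
    by (intro conjI prob_few_high) measurable
qed simp

lemma equivariant_near: "equivariant (\<lambda>u \<omega>. near B \<omega> \<rho> n m u)"
  by (rule equivariantI) (auto intro: near_shift)

lemma equivariant_not: "equivariant Q \<Longrightarrow> equivariant (\<lambda>u \<omega>. \<not> Q u \<omega>)"
  unfolding equivariant_def by (blast intro: pred_intros_logic)

text \<open>Both \<open>c\<close> and \<open>q\<close> are independent of \<open>a\<close>. Since
  \<open>a - q\<close> and \<open>2 * a\<close> tend to infinity together, a gap of this kind is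
  incompatible with a limit of the survival probabilities.\<close>

lemma survival_gap:
  assumes x: "x \<in> carrier G" and p: "0 < p" and alive: "\<And>n. p \<le> \<P>(\<omega> in P. alive n \<omega> (x, 0))"
  shows "\<exists>c>0. \<exists>q. \<forall>\<^sub>F a in sequentially.
    c \<le> \<P>(\<omega> in P. alive (a - q) \<omega> (x, 0)) - \<P>(\<omega> in P. alive (2 * a) \<omega> (x, 0))"
proof -
  \<comment> \<open>Five bad events of probability at most \<open>\<epsilon>\<close> each leave at
    least half of \<open>p\<close>.\<close>
  define \<epsilon> where "\<epsilon> = p / 10"
  have \<epsilon>: "0 < \<epsilon>" using p by (simp add: \<epsilon>_def)
  obtain M :: nat where M: "1 / \<epsilon> < M" using reals_Archimedean2 by blast
  have M': "1 / (real M + 1) \<le> \<epsilon>"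
  proof -
    have "1 / \<epsilon> \<le> real M + 1" using M by simp
    then show ?thesis using \<epsilon> by (simp add: field_simps)
  qed
  obtain J where J: "\<forall>y\<in>carrier G. \<forall>n>J. M < card {v. \<exists>\<sigma>. walk {..n} (y, n) \<sigma> v \<and> length \<sigma> = J \<and> snd v = n - \<delta> * J}"
    using connectors by blast
  obtain Z where Z: "0 < Z" and choice: "\<And>q. \<exists>\<rho>. \<forall>\<^sub>F a in sequentially. \<exists>n\<in>{a<..2 * a}.
    \<P>(\<omega> in P. bad_excess J Z (2 * a) (x, n) \<omega>) \<le> \<epsilon> \<and>
    \<P>(\<omega> in P. \<not> near {..2 * a} \<omega> \<rho> n (n - q) (x, 2 * a)) \<le> \<epsilon>"
    using level_choice[OF x \<epsilon> J] by blast
  \<comment> \<open>With this \<open>r\<close>, lowering \<open>r + 1\<close> high weights saves at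
    least \<open>Z\<close>. Below, \<open>k\<close> is taken so large that the first
    \<open>k\<close> arcs of every path from the end of a detour contain that many high weights with
    high probability, even after a union over at most \<open>\<Delta> ^ J\<close> detours.\<close>
  obtain r :: nat where r: "Z / (hi - lo) < r" using reals_Archimedean2 by blast
  have Zr: "Z \<le> (real r + 1) * (hi - lo)"
  proof -
    have "Z \<le> real r * (hi - lo)" using r lo_hi(1) by (simp add: divide_less_eq less_imp_le)
    also have "\<dots> \<le> (real r + 1) * (hi - lo)" using lo_hi(1) by (intro mult_right_mono) auto
    finally show ?thesis .
  qed
  have "(\<lambda>k. real \<Delta> ^ J * ((4 * real \<Delta>) ^ r / 2 ^ k)) \<longlonglongrightarrow> real \<Delta> ^ J * 0"
    by (intro tendsto_mult tendsto_const LIMSEQ_divide_realpow_zero) simp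
  then have "\<forall>\<^sub>F k in sequentially. real \<Delta> ^ J * ((4 * real \<Delta>) ^ r / 2 ^ k) < \<epsilon>"
    using \<epsilon> by (intro order_tendstoD) auto
  then obtain k where k: "real \<Delta> ^ J * ((4 * real \<Delta>) ^ r / 2 ^ k) < \<epsilon>"
    by (auto simp: eventually_sequentially)
  \<comment> \<open>A detour descends \<open>\<delta> * J\<close> levels, and the \<open>k\<close>
    arcs on which weights may be lowered must still start above level \<open>n - ?q\<close>.\<close>
  let ?q = "k + \<delta> * J"
  obtain \<rho> where \<rho>: "\<forall>\<^sub>F a in sequentially. \<exists>n\<in>{a<..2 * a}.
    \<P>(\<omega> in P. bad_excess J Z (2 * a) (x, n) \<omega>) \<le> \<epsilon> \<and>
    \<P>(\<omega> in P. \<not> near {..2 * a} \<omega> \<rho> n (n - ?q) (x, 2 * a)) \<le> \<epsilon>"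
    using choice by blast
  \<comment> \<open>A bound for the size of the region around at most \<open>M\<close> tree
    vertices; it does not involve \<open>a\<close>.\<close>
  define K where "K = \<Delta> * ((1 + 2 * \<Delta>) ^ (\<rho> + J + k) * M)"
  let ?c = "measure \<mu> {..lo} ^ K * (p / 2) / 2 ^ K"
  have c: "0 < ?c" using lo_hi(3) p by simp
  let ?al = "\<lambda>n. \<P>(\<omega> in P. alive n \<omega> (x, 0))"
  have "\<forall>\<^sub>F a in sequentially. ?c \<le> ?al (a - ?q) - ?al (2 * a)"
    using \<rho> eventually_ge_at_top[of "J + ?q"]
  proof eventually_elim
    case (elim a)
    let ?N = "2 * a"
    obtain n where n: "n \<in> {a<..2 * a}"
      and exc: "\<P>(\<omega> in P. bad_excess J Z ?N (x, n) \<omega>) \<le> \<epsilon>"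
      and nr: "\<P>(\<omega> in P. \<not> near {..?N} \<omega> \<rho> n (n - ?q) (x, ?N)) \<le> \<epsilon>"
      using elim(1) by blast
    let ?m = "n - ?q" and ?n' = "n - \<delta> * J"
    note small_level(1)[OF x, measurable]
    let ?A1 = "\<lambda>\<omega>. \<not> small_level M {..?N} ?n' (x, 0) \<omega>"
    let ?A2 = "\<lambda>\<omega>. \<not> small_level M {..?m} ?m (x, 0) \<omega>"
    let ?A3 = "\<lambda>\<omega>. \<exists>y\<in>carrier G. root {..?N} \<omega> (y, n) (x, 0) \<and> bad_excess J Z ?N (y, n) \<omega>"
    let ?A4 = "\<lambda>\<omega>. \<exists>y\<in>carrier G. root {..?N} \<omega> (y, n) (x, 0) \<and> bad_few J k r (y, n) \<omega>"
    let ?A5 = "\<lambda>\<omega>. \<exists>y\<in>carrier G. root {..?N} \<omega> (y, ?N) (x, 0) \<and> \<not> near {..?N} \<omega> \<rho> n ?m (y, ?N)"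
    let ?S = "\<lambda>A. {\<omega> \<in> space P. A \<omega>}"
    have meas: "?S ?A1 \<in> sets P" "?S ?A2 \<in> sets P" "?S ?A3 \<in> sets P" "?S ?A4 \<in> sets P" "?S ?A5 \<in> sets P"
    proof -
      show "?S ?A1 \<in> sets P" "?S ?A2 \<in> sets P" by measurable
      have "Measurable.pred P ?A3"
        using equivariant_bad_excess by (intro pred_countable_Bex countable_carrier pred_intros_logic pred_root) (auto simp: equivariant_def)
      moreover have "Measurable.pred P ?A4"
        by (intro pred_countable_Bex countable_carrier pred_intros_logic pred_root pred_bad_few)
      moreover have "Measurable.pred P ?A5"
        by (intro pred_countable_Bex countable_carrier pred_intros_logic pred_root pred_near)
      ultimately show "?S ?A3 \<in> sets P" "?S ?A4 \<in> sets P" "?S ?A5 \<in> sets P" by (simp_all add: pred_def)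
    qed
    have bounds: "measure P (?S ?A1) \<le> \<epsilon>" "measure P (?S ?A2) \<le> \<epsilon>"
      "measure P (?S ?A3) \<le> \<epsilon>" "measure P (?S ?A4) \<le> \<epsilon>" "measure P (?S ?A5) \<le> \<epsilon>"
      by (rule order_trans[OF small_level(2)[OF x] M']
        order_trans[OF prob_tree_meets_bad[OF equivariant_bad_excess x] exc]
        order_trans[OF prob_tree_meets_bad[OF equivariant_bad_few x] order_trans[OF prob_bad_few less_imp_le[OF k]]]
        order_trans[OF prob_tree_meets_bad[OF equivariant_not[OF equivariant_near] x] nr])+
    let ?bad = "?S ?A1 \<union> (?S ?A2 \<union> (?S ?A3 \<union> (?S ?A4 \<union> ?S ?A5)))"
    have bad: "?bad \<in> sets P" using meas by (intro sets.Un)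
    have "measure P ?bad \<le> \<epsilon> + (\<epsilon> + (\<epsilon> + (\<epsilon> + \<epsilon>)))"
      using meas by (intro order_trans[OF measure_Un_le] add_mono bounds sets.Un)
    then have bad_le: "measure P ?bad \<le> p / 2" by (simp add: \<epsilon>_def)
    obtain Nu where Nu: "{\<omega> \<in> space P. \<not> good \<omega>} \<subseteq> Nu" "Nu \<in> null_sets P"
      using AE_good by (auto simp: eventually_ae_filter)
    let ?E = "{\<omega> \<in> space P. alive ?N \<omega> (x, 0)} - ?bad - Nu"
    have al: "{\<omega> \<in> space P. alive ?N \<omega> (x, 0)} \<in> sets P" by measurable
    have E: "?E \<in> sets P" using Nu(2) by (intro sets.Diff al bad null_setsD2)
    have "p \<le> ?al ?N" by (rule alive)
    also have "\<dots> \<le> measure P (({\<omega> \<in> space P. alive ?N \<omega> (x, 0)} - ?bad) \<union> ?bad)"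
      by (rule P.finite_measure_mono[OF _ sets.Un[OF sets.Diff[OF al bad] bad]]) blast
    also have "\<dots> \<le> measure P ({\<omega> \<in> space P. alive ?N \<omega> (x, 0)} - ?bad) + measure P ?bad"
      using al bad by (intro measure_Un_le sets.Diff)
    also have "measure P ({\<omega> \<in> space P. alive ?N \<omega> (x, 0)} - ?bad) = measure P ?E"
      using al bad Nu(2) by (intro measure_Diff_null_set[symmetric] sets.Diff)
    finally have pE: "p / 2 \<le> measure P ?E" using bad_le by simp
    have nN: "n \<le> ?N" "J < n" "?m + k = ?n'" "?m \<le> ?N" using n elim(2) by auto
    have tree: "finite (level_tree {..?m} ?m \<omega> (x, 0)) \<and> card (level_tree {..?m} ?m \<omega> (x, 0)) \<le> M" if "\<omega> \<in> ?E" for \<omega>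
    proof -
      have "small_level M {..?m} ?m (x, 0) \<omega>" using that by simp
      then show ?thesis unfolding small_level_def level_tree_def .
    qed
    have "measure \<mu> {..lo} ^ K * measure P ?E \<le> 2 ^ K * (?al ?m - ?al ?N)"
    proof (rule resampling_bound[OF E])
      fix \<omega> assume \<omega>: "\<omega> \<in> ?E"
      have good: "good \<omega>" using \<omega> Nu(1) by blast
      have "alive ?m \<omega> (x, 0)" using \<omega> alive_antimono nN(4) by blast
      then obtain y where y: "root {..?m} \<omega> (y, ?m) (x, 0)" by (auto simp: alive_def)
      then have "level_tree {..?m} ?m \<omega> (x, 0) \<noteq> {}"
        using root_in_V(1)[OF y] by (auto simp: level_tree_def)
      with tree[OF \<omega>] show "finite (level_tree {..?m} ?m \<omega> (x, 0)) \<and> level_tree {..?m} ?m \<omega> (x, 0) \<noteq> {}" by blast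
      have "card (region (\<rho> + J + k) ?m (level_tree {..?m} ?m \<omega> (x, 0))) \<le>
          \<Delta> * ((1 + 2 * \<Delta>) ^ (\<rho> + J + k) * card (level_tree {..?m} ?m \<omega> (x, 0)))"
        using tree[OF \<omega>] by (intro finite_region(2)) blast
      also have "\<dots> \<le> K" unfolding K_def using tree[OF \<omega>] by (intro mult_le_mono2) blast
      finally show "card (region (\<rho> + J + k) ?m (level_tree {..?m} ?m \<omega> (x, 0))) \<le> K" .
      show "\<exists>F \<subseteq> region (\<rho> + J + k) ?m (level_tree {..?m} ?m \<omega> (x, 0)). \<forall>\<omega>'.
        (\<forall>e\<in>E. \<kappa> e \<notin> F \<longrightarrow> \<omega>' (\<kappa> e) = \<omega> (\<kappa> e)) \<and> (\<forall>e\<in>F. \<omega>' e \<le> lo) \<longrightarrow>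
        level_tree {..?m} ?m \<omega>' (x, 0) = level_tree {..?m} ?m \<omega> (x, 0) \<and> \<not> alive ?N \<omega>' (x, 0)"
      proof (rule kill_tree[OF good _ nN(2,1,3) J _ _ _ _ Z Zr])
        show "small_level M {..?N} ?n' (x, 0) \<omega>" using \<omega> by blast
        fix y assume "y \<in> carrier G"
        then show "root {..?N} \<omega> (y, n) (x, 0) \<Longrightarrow> \<not> bad_excess J Z ?N (y, n) \<omega>"
          and "root {..?N} \<omega> (y, ?N) (x, 0) \<Longrightarrow> near {..?N} \<omega> \<rho> n ?m (y, ?N)" using \<omega> by blast+
      next
        fix y \<sigma> v assume *: "root {..?N} \<omega> (y, n) (x, 0)" "walk UNIV (y, n) \<sigma> v" "length \<sigma> = J"
        have "y \<in> carrier G" using root_in_V(1)[OF *(1)] by simp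
        then have "\<not> bad_few J k r (y, n) \<omega>" using \<omega> *(1) by blast
        then show "\<not> few_high k r v \<omega>" using bad_fewI[OF *(2,3)] by blast
      qed simp
    qed (rule nN(4))
    \<comment> \<open>About \<open>n\<close> only \<open>a < n\<close> is known in this direction,
      so \<open>?m\<close> is replaced by a level that depends on \<open>a\<close> alone.\<close>
    moreover have "?al ?m \<le> ?al (a - ?q)"
    proof (rule P.finite_measure_mono)
      have "a - ?q \<le> ?m" using n by auto
      then show "{\<omega> \<in> space P. alive ?m \<omega> (x, 0)} \<subseteq> {\<omega> \<in> space P. alive (a - ?q) \<omega> (x, 0)}"
        using alive_antimono by blast
    qed measurable
    moreover have "measure \<mu> {..lo} ^ K * (p / 2) \<le> measure \<mu> {..lo} ^ K * measure P ?E"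
      using pE by (intro mult_left_mono) auto
    moreover from calculation(2) have "2 ^ K * (?al ?m - ?al ?N) \<le> 2 ^ K * (?al (a - ?q) - ?al ?N)"
      by (intro mult_left_mono) auto
    ultimately have "measure \<mu> {..lo} ^ K * (p / 2) \<le> 2 ^ K * (?al (a - ?q) - ?al ?N)"
      by linarith
    then show ?case by (simp add: divide_le_eq mult.commute)
  qed
  with c show ?thesis by blast
qed

lemma AE_dies:
  assumes x: "x \<in> carrier G"
  shows "AE \<omega> in P. \<exists>n. \<not> alive n \<omega> (x, 0)"
proof -
  let ?al = "\<lambda>n. \<P>(\<omega> in P. alive n \<omega> (x, 0))"
  let ?A = "\<lambda>n. {\<omega> \<in> space P. alive n \<omega> (x, 0)}"
  define p where "p = measure P (\<Inter>n. ?A n)"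
  have A: "?A n \<in> sets P" for n by measurable
  have dec: "decseq ?A" unfolding decseq_def using alive_antimono by blast
  have lim: "?al \<longlonglongrightarrow> p"
    unfolding p_def using A dec by (intro P.finite_Lim_measure_decseq) auto
  have p_le: "p \<le> ?al n" for n
    unfolding p_def using A by (intro P.finite_measure_mono) auto
  have "p = 0"
  proof (rule ccontr)
    assume "p \<noteq> 0"
    then have "0 < p" by (simp add: p_def less_le)
    from survival_gap[OF x this p_le] obtain c q where c: "0 < c"
      "\<forall>\<^sub>F a in sequentially. c \<le> ?al (a - q) - ?al (2 * a)" by blast
    have "(\<lambda>a. ?al (a - q)) \<longlonglongrightarrow> p"
      using lim by (rule filterlim_compose) (rule filterlim_minus_const_nat_at_top)
    moreover have "(\<lambda>a. ?al (2 * a)) \<longlonglongrightarrow> p"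
      using lim by (rule filterlim_compose) (rule mult_nat_left_at_top, simp)
    ultimately have "(\<lambda>a. ?al (a - q) - ?al (2 * a)) \<longlonglongrightarrow> p - p" by (rule tendsto_diff)
    then have "c \<le> p - p" using c(2) by (intro tendsto_lowerbound) auto
    with c(1) show False by simp
  qed
  then have "emeasure P (\<Inter>n. ?A n) = 0" by (simp add: p_def P.emeasure_eq_measure)
  moreover have "(\<Inter>n. ?A n) \<in> sets P" using A by blast
  ultimately show ?thesis by (intro AE_I[of _ _ "\<Inter>n. ?A n"]) auto
qed

text \<open>By \<open>alive_if_geod\<close>, death in the graph truncated at \<open>n\<close> leaves
  the tree of the full graph without vertices on or above level \<open>n\<close>; the finitely many
  lower levels are finite almost surely.\<close>

lemma AE_finite_tree:
  assumes x: "x \<in> carrier G"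
  shows "AE \<omega> in P. finite {u. root UNIV \<omega> u (x, 0)}"
proof -
  have "AE \<omega> in P. \<forall>n. finite {y \<in> carrier G. root UNIV \<omega> (y, n) (x, 0)}"
    using AE_finite_level[OF x] by (simp add: AE_all_countable)
  then show ?thesis using AE_dies[OF x]
  proof eventually_elim
    case (elim \<omega>)
    then obtain n where n: "\<not> alive n \<omega> (x, 0)" by blast
    have "{u. root UNIV \<omega> u (x, 0)} \<subseteq> (\<Union>i<n. (\<lambda>y. (y, i)) ` {y \<in> carrier G. root UNIV \<omega> (y, i) (x, 0)})"
    proof
      fix u assume u: "u \<in> {u. root UNIV \<omega> u (x, 0)}"
      then obtain p where p: "geod UNIV \<omega> u p (x, 0)" by (auto simp: root_def)
      have "snd u < n"
      proof (rule ccontr)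
        assume "\<not> snd u < n"
        then have "alive n \<omega> (x, 0)" using p by (intro alive_if_geod) auto
        with n show False by simp
      qed
      moreover have "fst u \<in> carrier G" using u root_in_V(1)[of UNIV \<omega> u "(x, 0)"] by auto
      ultimately show "u \<in> (\<Union>i<n. (\<lambda>y. (y, i)) ` {y \<in> carrier G. root UNIV \<omega> (y, i) (x, 0)})"
        using u by (cases u) auto
    qed
    moreover have "finite (\<Union>i<n. (\<lambda>y. (y, i)) ` {y \<in> carrier G. root UNIV \<omega> (y, i) (x, 0)})"
      using elim(1) by blast
    ultimately show ?case by (rule finite_subset)
  qed
qed

end

section \<open>Geodesic trees of the library digraphs\<close>

context layered_graph
begin

definition digraph_of :: "('g vertex, 'g arc) pre_digraph" where
  "digraph_of = \<lparr>verts = V, arcs = E, tail = fst, head = snd\<rparr>"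

lemma digraph_of_simps [simp]:
  "verts digraph_of = V" "arcs digraph_of = E" "tail digraph_of = fst" "head digraph_of = snd"
  by (simp_all add: digraph_of_def)

lemma cas_walk: "u \<in> V \<Longrightarrow> set p \<subseteq> E \<and> pre_digraph.cas digraph_of u p v \<longleftrightarrow> walk UNIV u p v"
proof (induction p arbitrary: u)
  case Nil
  then show ?case by (auto simp: pre_digraph.cas.simps)
next
  case (Cons e p)
  have "e \<in> E \<Longrightarrow> snd e \<in> V" using arcs_simps(2) by (simp add: mem_Times_iff)
  then show ?case using Cons.IH[of "snd e"] by (auto simp: pre_digraph.cas.simps)
qed

lemma awalk_iff: "pre_digraph.awalk digraph_of u p v \<longleftrightarrow> walk UNIV u p v"
  using cas_walk[of u p v] walk_start[of UNIV u p v] by (auto simp: pre_digraph.awalk_def)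

lemma awalk_verts_eq: "walk B u p v \<Longrightarrow> pre_digraph.awalk_verts digraph_of u p = u # map snd p"
  by (induction p arbitrary: u) (auto simp: pre_digraph.awalk_verts.simps)

lemma apath_iff: "pre_digraph.apath digraph_of u p v \<longleftrightarrow> path u p v"
  unfolding pre_digraph.apath_def awalk_iff path_def using awalk_verts_eq by metis

lemma path_weight_eq: "path_weight (\<lambda>e. \<omega> (\<kappa> e)) p = weight \<omega> p"
  by (simp add: path_weight_def weight_def)

text \<open>Minimality among paths extends to walks by loop erasure, and every suffix of a geodesic
  is a geodesic to the same root. For finiteness this inclusion is enough.\<close>

lemma geodesic_tree_subset:
  assumes good: "good \<omega>"
  shows "pre_digraph.geodesic_tree digraph_of (\<lambda>e. \<omega> (\<kappa> e)) (carrier G \<times> {0}) v \<subseteq> {u. root UNIV \<omega> u v}"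
proof
  fix z assume "z \<in> pre_digraph.geodesic_tree digraph_of (\<lambda>e. \<omega> (\<kappa> e)) (carrier G \<times> {0}) v"
  then obtain u p where up: "pre_digraph.geodesic_to_set digraph_of (\<lambda>e. \<omega> (\<kappa> e)) (carrier G \<times> {0}) u p v"
    and z: "z \<in> set (pre_digraph.awalk_verts digraph_of u p)"
    unfolding pre_digraph.geodesic_tree_def by blast
  then have v: "v \<in> carrier G \<times> {0}" and p: "path u p v"
    and opt: "ereal (weight \<omega> p) = pre_digraph.passage_time_set digraph_of (\<lambda>e. \<omega> (\<kappa> e)) u (carrier G \<times> {0})"
    by (auto simp: pre_digraph.geodesic_to_set_def apath_iff path_weight_eq)
  have w: "walk UNIV u p v" using p by (simp add: path_def)
  have "weight \<omega> p \<le> weight \<omega> q" if q: "walk UNIV u q w" "snd w = 0" for q w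
  proof -
    obtain q' where q': "walk UNIV u q' w" "distinct (u # map snd q')" "weight \<omega> q' \<le> weight \<omega> q"
      using walk_shorten[OF goodD(1)[OF good] q(1)] by blast
    have "w \<in> carrier G \<times> {0}" using walk_end[OF q(1)] q(2) by (simp add: mem_Times_iff)
    then have "ereal (weight \<omega> p) \<le> pre_digraph.passage_time digraph_of (\<lambda>e. \<omega> (\<kappa> e)) u w"
      unfolding opt pre_digraph.passage_time_set_def by (rule INF_lower)
    also have "\<dots> \<le> ereal (path_weight (\<lambda>e. \<omega> (\<kappa> e)) q')"
      unfolding pre_digraph.passage_time_def using q' by (intro INF_lower) (simp add: apath_iff path_def)
    finally show ?thesis using q'(3) by (simp add: path_weight_eq)
  qed
  then have g: "geod UNIV \<omega> u p v" using w v unfolding geod_def by (auto simp: mem_Times_iff)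
  have "z \<in> set (u # map snd p)" using z awalk_verts_eq[OF w] by simp
  then obtain p1 p2 where p12: "p = p1 @ p2" "walk UNIV u p1 z" using walk_through[OF w] by metis
  have "geod UNIV \<omega> z p2 v" using g p12 geod_suffix by blast
  then show "z \<in> {u. root UNIV \<omega> u v}" by (auto simp: root_def)
qed

end

context layered_percolation
begin

lemma pred_geodesic_to_set:
  "Measurable.pred P (\<lambda>\<omega>. pre_digraph.geodesic_to_set digraph_of (\<lambda>e. \<omega> (\<kappa> e)) (carrier G \<times> {0}) u p v)"
proof (cases "v \<in> carrier G \<times> {0} \<and> path u p v")
  case True
  have lists: "{p. path u p v} \<subseteq> lists E" for v by (auto simp: path_def dest: walk_subset)
  have m: "(\<lambda>\<omega>. ereal (weight \<omega> p)) \<in> borel_measurable P" if "path u p v" for p v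
    using that by (intro borel_measurable_ereal measurable_weight) (auto simp: path_def dest: walk_subset)
  have "(\<lambda>\<omega>. INF v\<in>carrier G \<times> {0}. INF p\<in>{p. path u p v}. ereal (weight \<omega> p)) \<in> borel_measurable P"
    using m by (intro borel_measurable_INF countable_V countable_subset[OF lists countable_lists_E]) auto
  then have "Measurable.pred P (\<lambda>\<omega>. ereal (weight \<omega> p) =
      (INF v\<in>carrier G \<times> {0}. INF p\<in>{p. path u p v}. ereal (weight \<omega> p)))"
    using m True unfolding pred_def by (intro borel_measurable_eq) auto
  then show ?thesis
    using True by (simp add: pre_digraph.geodesic_to_set_def pre_digraph.passage_time_set_def
        pre_digraph.passage_time_def apath_iff path_weight_eq)
next
  case False
  then have "\<not> pre_digraph.geodesic_to_set digraph_of (\<lambda>e. \<omega> (\<kappa> e)) (carrier G \<times> {0}) u p v" for \<omega>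
    by (auto simp: pre_digraph.geodesic_to_set_def apath_iff)
  then show ?thesis by simp
qed

text \<open>Almost sure finiteness has to be supplemented by measurability of the event, since
  \<open>measure\<close> vanishes on nonmeasurable sets.\<close>

lemma prob_finite_geodesic_tree:
  assumes x: "x \<in> carrier G"
  shows "measure P {\<omega> \<in> space P.
    finite (pre_digraph.geodesic_tree digraph_of (\<lambda>e. \<omega> (\<kappa> e)) (carrier G \<times> {0}) (x, 0))} = 1"
proof -
  let ?T = "\<lambda>\<omega>. pre_digraph.geodesic_tree digraph_of (\<lambda>e. \<omega> (\<kappa> e)) (carrier G \<times> {0}) (x, 0)"
  let ?g = "\<lambda>\<omega> u p. pre_digraph.geodesic_to_set digraph_of (\<lambda>e. \<omega> (\<kappa> e)) (carrier G \<times> {0}) u p (x, 0)"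
  have path: "path u p (x, 0)" if "?g \<omega> u p" for \<omega> u p
    using that by (simp add: pre_digraph.geodesic_to_set_def apath_iff)
  have T_iff: "z \<in> ?T \<omega> \<longleftrightarrow> (\<exists>u\<in>V. \<exists>p\<in>{p \<in> lists E. z \<in> set (u # map snd p)}. ?g \<omega> u p)" for z \<omega>
  proof
    assume "z \<in> ?T \<omega>"
    then obtain u p where up: "?g \<omega> u p" "z \<in> set (pre_digraph.awalk_verts digraph_of u p)"
      unfolding pre_digraph.geodesic_tree_def by blast
    have w: "walk UNIV u p (x, 0)" using path[OF up(1)] by (simp add: path_def)
    have "p \<in> {p \<in> lists E. z \<in> set (u # map snd p)}"
      using up(2) awalk_verts_eq[OF w] walk_subset[OF w] by auto
    with up(1) walk_start[OF w] show "\<exists>u\<in>V. \<exists>p\<in>{p \<in> lists E. z \<in> set (u # map snd p)}. ?g \<omega> u p" by blast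
  next
    assume "\<exists>u\<in>V. \<exists>p\<in>{p \<in> lists E. z \<in> set (u # map snd p)}. ?g \<omega> u p"
    then obtain u p where up: "?g \<omega> u p" "z \<in> set (u # map snd p)" by blast
    have w: "walk UNIV u p (x, 0)" using path[OF up(1)] by (simp add: path_def)
    have "z \<in> set (pre_digraph.awalk_verts digraph_of u p)" using up(2) awalk_verts_eq[OF w] by simp
    with up(1) show "z \<in> ?T \<omega>" unfolding pre_digraph.geodesic_tree_def by blast
  qed
  have T_V: "?T \<omega> \<subseteq> V" for \<omega>
  proof
    fix z assume "z \<in> ?T \<omega>"
    then obtain u p where up: "?g \<omega> u p" "z \<in> set (u # map snd p)" unfolding T_iff by blast
    have w: "walk UNIV u p (x, 0)" using path[OF up(1)] by (simp add: path_def)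
    obtain p1 where "walk UNIV u p1 z" using walk_through[OF w up(2)] by metis
    then show "z \<in> V" by (rule walk_end)
  qed
  have Tm: "Measurable.pred P (\<lambda>\<omega>. z \<in> ?T \<omega>)" for z
    unfolding T_iff
    by (intro pred_countable_Bex countable_V countable_subset[OF _ countable_lists_E] pred_geodesic_to_set) auto
  \<comment> \<open>There are only countably many finite subsets of \<open>V\<close>, so this form
    of finiteness uses countable quantifiers only.\<close>
  have "finite (?T \<omega>) \<longleftrightarrow> (\<exists>F\<in>{F. finite F \<and> F \<subseteq> V}. \<forall>z\<in>V - F. z \<notin> ?T \<omega>)" for \<omega>
  proof
    assume "finite (?T \<omega>)"
    then show "\<exists>F\<in>{F. finite F \<and> F \<subseteq> V}. \<forall>z\<in>V - F. z \<notin> ?T \<omega>"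
      using T_V by (intro bexI[of _ "?T \<omega>"]) auto
  next
    assume "\<exists>F\<in>{F. finite F \<and> F \<subseteq> V}. \<forall>z\<in>V - F. z \<notin> ?T \<omega>"
    then obtain F where F: "finite F" "\<forall>z\<in>V - F. z \<notin> ?T \<omega>"
      by (elim bexE CollectE conjE) (rule that)
    have "?T \<omega> \<subseteq> F"
    proof
      fix z assume z: "z \<in> ?T \<omega>"
      with subsetD[OF T_V z] F(2) show "z \<in> F" by (meson DiffI)
    qed
    then show "finite (?T \<omega>)" using F(1) by (rule finite_subset)
  qed
  moreover have "Measurable.pred P (\<lambda>\<omega>. \<exists>F\<in>{F. finite F \<and> F \<subseteq> V}. \<forall>z\<in>V - F. z \<notin> ?T \<omega>)"
    by (intro pred_countable_Bex pred_countable_Ball countable_Collect_finite_subset countable_V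
        countable_Diff pred_intros_logic Tm)
  ultimately have "{\<omega> \<in> space P. finite (?T \<omega>)} \<in> sets P" by (simp add: pred_def)
  moreover have "AE \<omega> in P. finite (?T \<omega>)"
    using AE_good AE_finite_tree[OF x] by eventually_elim (metis geodesic_tree_subset finite_subset)
  ultimately show ?thesis using P.prob_Collect_eq_1[of "\<lambda>\<omega>. finite (?T \<omega>)"] by simp
qed

end

section \<open>Words in the generators\<close>

context group
begin

definition word :: "'a list \<Rightarrow> 'a" where
  "word w = foldr (\<otimes>) w \<one>"

lemma word_simps [simp]: "word [] = \<one>" "word (s # w) = s \<otimes> word w"
  by (simp_all add: word_def)

lemma word_closed: "set w \<subseteq> carrier G \<Longrightarrow> word w \<in> carrier G"
  by (induction w) auto

lemma word_append: "set v \<subseteq> carrier G \<Longrightarrow> set w \<subseteq> carrier G \<Longrightarrow> word (v @ w) = word v \<otimes> word w"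
  by (induction v) (auto simp: m_assoc word_closed)

lemma generate_words:
  assumes S: "S \<subseteq> carrier G" "\<And>s. s \<in> S \<Longrightarrow> inv s \<in> S"
  shows "generate G S \<subseteq> word ` lists S"
proof
  fix h assume "h \<in> generate G S"
  then show "h \<in> word ` lists S"
  proof induction
    case one
    show ?case by (rule image_eqI[of _ _ "[]"]) auto
  next
    case (incl h)
    then show ?case using S by (intro image_eqI[of _ _ "[h]"]) auto
  next
    case (inv h)
    then show ?case using S by (intro image_eqI[of _ _ "[inv h]"]) auto
  next
    case (eng h1 h2)
    then obtain v w where "v \<in> lists S" "w \<in> lists S" "h1 = word v" "h2 = word w" by blast
    moreover from this have "word (v @ w) = word v \<otimes> word w" using S(1) by (intro word_append) auto
    ultimately show ?case by (intro image_eqI[of _ _ "v @ w"]) auto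
  qed
qed

definition words :: "'a set \<Rightarrow> nat \<Rightarrow> 'a set" where
  "words S n = word ` {w \<in> lists S. length w = n}"

lemma finite_words: "finite S \<Longrightarrow> finite (words S n)"
  unfolding words_def using finite_lists_length_eq[of S n] by (simp add: lists_eq_set)

text \<open>Prepending \<open>s\<close> and its inverse keeps the product and adds two
  letters.\<close>

lemma words_mono:
  assumes S: "S \<subseteq> carrier G" "\<And>s. s \<in> S \<Longrightarrow> inv s \<in> S" "s \<in> S"
  shows "words S n \<subseteq> words S (n + 2 * i)"
proof (induction i)
  case (Suc i)
  have "words S m \<subseteq> words S (Suc (Suc m))" for m
  proof
    fix h assume "h \<in> words S m"
    then obtain w where w: "w \<in> lists S" "length w = m" "h = word w" by (auto simp: words_def)
    have "word w \<in> carrier G" using w(1) S(1) by (intro word_closed) auto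
    then have "word (s # inv s # w) = h" using S w by (auto simp: m_assoc[symmetric])
    then show "h \<in> words S (Suc (Suc m))"
      unfolding words_def using S w by (intro image_eqI[of _ _ "s # inv s # w"]) auto
  qed
  with Suc show ?case by fastforce
qed simp

text \<open>Words of the same parity form an increasing chain, so one parity class already fills up \<open>G\<close>.\<close>
lemma words_unbounded:
  assumes S: "finite S" "S \<subseteq> carrier G" "\<And>s. s \<in> S \<Longrightarrow> inv s \<in> S" "s \<in> S"
    and gen: "generate G S = carrier G" and inf: "infinite (carrier G)"
  shows "\<exists>n. M < card (words S n)"
proof -
  \<comment> \<open>Of \<open>2 * M + 2\<close> elements, more than \<open>M\<close> have chosen
    word lengths of the same parity; the longest of these lengths then serves for all of
    them.\<close>
  obtain T where T: "finite T" "card T = 2 * M + 2" "T \<subseteq> carrier G"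
    using infinite_arbitrarily_large[OF inf] by metis
  have "\<exists>n. h \<in> words S n" if "h \<in> T" for h
  proof -
    have "h \<in> word ` lists S" using generate_words[OF S(2,3)] gen T(3) that by blast
    then show ?thesis by (auto simp: words_def)
  qed
  then obtain f where f: "\<And>h. h \<in> T \<Longrightarrow> h \<in> words S (f h)" by metis
  let ?Te = "{h \<in> T. even (f h)}" and ?To = "{h \<in> T. odd (f h)}"
  have *: "\<exists>n. M < card (words S n)" if U: "U \<subseteq> T" "M < card U" and par: "\<And>h. h \<in> U \<Longrightarrow> f h mod 2 = b" for U b
  proof -
    have fin: "finite U" using U(1) T(1) by (rule finite_subset)
    have ne: "U \<noteq> {}" using U(2) by auto
    let ?n = "Max (f ` U)"
    have "?n \<in> f ` U" using fin ne by (intro Max_in) auto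
    then obtain h0 where h0: "?n = f h0" "h0 \<in> U" by (rule imageE)
    have "U \<subseteq> words S ?n"
    proof
      fix h assume h: "h \<in> U"
      have "f h \<le> ?n" using fin h by auto
      moreover have "f h mod 2 = ?n mod 2" using par[OF h] par[OF h0(2)] h0(1) by simp
      ultimately have "2 dvd ?n - f h" using mod_eq_dvd_iff_nat[of "f h" ?n 2] by simp
      then obtain i where "?n - f h = 2 * i" by (rule dvdE)
      with \<open>f h \<le> ?n\<close> have "?n = f h + 2 * i" by simp
      then show "h \<in> words S ?n" using words_mono[OF S(2,3,4), of "f h" i] f h U(1) by auto
    qed
    then have "card U \<le> card (words S ?n)" using finite_words[OF S(1)] by (intro card_mono)
    with U(2) show ?thesis by (intro exI[of _ ?n]) simp
  qed
  have "card T = card ?Te + card ?To"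
    using T(1) by (subst card_Un_disjoint[symmetric]) (auto intro!: arg_cong[where f = card])
  then consider "M < card ?Te" | "M < card ?To" using T(2) by linarith
  then show ?thesis
  proof cases
    case 1
    then show ?thesis by (rule *[of ?Te 0, rotated]) auto
  next
    case 2
    then show ?thesis by (rule *[of ?To 1, rotated]) (auto simp: odd_iff_mod_2_eq_one)
  qed
qed

end

section \<open>The weight distribution\<close>

lemma nonatomic_singleton:
  assumes "real_distribution M" "nonatomic M"
  shows "emeasure M {t} = 0"
proof (rule ccontr)
  interpret real_distribution M by fact
  assume "emeasure M {t} \<noteq> 0"
  then have "0 < emeasure M {t}" by (simp add: zero_less_iff_neq_zero)
  moreover have "{t} \<in> sets M" by simp
  ultimately obtain B where "B \<subseteq> {t}" "0 < emeasure M B" "emeasure M B < emeasure M {t}"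
    using assms(2) unfolding nonatomic_def by blast
  then show False by (cases "B = {}") (auto dest: subset_singletonD)
qed

lemma exists_quantile:
  assumes M: "real_distribution M" "\<And>t. measure M {t} = 0" and 0: "cdf M 0 = 0" and c: "0 < c" "c < 1"
  shows "\<exists>t. cdf M t = c"
proof -
  interpret real_distribution M by fact
  have cont: "isCont (cdf M) t" for t using isCont_cdf M(2) by blast
  have "\<forall>\<^sub>F t in at_top. c < cdf M t" using order_tendstoD(1)[OF cdf_lim_at_top_prob c(2)] .
  then obtain b where b: "\<And>t. b \<le> t \<Longrightarrow> c < cdf M t" by (auto simp: eventually_at_top_linorder)
  have "\<exists>t\<ge>0. t \<le> max 0 b \<and> cdf M t = c"
    using b[of "max 0 b"] 0 c cont by (intro IVT) auto
  then show ?thesis by blast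
qed

text \<open>The \<open>c\<close>-quantile and the \<open>c / 2\<close>-quantile of a continuous
  distribution function that vanishes at 0; monotonicity puts them in order and the former above
  0.\<close>

lemma exists_low_high:
  assumes M: "real_distribution M" "nonatomic M" "measure M {0..} = 1" and c: "0 < c" "c < 1"
  shows "\<exists>lo hi. lo < hi \<and> 0 < hi \<and> 0 < measure M {..lo} \<and> measure M {..<hi} = c"
proof -
  interpret real_distribution M by fact
  have single: "measure M {t} = 0" for t using nonatomic_singleton[OF M(1,2)] by (simp add: measure_def)
  have lt: "measure M {..<t} = cdf M t" for t
  proof -
    have "measure M {..t} = measure M {..<t} + measure M {t}"
      by (subst finite_measure_Union[symmetric]) (auto intro!: arg_cong[where f = "measure M"])
    then show ?thesis using single by (simp add: cdf_def)
  qed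
  have "measure M {..<0} = 0"
    using prob_compl[of "{0::real..}"] M(3) by (simp add: Compl_eq_Diff_UNIV[symmetric] Compl_atLeast)
  then have 0: "cdf M 0 = 0" using lt by simp
  obtain hi where hi: "cdf M hi = c" using exists_quantile[OF M(1) single 0 c] by blast
  obtain lo where lo: "cdf M lo = c / 2" using exists_quantile[OF M(1) single 0, of "c / 2"] c by auto
  have "lo < hi" using cdf_nondecreasing[of hi lo] hi lo c by (force simp: not_less[symmetric])
  moreover have "0 < hi" using cdf_nondecreasing[of hi 0] hi 0 c by (force simp: not_less[symmetric])
  ultimately show ?thesis using hi lo lt c by (intro exI[of _ lo] exI[of _ hi]) (auto simp: cdf_def)
qed

section \<open>Finiteness of the geodesic trees\<close>

context layered_graph
begin

text \<open>Strict inequality between the length of the word and \<open>n\<close> keeps the start of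
  every step on a positive level, where generator steps exist in both graphs.\<close>

lemma word_walk:
  assumes "group G" and S: "S \<subseteq> carrier G" and "d \<le> 1"
    and step: "\<And>y s n. y \<in> carrier G \<Longrightarrow> s \<in> S \<Longrightarrow> ((y, Suc n), (y \<otimes> s, Suc n - d)) \<in> E"
  shows "w \<in> lists S \<Longrightarrow> y \<in> carrier G \<Longrightarrow> length w < n \<Longrightarrow>
    \<exists>\<sigma>. walk {..n} (y, n) \<sigma> (y \<otimes> group.word G w, n - d * length w) \<and> length \<sigma> = length w"
proof (induction w arbitrary: y n)
  case Nil
  interpret group G by fact
  show ?case using Nil by (intro exI[of _ "[]"]) simp
next
  case (Cons s w)
  interpret group G by fact
  obtain n' where n: "n = Suc n'" using Cons.prems(3) by (cases n) auto
  have s: "s \<in> S" "s \<in> carrier G" "w \<in> lists S" and w: "word w \<in> carrier G"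
    using Cons.prems(1) S by (auto intro!: word_closed)
  have "length w < n - d" using Cons.prems(3) \<open>d \<le> 1\<close> by simp
  from Cons.IH[OF s(3) _ this, of "y \<otimes> s"] obtain \<sigma> where \<sigma>:
    "walk {..n - d} (y \<otimes> s, n - d) \<sigma> (y \<otimes> s \<otimes> word w, n - d - d * length w)" "length \<sigma> = length w"
    using s Cons.prems(2) by auto
  have "walk {..n} (y \<otimes> s, n - d) \<sigma> (y \<otimes> s \<otimes> word w, n - d - d * length w)"
    using \<sigma>(1) by (rule walk_mono) auto
  moreover have "((y, n), (y \<otimes> s, n - d)) \<in> E" using step[OF Cons.prems(2) s(1), of n'] n by simp
  moreover have "y \<otimes> s \<otimes> word w = y \<otimes> word (s # w)" "n - d - d * length w = n - d * length (s # w)"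
    using s w Cons.prems(2) by (simp_all add: m_assoc)
  ultimately show ?case using \<sigma>(2)
    by (intro exI[of _ "((y, n), (y \<otimes> s, n - d)) # \<sigma>"]) simp
qed

text \<open>Words of length \<open>J\<close> with different products lead from \<open>y\<close> to
  different vertices, by cancellation in the group. The set of endpoints must also be finite, so
  that its \<open>card\<close> can be bounded from below by a subset.\<close>

lemma exists_many_connectors:
  assumes G: "group G" "infinite (carrier G)"
    and S: "finite S" "S \<subseteq> carrier G" "generate G S = carrier G" "\<And>s. s \<in> S \<Longrightarrow> inv s \<in> S" "s \<in> S"
    and d: "d \<le> 1"
    and step: "\<And>y s n. y \<in> carrier G \<Longrightarrow> s \<in> S \<Longrightarrow> ((y, Suc n), (y \<otimes> s, Suc n - d)) \<in> E"
    and fin: "\<And>v. finite {w. (v, w) \<in> E}"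
  shows "\<exists>J. \<forall>y\<in>carrier G. \<forall>n>J. M <
    card {v. \<exists>\<sigma>. walk {..n} (y, n) \<sigma> v \<and> length \<sigma> = J \<and> snd v = n - d * J}"
proof -
  interpret group G by fact
  obtain J where J: "M < card (words S J)"
    using words_unbounded[OF S(1,2,4,5,3) G(2)] by blast
  have "M < card {v. \<exists>\<sigma>. walk {..n} (y, n) \<sigma> v \<and> length \<sigma> = J \<and> snd v = n - d * J}" (is "_ < card ?A")
    if y: "y \<in> carrier G" and n: "J < n" for y n
  proof -
    have WG: "words S J \<subseteq> carrier G" using S(2) by (auto simp: words_def intro!: word_closed)
    have "?A \<subseteq> (\<lambda>\<sigma>. last ((y, n) # map snd \<sigma>)) ` {\<sigma>. length \<sigma> = J \<and> (\<exists>v. walk {..n} (y, n) \<sigma> v)}"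
    proof
      fix v assume "v \<in> ?A"
      then obtain \<sigma> where \<sigma>: "walk {..n} (y, n) \<sigma> v" "length \<sigma> = J" by blast
      then have "\<sigma> \<in> {\<sigma>. length \<sigma> = J \<and> (\<exists>v. walk {..n} (y, n) \<sigma> v)}" by blast
      with walk_last[OF \<sigma>(1)] show "v \<in> (\<lambda>\<sigma>. last ((y, n) # map snd \<sigma>)) ` {\<sigma>. length \<sigma> = J \<and> (\<exists>v. walk {..n} (y, n) \<sigma> v)}"
        by (rule image_eqI)
    qed
    then have "finite ?A" by (rule finite_subset) (intro finite_imageI finite_walks fin)
    moreover have "(\<lambda>h. (y \<otimes> h, n - d * J)) ` words S J \<subseteq> ?A"
    proof
      fix v assume "v \<in> (\<lambda>h. (y \<otimes> h, n - d * J)) ` words S J"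
      then obtain w where w: "w \<in> lists S" "length w = J" "v = (y \<otimes> word w, n - d * J)"
        by (auto simp: words_def)
      have "length w < n" using n w(2) by simp
      from word_walk[OF G(1) S(2) d step w(1) y this] obtain \<sigma> where
        "walk {..n} (y, n) \<sigma> (y \<otimes> word w, n - d * length w)" "length \<sigma> = length w" by blast
      with w(2,3) show "v \<in> ?A" by (intro CollectI exI[of _ \<sigma>]) simp
    qed
    moreover have "inj_on (\<lambda>h. (y \<otimes> h, n - d * J)) (words S J)"
    proof (rule inj_onI)
      fix a b assume "a \<in> words S J" "b \<in> words S J" "(y \<otimes> a, n - d * J) = (y \<otimes> b, n - d * J)"
      then have "a \<in> carrier G" "b \<in> carrier G" "y \<otimes> a = y \<otimes> b" using WG by auto
      then show "a = b" using Units_l_cancel[of y a b] y by (simp add: Units_eq)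
    qed
    ultimately have "card (words S J) \<le> card ?A" by - (rule card_inj_on_le)
    with J show ?thesis by simp
  qed
  then show ?thesis by blast
qed

end

theorem theorem1p1:
  fixes G :: "('g, 'm) monoid_scheme" and S :: "'g set" and \<mu> :: "real measure"
  assumes "group G" and "infinite (carrier G)"
    and "finite S" and "S \<subseteq> carrier G" and "generate G S = carrier G"
    and "\<And>s. s \<in> S \<Longrightarrow> inv\<^bsub>G\<^esub> s \<in> S" and "\<one>\<^bsub>G\<^esub> \<notin> S"
    and "real_distribution \<mu>" and "nonatomic \<mu>"
    and "measure \<mu> {0..} = 1" and "integrable \<mu> (\<lambda>t. t)"
  shows "\<forall>x\<in>carrier G.
     measure (hat_P G S \<mu>) {\<omega> \<in> space (hat_P G S \<mu>). finite (hat_tree G S \<omega> x)} = 1 \<and>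
     measure (bar_P G S \<mu>) {\<omega> \<in> space (bar_P G S \<mu>). finite (bar_tree G S \<omega> x)} = 1"
proof
  fix x assume x: "x \<in> carrier G"
  interpret G: group G by fact
  interpret \<mu>: real_distribution \<mu> by fact
  note S = assms(3-6)
  \<comment> \<open>The two additional neighbours are the vertical ones of the undirected graph. The
    same bound serves the directed graph, so one choice of \<open>lo\<close> and \<open>hi\<close>
    works for both.\<close>
  let ?\<Delta> = "card S + 2"
  have "S \<noteq> {}"
  proof
    assume "S = {}"
    then have "carrier G = {\<one>\<^bsub>G\<^esub>}" using assms(5) G.generate_empty by simp
    then have "finite (carrier G)" by simp
    with assms(2) show False by simp
  qed
  then obtain s0 where s0: "s0 \<in> S" by blast
  have countable: "countable (carrier G)"
  proof -
    have "countable (G.word ` lists S)" using S(1) by (intro countable_image countable_lists countable_finite)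
    moreover have "carrier G \<subseteq> G.word ` lists S" using G.generate_words[OF S(2,4)] S(3) by simp
    ultimately show ?thesis by (rule countable_subset[rotated])
  qed
  have atoms: "emeasure \<mu> {t} = 0" for t using nonatomic_singleton[OF assms(8,9)] .
  have pos: "AE t in \<mu>. 0 < t"
  proof -
    have "AE t in \<mu>. t \<in> {0..}" using \<mu>.prob_eq_1[of "{0..}"] assms(10) by simp
    moreover have "AE t in \<mu>. t \<notin> {0}" using atoms[of 0] by (intro AE_not_in) (simp add: null_sets_def)
    ultimately show ?thesis by eventually_elim auto
  qed
  have \<Delta>: "0 < 1 / (4 * real ?\<Delta>)" "1 / (4 * real ?\<Delta>) < 1" by (auto simp: field_simps)
  obtain lo hi where lohi: "lo < hi" "0 < hi" "0 < measure \<mu> {..lo}" "measure \<mu> {..<hi} = 1 / (4 * real ?\<Delta>)"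
    using exists_low_high[OF assms(8-10) \<Delta>] by blast
  have deg: "finite A \<and> card A \<le> ?\<Delta>" if "A \<subseteq> f ` S \<union> {a, b}" for A and f :: "'g \<Rightarrow> 'g \<times> nat" and a b
  proof -
    have fin: "finite (f ` S \<union> {a, b})" using S(1) by simp
    have "card A \<le> card (f ` S \<union> {a, b})" using fin that by (rule card_mono)
    also have "\<dots> \<le> card (f ` S) + card {a, b}" by (rule card_Un_le)
    also have "\<dots> \<le> card S + 2" using card_image_le[OF S(1), of f] by (intro add_mono) (auto simp: card_insert_if)
    finally show ?thesis using finite_subset[OF that fin] by simp
  qed
  have inv_mult: "(y \<otimes>\<^bsub>G\<^esub> inv\<^bsub>G\<^esub> s) \<otimes>\<^bsub>G\<^esub> s = y" "(y \<otimes>\<^bsub>G\<^esub> s) \<otimes>\<^bsub>G\<^esub> inv\<^bsub>G\<^esub> s = y"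
    if "y \<in> carrier G" "s \<in> S" for y s
    using that S(2) by (auto simp: G.m_assoc subset_eq)
  have nbr: "\<exists>t\<in>S. x = y \<otimes>\<^bsub>G\<^esub> t" if "cayley_nbr G S x y" for x y
    using that inv_mult(2) S(4) unfolding cayley_nbr_def by metis
  have nbr_step: "cayley_nbr G S y (y \<otimes>\<^bsub>G\<^esub> s)" "cayley_nbr G S (y \<otimes>\<^bsub>G\<^esub> s) y" if "y \<in> carrier G" "s \<in> S" for y s
  proof -
    have c: "y \<otimes>\<^bsub>G\<^esub> s \<in> carrier G" using that S(2) by auto
    show "cayley_nbr G S y (y \<otimes>\<^bsub>G\<^esub> s)" unfolding cayley_nbr_def using that c by blast
    show "cayley_nbr G S (y \<otimes>\<^bsub>G\<^esub> s) y"
      unfolding cayley_nbr_def using that c S(4) inv_mult(2)[OF that] by metis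
  qed
  have nbr_translate: "cayley_nbr G S (g \<otimes>\<^bsub>G\<^esub> y) (g \<otimes>\<^bsub>G\<^esub> z)" if "g \<in> carrier G" "cayley_nbr G S y z" for g y z
    using that S(2) unfolding cayley_nbr_def by (auto simp: G.m_assoc subset_eq)
  show "measure (hat_P G S \<mu>) {\<omega> \<in> space (hat_P G S \<mu>). finite (hat_tree G S \<omega> x)} = 1 \<and>
     measure (bar_P G S \<mu>) {\<omega> \<in> space (bar_P G S \<mu>). finite (bar_tree G S \<omega> x)} = 1"
  proof
    define E where "E = arcs (hat_graph G S)"
    have E_iff: "((y, i), (z, j)) \<in> E \<longleftrightarrow> i = Suc j \<and> cayley_nbr G S z y" for y i z j
      by (auto simp: hat_graph_def E_def)
    interpret H: layered_graph G E "\<lambda>e. e"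
    proof
      fix y :: 'g and i :: nat assume "y \<in> carrier G"
      then show "\<exists>z. ((y, Suc i), (z, i)) \<in> E" using nbr_step(2) s0 E_iff by blast
    qed (auto simp: E_iff cayley_nbr_def)
    \<comment> \<open>The doubled vertex pads the set to the shape expected by
      \<open>deg\<close>.\<close>
    have out: "{w. ((y, i), w) \<in> E} \<subseteq> (\<lambda>s. (y \<otimes>\<^bsub>G\<^esub> s, i - 1)) ` S \<union> {(y, i), (y, i)}" for y i
    proof (intro subsetI UnI1)
      fix w assume w: "w \<in> {w. ((y, i), w) \<in> E}"
      then have i: "i = Suc (snd w)" and "cayley_nbr G S (fst w) y" using E_iff[of y i "fst w" "snd w"] by simp_all
      then obtain t where "t \<in> S" "fst w = y \<otimes>\<^bsub>G\<^esub> t" using nbr by blast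
      with i show "w \<in> (\<lambda>s. (y \<otimes>\<^bsub>G\<^esub> s, i - 1)) ` S" by (cases w) auto
    qed
    have "in": "{w. (w, (y, i)) \<in> E} \<subseteq> (\<lambda>s. (y \<otimes>\<^bsub>G\<^esub> s, Suc i)) ` S \<union> {(y, i), (y, i)}" for y i
      by (auto simp: E_iff cayley_nbr_def)
    \<comment> \<open>Labels are the arcs themselves. Every generator step lowers the level by one,
      hence \<open>\<delta> = 1\<close>.\<close>
    interpret H: layered_percolation G E "\<lambda>e. e" "\<lambda>g (u, v). (translate G g u, translate G g v)" \<mu> ?\<Delta> 1 lo hi
    proof
      show "\<exists>J. \<forall>y\<in>carrier G. \<forall>n>J. M < card {v. \<exists>\<sigma>. H.walk {..n} (y, n) \<sigma> v \<and> length \<sigma> = J \<and> snd v = n - 1 * J}" for M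
        using deg[OF out] nbr_step(2)
        by (intro H.exists_many_connectors[OF assms(1,2) S s0]) (auto simp: E_iff)
    qed (use countable atoms pos assms(11) lohi deg[OF out] deg[OF "in"] nbr_translate \<mu>.prob_space_axioms in
        \<open>auto simp: translate_def E_iff\<close>)
    have "hat_P G S \<mu> = H.P" by (simp add: hat_P_def E_def)
    moreover have "hat_graph G S = H.digraph_of" unfolding H.digraph_of_def by (simp add: hat_graph_def E_def)
    ultimately show "measure (hat_P G S \<mu>) {\<omega> \<in> space (hat_P G S \<mu>). finite (hat_tree G S \<omega> x)} = 1"
      using H.prob_finite_geodesic_tree[OF x] by (simp add: hat_tree_def level0_def)
  next
    define E where "E = {(u, v). bar_adj G S u v}"
    let ?\<kappa> = "\<lambda>(u :: 'g \<times> nat, v). {u, v}"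
    have E_iff: "((y, i), (z, j)) \<in> E \<longleftrightarrow> cayley_nbr G S y z \<and> i = j \<and> j \<ge> 1 \<or>
        y \<in> carrier G \<and> y = z \<and> (i = Suc j \<or> j = Suc i)" for y i z j
      by (auto simp: bar_adj_def E_def)
    interpret B: layered_graph G E ?\<kappa>
    proof
      fix y :: 'g and i :: nat assume "y \<in> carrier G"
      then show "\<exists>z. ((y, Suc i), (z, i)) \<in> E" using E_iff by blast
    next
      fix a b :: "('g \<times> nat) \<times> ('g \<times> nat)" assume "?\<kappa> a = ?\<kappa> b"
      then show "b = a \<or> b = (snd a, fst a)" by (cases a; cases b) (auto simp: doubleton_eq_iff)
    qed (auto simp: E_iff cayley_nbr_def)
    have out: "{w. ((y, i), w) \<in> E} \<subseteq> (\<lambda>s. (y \<otimes>\<^bsub>G\<^esub> s, i)) ` S \<union> {(y, i - 1), (y, Suc i)}" for y i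
      by (auto simp: E_iff cayley_nbr_def)
    have "in": "{w. (w, (y, i)) \<in> E} \<subseteq> (\<lambda>s. (y \<otimes>\<^bsub>G\<^esub> s, i)) ` S \<union> {(y, i - 1), (y, Suc i)}" for y i
    proof
      fix w assume w: "w \<in> {w. (w, (y, i)) \<in> E}"
      then consider "cayley_nbr G S (fst w) y" "snd w = i" | "fst w = y" "snd w = Suc i \<or> i = Suc (snd w)"
        using E_iff[of "fst w" "snd w" y i] by auto
      then show "w \<in> (\<lambda>s. (y \<otimes>\<^bsub>G\<^esub> s, i)) ` S \<union> {(y, i - 1), (y, Suc i)}"
      proof cases
        case 1
        then obtain t where "t \<in> S" "fst w = y \<otimes>\<^bsub>G\<^esub> t" using nbr by blast
        with 1(2) show ?thesis by (cases w) auto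
      next
        case 2
        then show ?thesis by (cases w) auto
      qed
    qed
    \<comment> \<open>Labels are two-element vertex sets, on which the group acts by taking images.
      Generator steps stay on their level, hence \<open>\<delta> = 0\<close>.\<close>
    interpret B: layered_percolation G E ?\<kappa> "\<lambda>g e. translate G g ` e" \<mu> ?\<Delta> 0 lo hi
    proof
      show "\<exists>J. \<forall>y\<in>carrier G. \<forall>n>J. M < card {v. \<exists>\<sigma>. B.walk {..n} (y, n) \<sigma> v \<and> length \<sigma> = J \<and> snd v = n - 0 * J}" for M
        using deg[OF out] nbr_step(1)
        by (intro B.exists_many_connectors[OF assms(1,2) S s0]) (auto simp: E_iff)
    qed (use countable atoms pos assms(11) lohi deg[OF out] deg[OF "in"] nbr_translate \<mu>.prob_space_axioms in
        \<open>auto simp: translate_def E_iff\<close>)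
    have "bar_edges G S = ?\<kappa> ` E" unfolding bar_edges_def E_def by (auto simp: image_iff)
    then have "bar_P G S \<mu> = B.P" by (simp add: bar_P_def)
    moreover have "bar_graph G S = B.digraph_of" unfolding B.digraph_of_def by (simp add: bar_graph_def E_def)
    moreover have "(\<lambda>(u, v). \<omega> {u, v}) = (\<lambda>e. \<omega> (?\<kappa> e))" for \<omega> :: "('g \<times> nat) set \<Rightarrow> real" by auto
    ultimately show "measure (bar_P G S \<mu>) {\<omega> \<in> space (bar_P G S \<mu>). finite (bar_tree G S \<omega> x)} = 1"
      using B.prob_finite_geodesic_tree[OF x] by (simp add: bar_tree_def level0_def)
  qed
qed

end
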